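(* Let $d,p,s\in\mathbb{N}$, $m\in\mathbb{N}_0$, $\Theta\subset\mathbb{R}^p$, $\theta_0\in\Theta$ and $k=2p+1$. Let the noise sequences, the mappings $G_u^{(i,r)}$, $u\in[0,1]$, the random Fourier features $\varphi=(\varphi_1,\dots,\varphi_k)$ with drawn parameters $(\vartheta_1,\dots,\vartheta_k)$, and the rolling-window estimator $\hat\theta^{\mathrm{RW}}$ (with window size $w_n$, offset $\tau_n$, lag $L_n$) be as in the context. Suppose the following hold. (B1) For each $n\in\mathbb{N}$, the observed and simulated time series of length $n$ are $X_t^{\mathrm{obs}}=G_{t/n}^{(n,0)}(\boldsymbol{\varepsilon}_t^{(0)},\theta_0)$ and $X_t^{(r)}(\theta)=G_{t/n}^{(n,r)}(\boldsymbol{\varepsilon}_t^{(r)},\theta)$, $t=1,\dots,n$, for all $r=1,\dots,s$ and $\theta\in\Theta$. (B2) For each $u\in[0,1]$ there is a measurable mapping $G_u:\mathbb{R}^\infty\times\Theta\to\mathbb{R}^d$ such that $(G_u(\boldsymbol{\varepsilon}_j,\theta))_{j\in\mathbb{Z}}$ is a stationary ergodic process, and for some $q>2$, as $i\to\infty$, $$\sup_{\theta\in\Theta}\sup_{u\in[0,1]}\max_{0\le r\le s}\big\|G_u^{(i,r)}(\boldsymbol{\varepsilon}_0,\theta)-G_u(\boldsymbol{\varepsilon}_0,\theta)\big\|_{\mathcal{L}^q(\theta)}\to0 .$$ (B3) There is $\tilde p\in\mathbb{N}$ such that for each $u\in[0,1]$ there exists a Lipschitz, semialgebraic mapping $g_u:\Theta\to\mathbb{R}^{\tilde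 p}$, written $g_u(\theta)=\tilde\theta_u$, with image $\tilde\Theta_u=\{g_u(\theta):\theta\in\Theta\}\subset\mathbb{R}^{\tilde p}$, and a measurable mapping $\tilde G_u:\mathbb{R}^\infty\times\tilde\Theta_u\to\mathbb{R}^d$ such that $\tilde G_u(\boldsymbol{\varepsilon}_0,\tilde\theta_u)=G_u(\boldsymbol{\varepsilon}_0,\theta)$ whenever $\tilde\theta_u=g_u(\theta)$, where $(\tilde G_u(\boldsymbol{\varepsilon}_j,\tilde\theta_u))_{j\in\mathbb{Z}}$ is a stationary ergodic process for each fixed $u$. Furthermore, $(u,\theta)\mapsto g_u(\theta)$ is jointly Borel measurable. Let $P_{\theta,u}$ denote the distribution of $[G_u(\boldsymbol{\varepsilon}_{-m},\theta),\dots,G_u(\boldsymbol{\varepsilon}_0,\theta)]^\top$, $\tilde P_{\tilde\theta_u,u}$ the distribution of $[\tilde G_u(\boldsymbol{\varepsilon}_{-m},\tilde\theta_u),\dots,\tilde G_u(\boldsymbol{\varepsilon}_0,\tilde\theta_u)]^\top$, and $\tilde\psi_{\tilde\theta_u,u}$ the characteristic function of $\tilde P_{\tilde\theta_u,u}$. (B4) For all $u\in[0,1]$: (i) $\tilde\Theta_u\subset\mathbb{R}^{\tilde p}$ is compact, and $\Theta\subset\mathbb{R}^p$ is compact and semialgebraic with non-empty interior; (ii) the map $\tilde\theta_u\mapsto\tilde P_{\tilde\theta_u,u}$ is injective on $\tilde\Theta_u$; (iii) the map $(\tilde\theta_u,\omega)\mapsto\tilde\psi_{\tilde\theta_u,u}(\omega)$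 admits a jointly real analytic extension to $\tilde O_u\times\mathbb{R}^{(m+1)\times d}$, where $\tilde O_u\subset\mathbb{R}^{\tilde p}$ is an open neighborhood of $\tilde\Theta_u$. (B5) (i) The set-valued map $u\mapsto\tilde\Theta_u$ is weakly Borel measurable. (ii) There exists a jointly Borel measurable function $\bar\psi:[0,1]\times\mathbb{R}^{\tilde p}\times\mathbb{R}^{(m+1)\times d}\to\mathbb{C}$ such that $\bar\psi(u,\tilde\theta_u,\omega)=\tilde\psi_{\tilde\theta_u,u}(\omega)$ for all $u\in[0,1]$, $\tilde\theta_u\in\tilde\Theta_u$, $\omega\in\mathbb{R}^{(m+1)\times d}$, and $\bar\psi$ is continuous in its second argument for each fixed $(u,\omega)$. (B6) The parameters $(\vartheta_1,\dots,\vartheta_k)$ that have been drawn yield mappings $\tilde\Phi_u:\tilde\Theta_u\to\mathbb{R}^k$, $\tilde\Phi_u(\tilde\theta_u)=\int_{\mathbb{R}^{(m+1)\times d}}\varphi(x)\,d\tilde P_{\tilde\theta_u,u}(x)$, $u\in[0,1]$, that are one-to-one for almost every $u\in[0,1]$. (B7) For all $\theta_1,\theta_2\in\Theta$ with $\theta_1\ne\theta_2$ there exists a subset $\mathcal{U}_{\theta_1,\theta_2}\subseteq[0,1]$ with positive Lebesgue measure such that $P_{\theta_1,u}\ne P_{\theta_2,u}$ for all $u\in\mathcal{U}_{\theta_1,\theta_2}$. (B8) For all $\epsilon>0$ there exists $\eta_G=\eta_G(\epsilon)>0$ such that $$\sup_{i\in\mathbb{N}}\sup_{u\in[0,1]}\max_{0\le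 r\le s}\mathbb{E}\Big(\sup_{\theta,\theta'\in\Theta,\ \|\theta-\theta'\|\le\epsilon}\big\|G_u^{(i,r)}(\boldsymbol{\varepsilon}_0,\theta)-G_u^{(i,r)}(\boldsymbol{\varepsilon}_0,\theta')\big\|^2\Big)<\eta_G,$$ with $\eta_G\to0$ as $\epsilon\to0$, where $\mathbb{E}$ is expectation with respect to the law of the noise inputs. (B9) There exist constants $\rho\in(0,1)$, $\Lambda>0$ such that, for some $q>2$ and all $j\in\mathbb{N}_0$, $$\sup_{i\in\mathbb{N}}\sup_{\theta\in\Theta}\sup_{u\in[0,1]}\max_{0\le r\le s}\big\|G_u^{(i,r)}(\boldsymbol{\varepsilon}_0,\theta)-G_u^{(i,r)}(\tilde{\boldsymbol{\varepsilon}}_{0,j},\theta)\big\|_{\mathcal{L}^q(\theta)}\le\Lambda\rho^j,$$ $$\sup_{i\in\mathbb{N}}\sup_{\theta\in\Theta}\sup_{u\in[0,1]}\max_{0\le r\le s}\big\|G_u^{(i,r)}(\boldsymbol{\varepsilon}_0,\theta)\big\|_{\mathcal{L}^q(\theta)}\le\Lambda .$$ (B10) For some $q>2$ and some $\kappa\in[1,4)$, the constant $\Lambda>0$ from (B9) also satisfies $$\sup_{i\in\mathbb{N}}\sup_{\theta\in\Theta}\max_{0\le r\le s}\Big(\sup_{u\in[0,1]}\big\|G_u^{(i,r)}(\boldsymbol{\varepsilon}_0,\theta)\big\|_{\mathcal{L}^q(\theta)}+\big\|(G_u^{(i,r)}(\boldsymbol{\varepsilon}_0,\theta))_u\big\|_{\kappa\text{-}\mathrm{var},\mathcal{L}^q(\theta)}\Big)\le\Lambda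 .$$ (B11) With $q$ from (B9) and $\kappa$ from (B10), the sequences $(w_n),(\tau_n),(L_n)$ satisfy: (i) $\tau_n=o(n)$; (ii) $w_n\gg n^{2/q}$, $w_n=o(n)$, and $w_nn^{\max(1-2/\kappa,0)}=o(n)$; (iii) $L_n\gg\log(n)^{1+a}$ for some $a\in(0,1)$, $L_n\ll\tau_n$, $L_n\ll n^{\frac1\kappa-\frac14}$, and $L_n=o(n^{\frac1{2\kappa}})$. Then $\hat\theta^{\mathrm{RW}}\to\theta_0$ in probability as $n\to\infty$.
   Context: Noise. $(\varepsilon_i)_{i\in\mathbb{Z}}$ is an iid sequence of (real) random variables; $(\varepsilon_i^{(r)})_{i\in\mathbb{Z}}$, $r=0,1,\dots,s$, and $(\varepsilon_i^* )_{i\in\mathbb{Z}}$ are iid copies of this sequence. Put $\boldsymbol{\varepsilon}_t=(\varepsilon_t,\varepsilon_{t-1},\dots)$, $\boldsymbol{\varepsilon}_t^{(r)}=(\varepsilon_t^{(r)},\varepsilon_{t-1}^{(r)},\dots)$, and, for $j\in\mathbb{N}_0$, $\tilde{\boldsymbol{\varepsilon}}_{t,j}=(\varepsilon_t,\dots,\varepsilon_{t-j+1},\varepsilon^*_{t-j},\varepsilon_{t-j-1},\dots)$ (the input $\varepsilon_{t-j}$ is replaced by an independent copy). $\mathbb{R}^\infty$ carries the $\sigma$-algebra generated by all finite projections. Mappings. For each $u\in[0,1]$, $i\in\mathbb{N}$, $r=0,1,\dots,s$, $G_u^{(i,r)}:\mathbb{R}^\infty\times\Theta\to\mathbb{R}^d$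 is measurable and $(G_u^{(i,r)}(\boldsymbol{\varepsilon}_j,\theta))_{j\in\mathbb{Z}}$ is a stationary ergodic process for each $\theta$. Norms. $\|\cdot\|$ is the Euclidean norm; for a random vector $X$ whose law depends on $\theta$, $\|X\|_{\mathcal{L}^q(\theta)}=(\mathbb{E}_\theta\|X\|^q)^{1/q}$, where $\mathbb{E}_\theta$ is expectation under that $\theta$-dependent law. The $\kappa$-variation is $$\big\|(G_u^{(i,r)}(\boldsymbol{\varepsilon}_0,\theta))_u\big\|_{\kappa\text{-}\mathrm{var},\mathcal{L}^q(\theta)}=\sup_{\ell\in\mathbb{N},\ 0=u_0<\dots<u_\ell=1}\Big(\sum_{j=1}^\ell\big\|G_{u_j}^{(i,r)}(\boldsymbol{\varepsilon}_0,\theta)-G_{u_{j-1}}^{(i,r)}(\boldsymbol{\varepsilon}_0,\theta)\big\|_{\mathcal{L}^q(\theta)}^\kappa\Big)^{1/\kappa}.$$ $a_n\ll b_n$ (equivalently $b_n\gg a_n$) means $a_n/b_n\to0$; $x\wedge y=\min(x,y)$, $x\vee y=\max(x,y)$. Random Fourier features. For $x=(x_1,\dots,x_{m+1})^\top\in\mathbb{R}^{(m+1)\times d}$ with $x_j\in\mathbb{R}^d$, $$\varphi_i(x)=\cos\Big(\sum_{j=1}^{m+1}\Omega_{i,j}\cdot x_j+\alpha_i\Big),\quad i=1,\dots,k,$$ where $\Omega_{i,j}\sim N(0,I_d)$ iid and $\alpha_i\sim U(-\pi,\pi)$ iid are drawn independently of each other and of the data (noise). Put $\vartheta_i=(\Omega_{i,1}^\top,\dots,\Omega_{i,m+1}^\top,\alpha_i)^\top$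 and $\varphi=(\varphi_1,\dots,\varphi_k):\mathbb{R}^{(m+1)\times d}\to\mathbb{R}^k$. The drawn parameters are regarded as fixed; they do not change with $n$, and probabilities and expectations are with respect to the noise inputs. Estimator. For $t_1\le t_2$ write $X_{t_1:t_2}=(X_{t_1},\dots,X_{t_2})^\top$. For $t=m+1,\dots,n$ let $f_t^{\mathrm{obs}}=\varphi(X^{\mathrm{obs}}_{t-m:t})$, $f_t^{(r)}(\theta)=\varphi(X^{(r)}_{t-m:t}(\theta))$, $\bar f_t^{\mathrm{sim}}(\theta)=\frac1s\sum_{r=1}^sf_t^{(r)}(\theta)$. With natural numbers $w=w_n$ (window size), $\tau=\tau_n$ (offset), $L=L_n$ (lag) and $N_t=(w+1)\wedge(t-m)$, let $$F_t^{\mathrm{obs}}=\frac1{N_t}\sum_{j=(t-w)\vee(m+1)}^tf_j^{\mathrm{obs}},\qquad \bar F_t^{\mathrm{sim}}(\theta)=\frac1{N_t}\sum_{j=(t-w)\vee(m+1)}^t\bar f_j^{\mathrm{sim}}(\theta),$$ $$\hat Q_n^{\mathrm{RW}}(\theta)=\frac1{n-m}\sum_{t=m+\tau+L}^n\Big[\big\|F_{t-L}^{\mathrm{obs}}-\bar F_{t-L}^{\mathrm{sim}}(\theta)\big\|^2+K_t(\theta)\Big],$$ $$K_t(\theta)=2\big(F_{t-L}^{\mathrm{obs}}-\bar F_{t-L}^{\mathrm{sim}}(\theta)\big)^\top\Big(\big[f_t^{\mathrm{obs}}-\bar f_t^{\mathrm{sim}}(\theta)\big]-\big[F_{t-L}^{\mathrm{obs}}-\bar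 F_{t-L}^{\mathrm{sim}}(\theta)\big]\Big).$$ The rolling-window estimator $\hat\theta^{\mathrm{RW}}$ (depending on $n$) is any $\Theta$-valued random variable satisfying $|\hat Q_n^{\mathrm{RW}}(\hat\theta^{\mathrm{RW}})|\le\inf_{\theta\in\Theta}|\hat Q_n^{\mathrm{RW}}(\theta)|+o_p(1)$. Semialgebraic sets and maps. A subset of $\mathbb{R}^a$ is semialgebraic if it is a finite union of finite intersections of sets $\{x: f(x)*0\}$ with $f$ a real polynomial and $*$ either $<$ or $=$. A map between semialgebraic subsets of Euclidean spaces is semialgebraic if its graph is semialgebraic. Weakly Borel measurable set-valued map: $\{u\in[0,1]:\tilde\Theta_u\cap U\ne\emptyset\}$ is Borel for every open $U\subset\mathbb{R}^{\tilde p}$. A complex-valued function is real analytic if its real and imaginary parts are. *)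

theory Defs
  imports "HOL-Probability.Probability"
begin

subsection \<open>Semialgebraic sets and maps, real analytic functions\<close>

definition basic_semialgebraic :: "'a::euclidean_space set \<Rightarrow> bool" where
  "basic_semialgebraic S \<longleftrightarrow> (\<exists>P Q. finite P \<and> finite Q \<and>
     (\<forall>f\<in>P \<union> Q. real_polynomial_function f) \<and>
     S = {x. (\<forall>f\<in>P. f x < 0) \<and> (\<forall>f\<in>Q. f x = 0)})"

definition semialgebraic :: "'a::euclidean_space set \<Rightarrow> bool" where
  "semialgebraic S \<longleftrightarrow> (\<exists>C. finite C \<and> (\<forall>B\<in>C. basic_semialgebraic B) \<and> S = \<Union>C)"

definition semialgebraic_map_on ::
    "'a::euclidean_space set \<Rightarrow> ('a \<Rightarrow> 'b::euclidean_space) \<Rightarrow> bool" where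
  "semialgebraic_map_on S f \<longleftrightarrow> semialgebraic ((\<lambda>x. (x, f x)) ` S)"

text \<open>Multi-indices are the functions from the standard basis to the naturals, extended by
  \<^term>\<open>0::nat\<close>; for a series of reals, \<^const>\<open>has_sum\<close> is absolute convergence.\<close>

definition real_analytic_on :: "('a::euclidean_space \<Rightarrow> real) \<Rightarrow> 'a set \<Rightarrow> bool" where
  "real_analytic_on f S \<longleftrightarrow> (\<forall>x\<in>S. \<exists>r>0. \<exists>c. \<forall>y\<in>ball x r.
     ((\<lambda>k::'a \<Rightarrow> nat. c k * (\<Prod>b\<in>Basis. ((y - x) \<bullet> b) ^ k b)) has_sum f y)
       {k. \<forall>b. b \<notin> Basis \<longrightarrow> k b = 0})"

definition complex_real_analytic_on :: "('a::euclidean_space \<Rightarrow> complex) \<Rightarrow> 'a set \<Rightarrow> bool" where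
  "complex_real_analytic_on f S \<longleftrightarrow>
     real_analytic_on (\<lambda>x. Re (f x)) S \<and> real_analytic_on (\<lambda>x. Im (f x)) S"


subsection \<open>Norms, expectations, convergence in probability\<close>

text \<open>Powers of extended nonnegative reals, for exponents \<^term>\<open>a > (0::real)\<close>.\<close>

definition ennpow :: "ennreal \<Rightarrow> real \<Rightarrow> ennreal" where
  "ennpow x a = (if x = \<top> then \<top> else ennreal (enn2real x powr a))"

text \<open>The law of \<open>G(\<epsilon>\<^sub>0, \<theta>)\<close> depends on \<open>\<theta>\<close> only through the integrand, since the law of the
  noise does not; hence a single measure \<^term>\<open>M\<close> serves for all \<open>\<theta>\<close>.\<close>

definition Lq_norm :: "'w measure \<Rightarrow> real \<Rightarrow> ('w \<Rightarrow> 'a::real_normed_vector) \<Rightarrow> ennreal" where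
  "Lq_norm M q X = ennpow (\<integral>\<^sup>+x. ennreal (norm (X x) powr q) \<partial>M) (1 / q)"

definition kappa_variation ::
    "'w measure \<Rightarrow> real \<Rightarrow> real \<Rightarrow> (real \<Rightarrow> 'w \<Rightarrow> 'a::real_normed_vector) \<Rightarrow> ennreal" where
  "kappa_variation M q \<kappa> Y =
     (SUP (l, v) \<in> {(l::nat, v::nat \<Rightarrow> real).
          1 \<le> l \<and> v 0 = 0 \<and> v l = 1 \<and> strict_mono_on {0..l} v}.
        ennpow (\<Sum>j=1..l. ennpow (Lq_norm M q (\<lambda>x. Y (v j) x - Y (v (j - 1)) x)) \<kappa>) (1 / \<kappa>))"

text \<open>The outer expectation equals \<^term>\<open>nn_integral M f\<close> when \<^term>\<open>f\<close> is measurable. It is used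
  for suprema over uncountable sets: their measurability with respect to the
  \<^emph>\<open>uncompleted\<close> measure is not automatic, and \<^const>\<open>nn_integral\<close> of a nonmeasurable function would
  be the lower integral.\<close>

definition outer_expectation :: "'w measure \<Rightarrow> ('w \<Rightarrow> ennreal) \<Rightarrow> ennreal" where
  "outer_expectation M f =
     (INF g\<in>{g \<in> borel_measurable M. \<forall>x\<in>space M. f x \<le> g x}. \<integral>\<^sup>+x. g x \<partial>M)"

definition tendsto_in_prob ::
    "'w measure \<Rightarrow> (nat \<Rightarrow> 'w \<Rightarrow> 'a::metric_space) \<Rightarrow> 'a \<Rightarrow> bool" where
  "tendsto_in_prob M X c \<longleftrightarrow>
     (\<forall>\<epsilon>>0. (\<lambda>n. measure M {x \<in> space M. dist (X n x) c > \<epsilon>}) \<longlonglongrightarrow> 0)"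


subsection \<open>Noise and stationary ergodic processes\<close>

text \<open>Index set of all noise variables: the base sequence, the replacements used in the coupling,
  and the copies driving the observed (\<^term>\<open>0::nat\<close>) and simulated series.\<close>

datatype noise_index = Base int | Star int | Copy nat int

definition iid_noise :: "'w measure \<Rightarrow> nat \<Rightarrow> (int \<Rightarrow> 'w \<Rightarrow> real) \<Rightarrow> (int \<Rightarrow> 'w \<Rightarrow> real) \<Rightarrow>
    (nat \<Rightarrow> int \<Rightarrow> 'w \<Rightarrow> real) \<Rightarrow> bool" where
  "iid_noise M s eps epsst epsc \<longleftrightarrow>
     (let \<xi> = (\<lambda>x. case x of Base i \<Rightarrow> eps i | Star i \<Rightarrow> epsst i | Copy r i \<Rightarrow> epsc r i);
          I = range Base \<union> range Star \<union> {Copy r i |r i. r \<le> s}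
      in prob_space.indep_vars M (\<lambda>_. borel) \<xi> I \<and>
         (\<forall>x\<in>I. distr M borel (\<xi> x) = distr M borel (eps 0)))"

definition past :: "(int \<Rightarrow> 'w \<Rightarrow> real) \<Rightarrow> int \<Rightarrow> 'w \<Rightarrow> nat \<Rightarrow> real" where
  "past eps t x = (\<lambda>l. eps (t - int l) x)"

definition past_replaced ::
    "(int \<Rightarrow> 'w \<Rightarrow> real) \<Rightarrow> (int \<Rightarrow> 'w \<Rightarrow> real) \<Rightarrow> int \<Rightarrow> nat \<Rightarrow> 'w \<Rightarrow> nat \<Rightarrow> real" where
  "past_replaced eps epsst t j x =
     (\<lambda>l. if l = j then epsst (t - int l) x else eps (t - int l) x)"

abbreviation Rinf :: "(nat \<Rightarrow> real) measure" where
  "Rinf \<equiv> \<Pi>\<^sub>M l\<in>UNIV. borel"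

definition noise_law :: "'w measure \<Rightarrow> (int \<Rightarrow> 'w \<Rightarrow> real) \<Rightarrow> (nat \<Rightarrow> real) measure" where
  "noise_law M eps = distr M Rinf (past eps 0)"

definition stationary_ergodic ::
    "'w measure \<Rightarrow> (int \<Rightarrow> 'w \<Rightarrow> 'a::topological_space) \<Rightarrow> bool" where
  "stationary_ergodic M Y \<longleftrightarrow>
     (let S = (\<Pi>\<^sub>M j\<in>(UNIV::int set). (borel :: 'a measure)); law = distr M S (\<lambda>x j. Y j x)
      in (\<forall>j. Y j \<in> borel_measurable M) \<and>
         distr M S (\<lambda>x j. Y (j + 1) x) = law \<and>
         (\<forall>A\<in>sets S. {y. (\<lambda>j. y (j + 1)) \<in> A} = A \<longrightarrow> measure law A = 0 \<or> measure law A = 1))"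


subsection \<open>Windows, random Fourier features\<close>

text \<open>The space of \<open>(m+1) \<times> d\<close> matrices is \<^typ>\<open>real^'d^'m\<close> with \<open>CARD('m) = m + 1\<close>. The rows are
  numbered \<open>0, \<dots>, m\<close> by the fixed bijection \<^term>\<open>to_nat_on (UNIV::'m::finite set)\<close>
  (see lemma \<open>to_nat_on_finite\<close>), so that \<open>window m X t\<close> has the rows
  \<open>X (t - m), \<dots>, X t\<close> in this order. The inner product of \<^typ>\<open>real^'d^'m\<close> is the sum of the
  inner products of the rows.\<close>

definition window :: "nat \<Rightarrow> (int \<Rightarrow> real^'d) \<Rightarrow> int \<Rightarrow> real^'d^'m" where
  "window m X t = (\<chi> a. X (t - int m + int (to_nat_on UNIV a)))"

definition window_law :: "'w measure \<Rightarrow> (int \<Rightarrow> 'w \<Rightarrow> real) \<Rightarrow> nat \<Rightarrow>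
    ((nat \<Rightarrow> real) \<Rightarrow> 'c \<Rightarrow> real^'d) \<Rightarrow> 'c \<Rightarrow> (real^'d^'m) measure" where
  "window_law M eps m H \<theta> = distr M borel (\<lambda>x. window m (\<lambda>j. H (past eps j x) \<theta>) 0)"

definition char_fun :: "'a::euclidean_space measure \<Rightarrow> 'a \<Rightarrow> complex" where
  "char_fun P \<omega> = (CLINT x|P. iexp (\<omega> \<bullet> x))"

definition rff :: "('k \<Rightarrow> real^'d^'m) \<Rightarrow> ('k \<Rightarrow> real) \<Rightarrow> real^'d^'m \<Rightarrow> real^'k" where
  "rff \<Omega> \<alpha> x = (\<chi> i. cos (\<Omega> i \<bullet> x + \<alpha> i))"

text \<open>The draw of the feature parameters lives on its own probability space, because it is
  independent of the noise; \<open>N(0, I)\<close> is written through its independent standard normal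
  coordinates.\<close>

definition rff_draw ::
    "'z measure \<Rightarrow> ('k \<Rightarrow> 'z \<Rightarrow> real^'d^'m) \<Rightarrow> ('k \<Rightarrow> 'z \<Rightarrow> real) \<Rightarrow> bool" where
  "rff_draw D \<Omega> \<alpha> \<longleftrightarrow> prob_space D \<and>
     prob_space.indep_vars D (\<lambda>_. borel)
       (\<lambda>(i, c). case c of Some (a, l) \<Rightarrow> (\<lambda>z. \<Omega> i z $ a $ l) | None \<Rightarrow> \<alpha> i) UNIV \<and>
     (\<forall>i a l. distributed D lborel (\<lambda>z. \<Omega> i z $ a $ l) (\<lambda>x. ennreal (std_normal_density x))) \<and>
     (\<forall>i. distr D borel (\<alpha> i) = uniform_measure lborel {-pi<..<pi})"


subsection \<open>The rolling-window criterion\<close>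

definition rolling_mean :: "nat \<Rightarrow> nat \<Rightarrow> (int \<Rightarrow> 'a::real_vector) \<Rightarrow> int \<Rightarrow> 'a" where
  "rolling_mean m w f t =
     (1 / real_of_int (min (int w + 1) (t - int m))) *\<^sub>R
       (\<Sum>j\<in>{max (t - int w) (int m + 1)..t}. f j)"

definition Q_RW :: "nat \<Rightarrow> nat \<Rightarrow> (real^'d^'m \<Rightarrow> real^'k) \<Rightarrow> nat \<Rightarrow> nat \<Rightarrow> nat \<Rightarrow> nat \<Rightarrow>
    (int \<Rightarrow> real^'d) \<Rightarrow> (nat \<Rightarrow> int \<Rightarrow> real^'d) \<Rightarrow> real" where
  "Q_RW m s \<phi> w \<tau> L n Xobs Xsim =
     (let f_obs = (\<lambda>t. \<phi> (window m Xobs t));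
          f_sim = (\<lambda>t. (1 / real s) *\<^sub>R (\<Sum>r=1..s. \<phi> (window m (Xsim r) t)));
          \<Delta> = (\<lambda>t. rolling_mean m w f_obs (t - int L) - rolling_mean m w f_sim (t - int L));
          K = (\<lambda>t. 2 * (\<Delta> t \<bullet> ((f_obs t - f_sim t) - \<Delta> t)))
      in 1 / (real n - real m) *
           (\<Sum>t\<in>{int m + int \<tau> + int L..int n}. (norm (\<Delta> t))\<^sup>2 + K t))"

text \<open>The term \<open>o\<^sub>p(1)\<close> is the sequence \<^term>\<open>R\<close>.\<close>

definition approx_minimizer :: "'w measure \<Rightarrow> 'c set \<Rightarrow> nat set \<Rightarrow>
    (nat \<Rightarrow> 'c \<Rightarrow> 'w \<Rightarrow> real) \<Rightarrow> (nat \<Rightarrow> 'w \<Rightarrow> 'c::topological_space) \<Rightarrow> bool" where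
  "approx_minimizer M \<Theta> I Q \<theta>hat \<longleftrightarrow>
     (\<forall>n\<in>I. \<theta>hat n \<in> measurable M (restrict_space borel \<Theta>)) \<and>
     (\<exists>R. (\<forall>n. R n \<in> borel_measurable M) \<and> tendsto_in_prob M R (0::real) \<and>
        (\<forall>n\<in>I. AE x in M. \<bar>Q n (\<theta>hat n x) x\<bar> \<le> (INF \<theta>\<in>\<Theta>. \<bar>Q n \<theta> x\<bar>) + R n x))"

end

theory Submission
  imports Defs
begin

text \<open>
  Since the features are bounded, the summand of the criterion equals, per feature,
  \<open>2 \<Delta> y - \<Delta>\<^sup>2\<close>, where \<open>y\<close> is the difference of observed and simulated features and \<open>\<Delta>\<close> its
  lagged window mean. Geometric moment contraction bounds covariances, so \<open>\<Delta>\<close> and weighted sums of \<open>y\<close>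
  are close to their means in \<open>L\<^sup>1\<close>; finite \<open>\<kappa>\<close>-variation makes these means, averaged over time,
  insensitive to shifts by \<open>o(n)\<close>. Hence the criterion approaches the time average of \<open>h\<^sup>2\<close>, uniformly in
  the parameter, where \<open>h\<close> is the difference of the mean features at \<open>\<theta>\<^sub>0\<close> and \<open>\<theta>\<close>. For
  \<open>\<theta> \<noteq> \<theta>\<^sub>0\<close> the limit of \<open>h\<close> exceeds some level in absolute value at infinitely many times, and
  finite \<open>\<kappa>\<close>-variation leaves only finitely many times with a large oscillation, so \<open>\<bar>h\<bar>\<close> stays away
  from 0 on a whole interval. Compactness and the stochastic equicontinuity in \<open>\<theta>\<close> make this uniform
  outside every ball around \<open>\<theta>\<^sub>0\<close>, and the argument for minimum contrast estimators applies.
\<close>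

subsection \<open>\<open>L\<^sup>q\<close> norms and \<open>\<kappa>\<close>-variation\<close>

text \<open>Three obstacles shape the development. The maps are merely measurable in the noise, so
  passing to the limit in infinitely many replaced coordinates cannot rest on continuity; that all
  hybrid sequences have one and the same law takes its place. The limit maps \<open>Glim\<close>
  come without a variation bound, so the oscillation argument runs on the maps of one fixed large
  index, which are uniformly close to them; an infinite level set is then weighed against finitely
  many bad times by cardinality alone. Suprema over the parameter are never formed: a random
  majorant valid for all close pairs, together with a finite net, yields uniformity. The product of
  the window mean and the current value is handled without estimating their joint law. Once the mean
  is replaced by the deterministic \<open>h\<close>, the value \<open>y\<close> enters linearly with
  deterministic weights, and a single deviation bound for weighted sums covers both the window means
  and the remaining sum. As the cosine is bounded and 1-Lipschitz, closeness of the maps is only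
  ever used in the first mean.\<close>

lemma ennpow_leD:
  assumes "ennpow x b \<le> ennreal a" "0 < b" "0 \<le> a"
  shows "x \<le> ennreal (a powr (1 / b))"
proof -
  have fin: "x \<noteq> \<top>" using assms by (auto simp: ennpow_def top_unique)
  then have "enn2real x powr b \<le> a" using assms by (simp add: ennpow_def)
  then have "(enn2real x powr b) powr (1 / b) \<le> a powr (1 / b)"
    using assms by (intro powr_mono2) auto
  then have "enn2real x \<le> a powr (1 / b)" using assms by (simp add: powr_powr)
  then show ?thesis using fin
    by (metis ennreal_enn2real_if ennreal_leI)
qed

text \<open>If y exceeds a, then y^(1-q) is at most a^(1-q), because the exponent is not positive.
  The level a stays free: taken near the norm it gives the comparison of norms with factor 2, and in
  \<open>bounded_kvar_lag_sum\<close> it balances the two terms of a sum.\<close>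

lemma le_add_powr:
  fixes y a q :: real
  assumes "0 \<le> y" "0 < a" "1 \<le> q"
  shows "y \<le> a + a powr (1 - q) * y powr q"
proof (cases "y \<le> a")
  case False
  have "y = y powr (1 - q) * y powr q" using assms False by (simp flip: powr_add)
  also have "\<dots> \<le> a powr (1 - q) * y powr q"
    using assms False by (intro mult_right_mono powr_mono2') auto
  finally show ?thesis using assms by simp
qed (use assms in \<open>simp add: add_increasing2\<close>)

text \<open>Young's inequality gives the comparison with a constant 2, which replaces Jensen's inequality.\<close>

lemma L1_le_Lq_norm:
  fixes X :: "'w \<Rightarrow> 'a::euclidean_space"
  assumes "prob_space M" and X[measurable]: "X \<in> borel_measurable M"
    and q: "1 \<le> q" and fin: "Lq_norm M q X \<noteq> \<top>"
  shows "(\<integral>\<^sup>+x. ennreal (norm (X x)) \<partial>M) \<le> ennreal (2 * enn2real (Lq_norm M q X))"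
proof (rule ennreal_le_epsilon)
  interpret prob_space M by fact
  fix e :: real assume e: "0 < e"
  define d where "d = enn2real (Lq_norm M q X)"
  \<comment> \<open>The best level is the norm d itself, but d may vanish and the level must be
    positive. The surplus e / 2 appears twice in the final bound, as e.\<close>
  define a where "a = d + e / 2"
  have d: "0 \<le> d" "Lq_norm M q X = ennreal d" using fin by (auto simp: d_def less_top)
  have a: "0 < a" using e d by (simp add: a_def)
  have "ennpow (\<integral>\<^sup>+x. ennreal (norm (X x) powr q) \<partial>M) (1 / q) \<le> ennreal a"
    using d e unfolding Lq_norm_def[symmetric] by (simp add: a_def ennreal_leI)
  from ennpow_leD[OF this] have I: "(\<integral>\<^sup>+x. ennreal (norm (X x) powr q) \<partial>M) \<le> ennreal (a powr q)"
    using q a by simp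
  have "(\<integral>\<^sup>+x. ennreal (norm (X x)) \<partial>M) \<le>
      (\<integral>\<^sup>+x. ennreal a + ennreal (a powr (1 - q)) * ennreal (norm (X x) powr q) \<partial>M)"
    using le_add_powr[OF _ a q] a
    by (intro nn_integral_mono) (simp flip: ennreal_mult ennreal_plus)
  also have "\<dots> = ennreal a + ennreal (a powr (1 - q)) * (\<integral>\<^sup>+x. ennreal (norm (X x) powr q) \<partial>M)"
    by (subst nn_integral_add) (auto simp: nn_integral_cmult emeasure_space_1)
  also have "\<dots> \<le> ennreal a + ennreal (a powr (1 - q)) * ennreal (a powr q)"
    by (intro add_left_mono mult_left_mono I) auto
  also have "\<dots> = ennreal (2 * d) + ennreal e"
    using a e d by (simp add: a_def flip: ennreal_mult ennreal_plus powr_add)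
  finally show "(\<integral>\<^sup>+x. ennreal (norm (X x)) \<partial>M) \<le> ennreal (2 * enn2real (Lq_norm M q X)) + ennreal e"
    by (simp add: d_def)
qed

lemma L1_le_of_Lq_norm_le:
  fixes X :: "'w \<Rightarrow> 'a::euclidean_space"
  assumes "prob_space M" "X \<in> borel_measurable M" "1 \<le> q" "Lq_norm M q X \<le> ennreal a" "0 \<le> a"
  shows "(\<integral>\<^sup>+x. ennreal (norm (X x)) \<partial>M) \<le> ennreal (2 * a)"
proof -
  have "Lq_norm M q X \<noteq> \<top>" using assms(4) by (auto simp: top_unique)
  from L1_le_Lq_norm[OF assms(1-3) this] show ?thesis
    by (rule order_trans) (use enn2real_mono[OF assms(4)] assms(5) in \<open>auto intro: ennreal_leI\<close>)
qed

text \<open>Below, \<^term>\<open>d u v\<close> bounds the \<open>L\<^sup>1\<close> distance of the values of a process at the times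
  \<^term>\<open>u\<close> and \<^term>\<open>v\<close>.\<close>

definition bounded_kvar :: "real \<Rightarrow> real \<Rightarrow> (real \<Rightarrow> real \<Rightarrow> real) \<Rightarrow> bool" where
  "bounded_kvar \<kappa> K d \<longleftrightarrow> (\<forall>u v. d u v = d v u \<and> 0 \<le> d u v) \<and> (\<forall>u. d u u = 0) \<and>
     (\<forall>l p. strict_mono_on {0..l::nat} p \<and> p ` {0..l} \<subseteq> {0..1} \<longrightarrow>
        (\<Sum>j<l. d (p (Suc j)) (p j) powr \<kappa>) \<le> K)"

lemma bounded_kvarD:
  assumes "bounded_kvar \<kappa> K d"
  shows "d u v = d v u" "0 \<le> d u v" "d u u = 0"
    and "strict_mono_on {0..l::nat} p \<Longrightarrow> p ` {0..l} \<subseteq> {0..1} \<Longrightarrow> (\<Sum>j<l. d (p (Suc j)) (p j) powr \<kappa>) \<le> K"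
  using assms unfolding bounded_kvar_def by blast+

text \<open>The supremum in \<open>kappa_variation\<close> only ranges over partitions from 0 to 1.
  Prepending 0 and appending 1 where they are missing adds nonnegative terms, so the bound passes to
  every increasing chain of times in the unit interval. This is the form that subchains and residue
  classes need later.\<close>

lemma partition_extend:
  fixes D :: "real \<Rightarrow> real \<Rightarrow> ennreal"
  assumes part: "\<And>l v. 1 \<le> l \<Longrightarrow> v 0 = 0 \<Longrightarrow> v l = 1 \<Longrightarrow> strict_mono_on {0..l::nat} v \<Longrightarrow>
      (\<Sum>j<l. D (v (Suc j)) (v j)) \<le> K"
    and p: "strict_mono_on {0..l::nat} p" "p ` {0..l} \<subseteq> {0..1}"
  shows "(\<Sum>j<l. D (p (Suc j)) (p j)) \<le> K"
proof -
  have from0: "(\<Sum>j<l. D (p (Suc j)) (p j)) \<le> K"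
    if p: "strict_mono_on {0..l::nat} p" "p ` {0..l} \<subseteq> {0..1}" "p 0 = 0" for l p
  proof (cases "p l = 1")
    case True
    then have "1 \<le> l" using p by (cases l) auto
    then show ?thesis using part p True by blast
  next
    case False
    have "p l \<in> {0..1}" using p(2) by (rule subsetD) simp
    with False have pl: "p l < 1" by auto
    define v where "v j = (if j \<le> l then p j else 1)" for j
    have "strict_mono_on {0..Suc l} v"
    proof (rule strict_mono_onI)
      fix r s assume rs: "r \<in> {0..Suc l}" "s \<in> {0..Suc l}" "r < s"
      have "r < l \<Longrightarrow> p r < p l" using p(1) by (auto simp: strict_mono_on_def)
      then have "p r < 1" using pl rs by (cases "r = l") auto
      then show "v r < v s" using rs p(1) by (auto simp: v_def strict_mono_on_def)
    qed
    then have "(\<Sum>j<Suc l. D (v (Suc j)) (v j)) \<le> K"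
      by (rule part[rotated 3]) (auto simp: v_def p)
    moreover have "(\<Sum>j<l. D (p (Suc j)) (p j)) = (\<Sum>j<l. D (v (Suc j)) (v j))"
      by (intro sum.cong) (auto simp: v_def)
    moreover have "(\<Sum>j<l. D (v (Suc j)) (v j)) \<le> (\<Sum>j<Suc l. D (v (Suc j)) (v j))"
      by (intro sum_mono2) auto
    ultimately show ?thesis by (metis order_trans)
  qed
  show ?thesis
  proof (cases "p 0 = 0")
    case True then show ?thesis using from0 p by blast
  next
    case False
    have "p 0 \<in> {0..1}" using p(2) by (rule subsetD) simp
    with False have p0: "0 < p 0" by auto
    define v where "v j = (case j of 0 \<Rightarrow> 0 | Suc i \<Rightarrow> p i)" for j
    have "strict_mono_on {0..Suc l} v"
    proof (rule strict_mono_onI)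
      fix r s assume rs: "r \<in> {0..Suc l}" "s \<in> {0..Suc l}" "r < s"
      then obtain s' where s': "s = Suc s'" by (cases s) auto
      have "0 < s' \<Longrightarrow> p 0 < p s'" using p(1) rs s' by (auto simp: strict_mono_on_def)
      then have "0 < p s'" using p0 by (cases "s' = 0") auto
      then show "v r < v s" using rs p(1) s' by (auto simp: v_def strict_mono_on_def split: nat.split)
    qed
    moreover have "v ` {0..Suc l} \<subseteq> {0..1}"
      using p(2) by (auto simp: v_def image_subset_iff split: nat.split)
    ultimately have "(\<Sum>j<Suc l. D (v (Suc j)) (v j)) \<le> K"
      by (rule from0) (auto simp: v_def)
    moreover have "(\<Sum>j<Suc l. D (v (Suc j)) (v j)) = D (v 1) (v 0) + (\<Sum>j<l. D (p (Suc j)) (p j))"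
      by (subst sum.lessThan_Suc_shift) (auto simp: v_def)
    ultimately show ?thesis
      by (metis le_iff_add add.commute order_trans)
  qed
qed

text \<open>The witness is twice the \<open>Lq_norm\<close> of the increment; the 2 is the constant
  of \<open>L1_le_Lq_norm\<close> and reappears inside the variation bound.\<close>

lemma kappa_variation_imp_bounded_kvar:
  fixes Y :: "real \<Rightarrow> 'w \<Rightarrow> 'a::euclidean_space"
  assumes M: "prob_space M" and Y: "\<And>u. u \<in> {0..1} \<Longrightarrow> Y u \<in> borel_measurable M"
    and q: "1 \<le> q" and \<kappa>: "1 \<le> \<kappa>" and \<Lambda>: "0 \<le> \<Lambda>"
    and kv: "kappa_variation M q \<kappa> Y \<le> ennreal \<Lambda>"
  shows "\<exists>d. bounded_kvar \<kappa> ((2 * \<Lambda>) powr \<kappa>) d \<and> (\<forall>u\<in>{0..1}. \<forall>v\<in>{0..1}.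
           (\<integral>\<^sup>+x. ennreal (norm (Y u x - Y v x)) \<partial>M) \<le> ennreal (d u v))"
proof -
  define D where "D u v = Lq_norm M q (\<lambda>x. Y u x - Y v x)" for u v
  define d where "d u v = 2 * enn2real (D u v)" for u v
  have sym: "D u v = D v u" for u v unfolding D_def Lq_norm_def by (simp add: norm_minus_commute)
  have D0: "D u u = 0" for u by (simp add: D_def Lq_norm_def ennpow_def)
  have part: "(\<Sum>j<l. ennpow (D (v (Suc j)) (v j)) \<kappa>) \<le> ennreal (\<Lambda> powr \<kappa>)"
    if v: "1 \<le> l" "v 0 = 0" "v l = 1" "strict_mono_on {0..l::nat} v" for l v
  proof -
    have "ennpow (\<Sum>j=1..l. ennpow (D (v j) (v (j - 1))) \<kappa>) (1 / \<kappa>) \<le> kappa_variation M q \<kappa> Y"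
      unfolding kappa_variation_def D_def
      by (rule SUP_upper2[where i="(l, v)"]) (use v in auto)
    also note kv
    finally have "(\<Sum>j=1..l. ennpow (D (v j) (v (j - 1))) \<kappa>) \<le> ennreal (\<Lambda> powr \<kappa>)"
      using ennpow_leD[of _ "1/\<kappa>" \<Lambda>] \<kappa> \<Lambda> by simp
    moreover have "(\<Sum>j=1..l. ennpow (D (v j) (v (j - 1))) \<kappa>) = (\<Sum>j<l. ennpow (D (v (Suc j)) (v j)) \<kappa>)"
      by (rule sum.reindex_bij_witness[of _ Suc "\<lambda>j. j - 1"]) auto
    ultimately show ?thesis by simp
  qed
  note ext = partition_extend[of "\<lambda>u v. ennpow (D u v) \<kappa>", OF part]
  \<comment> \<open>\<open>enn2real\<close> sends infinity to 0, so \<open>d\<close> is faithful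
    only where the increment has finite norm. The chain with the single step from u to v shows that
    it has.\<close>
  have fin1: "D v u \<noteq> \<top>" if "u \<in> {0..1}" "v \<in> {0..1}" "u < v" for u v
  proof -
    let ?p = "\<lambda>j::nat. if j = 0 then u else v"
    have "strict_mono_on {0..Suc 0} ?p" "?p ` {0..Suc 0} \<subseteq> {0..1}"
      using that by (auto intro!: strict_mono_onI)
    then have "(\<Sum>j<Suc 0. ennpow (D (?p (Suc j)) (?p j)) \<kappa>) \<le> ennreal (\<Lambda> powr \<kappa>)"
      using ext[where p="?p" and l="Suc 0"] by blast
    then show ?thesis by (auto simp: ennpow_def top_unique)
  qed
  have fin: "D u v \<noteq> \<top>" if "u \<in> {0..1}" "v \<in> {0..1}" for u v
    using fin1[of u v] fin1[of v u] D0[of u] sym[of u v] that by (cases u v rule: linorder_cases) auto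
  have "(\<Sum>j<l. d (p (Suc j)) (p j) powr \<kappa>) \<le> (2 * \<Lambda>) powr \<kappa>"
    if p: "strict_mono_on {0..l::nat} p" "p ` {0..l} \<subseteq> {0..1}" for l p
  proof -
    have "ennreal (\<Sum>j<l. enn2real (D (p (Suc j)) (p j)) powr \<kappa>) =
        (\<Sum>j<l. ennpow (D (p (Suc j)) (p j)) \<kappa>)"
      using p(2) by (subst sum_ennreal[symmetric])
        (auto intro!: sum.cong simp: ennpow_def image_subset_iff fin)
    also have "\<dots> \<le> ennreal (\<Lambda> powr \<kappa>)" using ext p by blast
    finally have "(\<Sum>j<l. enn2real (D (p (Suc j)) (p j)) powr \<kappa>) \<le> \<Lambda> powr \<kappa>" by simp
    then show ?thesis
      by (simp add: d_def powr_mult flip: sum_distrib_left)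
  qed
  then have "bounded_kvar \<kappa> ((2 * \<Lambda>) powr \<kappa>) d"
    unfolding bounded_kvar_def using sym D0 by (auto simp: d_def)
  moreover have "(\<integral>\<^sup>+x. ennreal (norm (Y u x - Y v x)) \<partial>M) \<le> ennreal (d u v)"
    if "u \<in> {0..1}" "v \<in> {0..1}" for u v
    using fin[OF that] Y that M q unfolding D_def d_def
    by (intro L1_le_Lq_norm) (auto intro: borel_measurable_diff)
  ultimately show ?thesis by blast
qed

text \<open>Each bad time has partners arbitrarily close to it at which the process differs by e.
  For many bad times, pairs of a time and its partner can be made disjoint and strung into one
  chain, and each pair adds e^\<open>\<kappa>\<close> to the variation sum.\<close>

lemma bounded_kvar_finite_oscillation:
  assumes d: "bounded_kvar \<kappa> K d" and \<kappa>: "0 < \<kappa>" and e: "0 < e"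
  shows "finite {v \<in> {0..1}. \<forall>\<delta>>0. \<exists>u\<in>{0..1}. \<bar>u - v\<bar> < \<delta> \<and> e \<le> d u v}" (is "finite ?B")
proof (rule ccontr)
  assume "infinite ?B"
  then have "infinite (?B - {0, 1})" by simp
  obtain N :: nat where N: "K < real N * e powr \<kappa>"
    using reals_Archimedean3[of "e powr \<kappa>"] e by auto
  obtain S where S: "S \<subseteq> ?B - {0, 1}" "finite S" "card S = Suc N"
    using infinite_arbitrarily_large[OF \<open>infinite (?B - {0, 1})\<close>, of "Suc N"] by (elim exE conjE) rule
  define xs where "xs = sorted_list_of_set S"
  define h where "h i = xs ! i" for i
  have len: "length xs = Suc N" "set xs = S" using S by (auto simp: xs_def)
  have mono: "h i < h j" if "i < j" "j < Suc N" for i j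
    unfolding h_def xs_def using that S
    by (intro sorted_wrt_nth_less[OF strict_sorted_list_of_set]) auto
  have hS: "h i \<in> S" if "i < Suc N" for i using that len by (metis h_def nth_mem)
  \<comment> \<open>At most half of every gap between consecutive bad times, so that partners chosen
    within \<open>\<delta>\<close> cannot make neighbouring pairs overlap.\<close>
  define \<delta> where "\<delta> = Min (insert 1 ((\<lambda>i. (h (Suc i) - h i) / 2) ` {..<N} \<union> h ` {..<Suc N} \<union> (\<lambda>i. 1 - h i) ` {..<Suc N}))"
  have h01: "0 < h i" "h i < 1" if "i < Suc N" for i
  proof -
    have "h i \<in> {0..1} - {0, 1}" using subsetD[OF S(1) hS[OF that]] by simp
    then show "0 < h i" "h i < 1" by auto
  qed
  have "0 < \<delta>" unfolding \<delta>_def using h01 mono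
    by (subst Min_gr_iff) auto
  have \<delta>1: "\<delta> \<le> (h (Suc i) - h i) / 2" if "i < N" for i
    unfolding \<delta>_def using that by (intro Min_le) auto
  have "\<forall>i<Suc N. \<exists>u\<in>{0..1}. \<bar>u - h i\<bar> < \<delta> \<and> e \<le> d u (h i)"
    using hS S(1) \<open>0 < \<delta>\<close> by blast
  then obtain u where u: "\<And>i. i < Suc N \<Longrightarrow> u i \<in> {0..1} \<and> \<bar>u i - h i\<bar> < \<delta> \<and> e \<le> d (u i) (h i)"
    by metis
  \<comment> \<open>The chain lists the pairs from left to right: positions 2i and 2i+1 hold the
    smaller and the larger of \<open>u i\<close> and \<open>h i\<close>. The two are distinct
    because \<open>d\<close> vanishes on the diagonal.\<close>
  define p where "p j = (if even j then min (u (j div 2)) (h (j div 2)) else max (u (j div 2)) (h (j div 2)))" for j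
  have une: "u i \<noteq> h i" if "i < Suc N" for i
    using u[OF that] e d by (auto simp: bounded_kvar_def)
  have step: "p j < p (Suc j)" if "j < Suc (2 * N)" for j
  proof (cases "even j")
    case True
    then obtain i where "j = 2 * i" by blast
    with that une[of i] show ?thesis by (auto simp: p_def min_def max_def)
  next
    case False
    then obtain i where i: "j = 2 * i + 1" using oddE by blast
    with that have "i < N" by simp
    with u[of i] u[of "Suc i"] \<delta>1[of i] \<open>0 < \<delta>\<close> show ?thesis by (auto simp: p_def i)
  qed
  have "strict_mono_on {0..Suc (2 * N)} p"
  proof (rule strict_mono_onI)
    fix r s assume "r \<in> {0..Suc (2 * N)}" "s \<in> {0..Suc (2 * N)}" "r < s"
    then have "s \<le> Suc (2 * N)" by simp
    with \<open>r < s\<close> show "p r < p s"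
    proof (induction s)
      case (Suc s) then show ?case using step[of s] by (cases "r = s") auto
    qed simp
  qed
  moreover have "p ` {0..Suc (2 * N)} \<subseteq> {0..1}"
  proof -
    have "p j \<in> {0..1}" if "j \<le> Suc (2 * N)" for j
    proof -
      have "j div 2 < Suc N" using that by linarith
      then show ?thesis
        using u[of "j div 2"] h01[of "j div 2"] by (auto simp: p_def min_def max_def)
    qed
    then show ?thesis by auto
  qed
  ultimately have "(\<Sum>j<Suc (2 * N). d (p (Suc j)) (p j) powr \<kappa>) \<le> K"
    by (rule bounded_kvarD(4)[OF d])
  \<comment> \<open>Only the even steps, which lead from one end of a pair to the other, are
    kept.\<close>
  moreover have "(\<Sum>i<N. e powr \<kappa>) \<le> (\<Sum>j<Suc (2 * N). d (p (Suc j)) (p j) powr \<kappa>)"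
  proof -
    have "(\<Sum>i<N. e powr \<kappa>) \<le> (\<Sum>i<N. d (p (Suc (2 * i))) (p (2 * i)) powr \<kappa>)"
    proof (rule sum_mono)
      fix i assume "i \<in> {..<N}"
      then have "e \<le> d (u i) (h i)" using u[of i] by simp
      also have "d (u i) (h i) = d (p (Suc (2 * i))) (p (2 * i))"
        using d by (auto simp: p_def min_def max_def bounded_kvar_def)
      finally show "e powr \<kappa> \<le> d (p (Suc (2 * i))) (p (2 * i)) powr \<kappa>"
        using e \<kappa> by (intro powr_mono2) auto
    qed
    also have "\<dots> = (\<Sum>j\<in>(\<lambda>i. 2 * i) ` {..<N}. d (p (Suc j)) (p j) powr \<kappa>)"
      by (subst sum.reindex) (auto simp: inj_on_def)
    also have "\<dots> \<le> (\<Sum>j<Suc (2 * N). d (p (Suc j)) (p j) powr \<kappa>)"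
      by (intro sum_mono2) auto
    finally show ?thesis .
  qed
  ultimately show False using N by simp
qed

text \<open>The times of one residue class modulo j form an increasing chain whose steps are exactly
  the lag j increments. There are j classes, and each contributes at most K.\<close>

lemma bounded_kvar_lag_sum_powr:
  assumes d: "bounded_kvar \<kappa> K d" and n: "1 \<le> n" and j: "1 \<le> j"
  shows "(\<Sum>t\<in>{Suc j..n}. d (real t / real n) (real (t - j) / real n) powr \<kappa>) \<le> real j * K"
proof -
  let ?g = "\<lambda>t. d (real t / real n) (real (t - j) / real n) powr \<kappa>"
  have "(\<Sum>t\<in>{Suc j..n}. ?g t) =
      (\<Sum>(r, i)\<in>(SIGMA r:{1..j}. {..<(n - r) div j}). ?g (r + j * Suc i))"
  \<comment> \<open>Classes are numbered r = 1, ..., j, hence the residue of t - 1. The term for t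
    joins t to its predecessor t - j in the class, so the index i of the step is one less than that
    of t.\<close>
  proof (rule sum.reindex_bij_witness[of _ "\<lambda>(r, i). r + j * Suc i" "\<lambda>t. (Suc ((t - 1) mod j), (t - 1) div j - 1)"])
    fix t assume t: "t \<in> {Suc j..n}"
    have 1: "1 \<le> (t - 1) div j" using div_greater_zero_iff[of "t - 1" j] t j by (simp add: Suc_le_eq) linarith
    have 2: "(t - 1) mod j + j * ((t - 1) div j) = t - 1" by simp
    show *: "(case (Suc ((t - 1) mod j), (t - 1) div j - 1) of (r, i) \<Rightarrow> r + j * Suc i) = t"
    proof -
      have "j * Suc ((t - 1) div j - 1) = j * ((t - 1) div j)" using 1 by simp
      with 2 t show ?thesis by simp
    qed
    have "j * ((t - 1) div j) = t - Suc ((t - 1) mod j)" using 2 t by linarith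
    also have "\<dots> \<le> n - Suc ((t - 1) mod j)" using t by (intro diff_le_mono) auto
    finally have "(t - 1) div j \<le> (n - Suc ((t - 1) mod j)) div j"
      using j by (metis div_le_mono nonzero_mult_div_cancel_left not_one_le_zero)
    then show "(Suc ((t - 1) mod j), (t - 1) div j - 1) \<in> (SIGMA r:{1..j}. {..<(n - r) div j})"
      using j 1 by (auto simp: Suc_le_eq)
    show "(case (Suc ((t - 1) mod j), (t - 1) div j - 1) of (r, i) \<Rightarrow> ?g (r + j * Suc i)) = ?g t"
      using arg_cong[OF *, of ?g] by (simp only: prod.case)
  next
    fix b assume b: "b \<in> (SIGMA r:{1..j}. {..<(n - r) div j})"
    obtain r i where ri: "b = (r, i)" "1 \<le> r" "r \<le> j" "i < (n - r) div j" using b by auto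
    have "r - 1 < j" using ri by simp
    have *: "r + j * Suc i - 1 = (r - 1) + j * Suc i" using ri by simp
    have m1: "(r + j * Suc i - 1) mod j = r - 1" unfolding * using \<open>r - 1 < j\<close>
      by (metis mod_less mod_mult_self2)
    have m2: "(r + j * Suc i - 1) div j = Suc i" unfolding * using \<open>r - 1 < j\<close>
      by (subst div_mult_self2) auto
    show "(\<lambda>t. (Suc ((t - 1) mod j), (t - 1) div j - 1)) (case b of (r, i) \<Rightarrow> r + j * Suc i) = b"
      using ri m1 m2 by simp
    have "j * Suc i \<le> j * ((n - r) div j)" using ri by (intro mult_le_mono2) auto
    also have "\<dots> \<le> n - r" by simp
    finally have "j * Suc i \<le> n - r" .
    moreover have "1 \<le> j * Suc i" using j by simp
    ultimately have "r + j * Suc i \<le> n" by linarith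
    then show "(case b of (r, i) \<Rightarrow> r + j * Suc i) \<in> {Suc j..n}" using ri by auto
  qed
  also have "\<dots> = (\<Sum>r\<in>{1..j}. \<Sum>i<(n - r) div j. ?g (r + j * Suc i))"
    by (subst sum.Sigma) auto
  also have "\<dots> \<le> (\<Sum>r\<in>{1..j}. K)"
  proof (rule sum_mono)
    fix r assume r: "r \<in> {1..j}"
    define p where "p i = real (r + j * i) / real n" for i
    let ?l = "(n - r) div j"
    show "(\<Sum>i<?l. ?g (r + j * Suc i)) \<le> K"
    proof (cases "r \<le> n")
      case True
      have "strict_mono_on {0..?l} p" using n j
        by (auto intro!: strict_mono_onI divide_strict_right_mono simp: p_def)
      moreover have "p ` {0..?l} \<subseteq> {0..1}"
      proof -
        have "r + j * i \<le> n" if "i \<le> ?l" for i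
        proof -
          have "j * i \<le> j * ?l" using that by simp
          also have "\<dots> \<le> n - r" by simp
          finally show ?thesis using True by linarith
        qed
        then have "real (r + j * i) \<le> real n" if "i \<le> ?l" for i using that by (metis of_nat_le_iff)
        then show ?thesis using n by (auto simp: p_def field_simps)
      qed
      ultimately have "(\<Sum>i<?l. d (p (Suc i)) (p i) powr \<kappa>) \<le> K"
        by (rule bounded_kvarD(4)[OF d])
      then show ?thesis by (simp add: p_def algebra_simps)
    next
      case False
      then have "?l = 0" by (metis diff_is_0_eq' div_0 nat_le_linear)
      \<comment> \<open>The empty sum of a one-point chain shows that K is nonnegative, which is
        what a class beyond n requires.\<close>
      moreover have "0 \<le> K"
      proof -
        have "strict_mono_on {0..0::nat} (\<lambda>_. 0 :: real)" by (rule strict_mono_onI) simp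
        from bounded_kvarD(4)[OF d this] show ?thesis by simp
      qed
      ultimately show ?thesis unfolding \<open>?l = 0\<close> by (simp only: lessThan_0 sum.empty)
    qed
  qed
  finally show ?thesis by simp
qed

text \<open>This replaces Hoelder's inequality: \<open>le_add_powr\<close> is applied at the level a
  = (J/n)^(1/\<open>\<kappa>\<close>), for which J = n a^\<open>\<kappa>\<close>, so that both
  resulting terms are multiples of n a. The bound is expressed through J rather than j in order to
  hold uniformly for all lags up to J, and it is o(n) as soon as J is.\<close>

lemma bounded_kvar_lag_sum:
  assumes d: "bounded_kvar \<kappa> K d" and \<kappa>: "1 \<le> \<kappa>" and K: "0 \<le> K"
    and n: "1 \<le> n" and J: "1 \<le> J" "j \<le> J"
  shows "(\<Sum>t\<in>{Suc j..n}. d (real t / real n) (real (t - j) / real n))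
    \<le> real n * ((1 + K) * (real J / real n) powr (1 / \<kappa>))"
proof (cases "j = 0")
  case True
  then show ?thesis using d K by (simp add: bounded_kvar_def)
next
  case False
  define a where "a = (real J / real n) powr (1 / \<kappa>)"
  have a: "0 < a" using n J by (simp add: a_def)
  let ?d = "\<lambda>t. d (real t / real n) (real (t - j) / real n)"
  have "(\<Sum>t\<in>{Suc j..n}. ?d t) \<le> (\<Sum>t\<in>{Suc j..n}. a + a powr (1 - \<kappa>) * ?d t powr \<kappa>)"
    using d a \<kappa> by (intro sum_mono le_add_powr) (auto simp: bounded_kvar_def)
  also have "\<dots> = real (n - j) * a + a powr (1 - \<kappa>) * (\<Sum>t\<in>{Suc j..n}. ?d t powr \<kappa>)"
    by (simp add: sum.distrib sum_distrib_left)
  also have "\<dots> \<le> real n * a + a powr (1 - \<kappa>) * (real J * K)"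
  proof (intro add_mono mult_right_mono mult_left_mono)
    have "(\<Sum>t\<in>{Suc j..n}. ?d t powr \<kappa>) \<le> real j * K"
      using bounded_kvar_lag_sum_powr[OF d n] False by simp
    also have "\<dots> \<le> real J * K" using J K by (intro mult_right_mono) auto
    finally show "(\<Sum>t\<in>{Suc j..n}. ?d t powr \<kappa>) \<le> real J * K" .
  qed (use a in auto)
  also have "a powr (1 - \<kappa>) * (real J * K) = real n * (K * a)"
  proof -
    have "real J = real n * a powr \<kappa>" using n J \<kappa> by (simp add: a_def powr_powr)
    then have "a powr (1 - \<kappa>) * (real J * K) = real n * (K * (a powr (1 - \<kappa>) * a powr \<kappa>))" by simp
    also have "a powr (1 - \<kappa>) * a powr \<kappa> = a" using a by (simp flip: powr_add)
    finally show ?thesis .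
  qed
  finally show ?thesis by (simp add: a_def algebra_simps)
qed

subsection \<open>Functionals of iid sequences\<close>

text \<open>Pasts at different times, pasts of different copies and hybrids with some coordinates
  replaced are all injective selections from one iid family. Hence they share one law.\<close>

lemma (in prob_space) distr_iid_inj:
  fixes \<sigma> :: "nat \<Rightarrow> 'i"
  assumes ind: "indep_vars (\<lambda>_. borel) \<xi> I" and law: "\<And>i. i \<in> I \<Longrightarrow> distr M borel (\<xi> i) = \<nu>"
    and \<sigma>: "inj \<sigma>" "range \<sigma> \<subseteq> I"
  shows "distr M Rinf (\<lambda>x l. \<xi> (\<sigma> l) x) = PiM UNIV (\<lambda>_. \<nu>)"
proof -
  have ne: "I \<noteq> {}" using \<sigma> by auto
  have rv: "random_variable borel (\<xi> i)" if "i \<in> I" for i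
    using ind that by (auto simp: indep_vars_def)
  obtain i where i: "i \<in> I" using ne by auto
  have \<nu>: "prob_space \<nu>" "sets \<nu> = sets borel"
    using law[OF i] rv[OF i] prob_space_distr by (metis, metis sets_distr)
  have sets: "sets (PiM I (\<lambda>_. \<nu>)) = sets (PiM I (\<lambda>_. borel))" "sets (PiM (UNIV::nat set) (\<lambda>_. \<nu>)) = sets Rinf"
    by (intro sets_PiM_cong refl \<nu>(2))+
  have "distr M (PiM I (\<lambda>_. borel)) (\<lambda>x. \<lambda>i\<in>I. \<xi> i x) = PiM I (\<lambda>i. distr M borel (\<xi> i))"
    using indep_vars_iff_distr_eq_PiM'[OF ne, where M'="\<lambda>_. borel" and X=\<xi>] ind rv by simp
  also have "\<dots> = PiM I (\<lambda>_. \<nu>)" by (intro PiM_cong refl law)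
  finally have J: "distr M (PiM I (\<lambda>_. borel)) (\<lambda>x. \<lambda>i\<in>I. \<xi> i x) = PiM I (\<lambda>_. \<nu>)" .
  have m1: "(\<lambda>\<omega> l. \<omega> (\<sigma> l)) \<in> measurable (PiM I (\<lambda>_. borel)) Rinf"
    using \<sigma> by (intro measurable_PiM_single') (auto intro!: measurable_component_singleton)
  have m2: "(\<lambda>x. \<lambda>i\<in>I. \<xi> i x) \<in> measurable M (PiM I (\<lambda>_. borel))"
    by (intro measurable_restrict rv)
  have "distr M Rinf (\<lambda>x l. \<xi> (\<sigma> l) x) = distr (distr M (PiM I (\<lambda>_. borel)) (\<lambda>x. \<lambda>i\<in>I. \<xi> i x)) Rinf (\<lambda>\<omega> l. \<omega> (\<sigma> l))"
    using \<sigma>(2) by (subst distr_distr[OF m1 m2]) (auto simp: comp_def image_subset_iff intro!: distr_cong)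
  also have "\<dots> = distr (PiM I (\<lambda>_. \<nu>)) (PiM UNIV (\<lambda>_. \<nu>)) (\<lambda>\<omega>. \<lambda>n\<in>UNIV. \<omega> (\<sigma> n))"
    unfolding J by (intro distr_cong) (auto simp: sets)
  also have "\<dots> = PiM UNIV (\<lambda>_. \<nu>)"
    using \<sigma> \<nu> by (intro distr_PiM_reindex) auto
  finally show ?thesis .
qed

text \<open>Two uses: a sequence together with its replacement values is a draw from the product
  measure in which the dependence bound is stated, and a hybrid is independent of the remote
  past.\<close>

lemma (in prob_space) indep_iid_pair:
  fixes \<sigma> \<sigma>' :: "nat \<Rightarrow> 'i"
  assumes ind: "indep_vars (\<lambda>_. borel) \<xi> I" and law: "\<And>i. i \<in> I \<Longrightarrow> distr M borel (\<xi> i) = \<nu>"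
    and \<sigma>: "inj \<sigma>" "range \<sigma> \<subseteq> I" "inj \<sigma>'" "range \<sigma>' \<subseteq> I" "range \<sigma> \<inter> range \<sigma>' = {}"
  shows "indep_var Rinf (\<lambda>x l. \<xi> (\<sigma> l) x) Rinf (\<lambda>x l. \<xi> (\<sigma>' l) x)"
    and "distr M (Rinf \<Otimes>\<^sub>M Rinf) (\<lambda>x. (\<lambda>l. \<xi> (\<sigma> l) x, \<lambda>l. \<xi> (\<sigma>' l) x)) =
      PiM UNIV (\<lambda>_. \<nu>) \<Otimes>\<^sub>M PiM UNIV (\<lambda>_. \<nu>)"
proof -
  have m: "(\<lambda>\<omega> l. \<omega> (f l)) \<in> measurable (PiM (range f) (\<lambda>_. borel)) Rinf" for f :: "nat \<Rightarrow> 'i"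
    by (intro measurable_PiM_single') (auto intro!: measurable_component_singleton)
  have "indep_var Rinf ((\<lambda>\<omega> l. \<omega> (\<sigma> l)) \<circ> (\<lambda>x. restrict (\<lambda>i. \<xi> i x) (range \<sigma>)))
     Rinf ((\<lambda>\<omega> l. \<omega> (\<sigma>' l)) \<circ> (\<lambda>x. restrict (\<lambda>i. \<xi> i x) (range \<sigma>')))"
    by (rule indep_var_compose[OF indep_var_restrict[OF ind] m m]) (use \<sigma> in auto)
  also have "(\<lambda>\<omega> l. \<omega> (\<sigma> l)) \<circ> (\<lambda>x. restrict (\<lambda>i. \<xi> i x) (range \<sigma>)) = (\<lambda>x l. \<xi> (\<sigma> l) x)"
    by (auto simp: fun_eq_iff)
  also have "(\<lambda>\<omega> l. \<omega> (\<sigma>' l)) \<circ> (\<lambda>x. restrict (\<lambda>i. \<xi> i x) (range \<sigma>')) = (\<lambda>x l. \<xi> (\<sigma>' l) x)"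
    by (auto simp: fun_eq_iff)
  finally show *: "indep_var Rinf (\<lambda>x l. \<xi> (\<sigma> l) x) Rinf (\<lambda>x l. \<xi> (\<sigma>' l) x)" .
  then show "distr M (Rinf \<Otimes>\<^sub>M Rinf) (\<lambda>x. (\<lambda>l. \<xi> (\<sigma> l) x, \<lambda>l. \<xi> (\<sigma>' l) x)) =
      PiM UNIV (\<lambda>_. \<nu>) \<Otimes>\<^sub>M PiM UNIV (\<lambda>_. \<nu>)"
    unfolding indep_var_distribution_eq
    using distr_iid_inj[OF ind law \<sigma>(1,2)] distr_iid_inj[OF ind law \<sigma>(3,4)] by simp
qed

text \<open>As all \<^term>\<open>D J\<close> have the same law, the good sets are closed under countable unions, although
  nothing is assumed about continuity of their indicators in the coordinates.\<close>

lemma (in prob_space) coordinate_limit_set: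
  assumes meas: "\<And>J. random_variable Rinf (D J)" "random_variable Rinf E"
    and law: "\<And>J. distr M Rinf (D J) = N" "distr M Rinf E = N"
    and ev: "\<And>l. \<exists>J0. \<forall>J\<ge>J0. \<forall>x\<in>space M. D J x l = E x l"
    and A: "A \<in> sets Rinf"
  shows "(\<lambda>J. prob {x\<in>space M. (D J x \<in> A) \<noteq> (E x \<in> A)}) \<longlonglongrightarrow> 0"
proof -
  note meas[measurable]
  let ?G = "{{f \<in> \<Pi>\<^sub>E i\<in>(UNIV::nat set). UNIV. f i \<in> A} |i A. i \<in> UNIV \<and> A \<in> sets (borel::real measure)}"
  have sets: "sets Rinf = sigma_sets UNIV ?G"
    by (subst sets_PiM_single) (simp add: PiE_def extensional_def)
  have "A \<in> sigma_sets UNIV ?G" using A sets by simp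
  then show ?thesis
  proof (induction A rule: sigma_sets.induct)
    \<comment> \<open>Such a set looks at a single coordinate, on which \<open>D J\<close> and
      \<open>E\<close> agree for all large J, so the event is eventually empty.\<close>
    case (Basic a)
    then obtain i B where a: "a = {f \<in> \<Pi>\<^sub>E i\<in>(UNIV::nat set). UNIV. f i \<in> B}" by auto
    obtain J0 where J0: "\<forall>J\<ge>J0. \<forall>x\<in>space M. D J x i = E x i" using ev by blast
    have "\<forall>\<^sub>F J in sequentially. prob {x\<in>space M. (D J x \<in> a) \<noteq> (E x \<in> a)} = 0"
      using eventually_ge_at_top[of J0]
    proof eventually_elim
      case (elim J)
      then have "{x\<in>space M. (D J x \<in> a) \<noteq> (E x \<in> a)} = {}" using J0 by (auto simp: a)
      then show ?case by (simp only: measure_empty)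
    qed
    then show ?case by (simp add: tendsto_eventually)
  next
    case Empty then show ?case by simp
  next
    case (Compl a)
    then show ?case by (simp cong: conj_cong)
  next
    case (Union a)
    have am[measurable]: "a i \<in> sets Rinf" for i using Union.hyps sets by simp
    define U where "U = (\<Union>i. a i)"
    \<comment> \<open>The part of the union not yet covered by the first k+1 sets. Its probability
      under \<open>D J\<close> is the same for every J, which makes the truncation uniform in
      J.\<close>
    define T where "T k = U - (\<Union>i\<le>k. a i)" for k
    have [measurable]: "U \<in> sets Rinf" "T k \<in> sets Rinf" for k by (auto simp: U_def T_def)
    interpret N: prob_space N using law(2) prob_space_distr[OF meas(2)] by simp
    have sN: "sets N = sets Rinf" using law(2) by auto
    have "(\<lambda>k. N.prob (T k)) \<longlonglongrightarrow> N.prob (\<Inter>k. T k)"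
      by (rule N.finite_Lim_measure_decseq)
         (auto simp: sN decseq_def T_def intro: order_trans)
    also have "(\<Inter>k. T k) = {}" by (auto simp: T_def U_def)
    finally have T0: "(\<lambda>k. N.prob (T k)) \<longlonglongrightarrow> 0" by simp
    have TD: "prob {x\<in>space M. D J x \<in> T k} = N.prob (T k)" for J k
      using measure_distr[OF meas(1), of "T k" J] law(1) by (simp add: vimage_def Int_def conj_commute)
    have TE: "prob {x\<in>space M. E x \<in> T k} = N.prob (T k)" for k
      using measure_distr[OF meas(2), of "T k"] law(2) by (simp add: vimage_def Int_def conj_commute)
    \<comment> \<open>If neither sequence lies in \<open>T k\<close>, a disagreement about the union
      is a disagreement about one of the first k+1 sets.\<close>
    have bd: "prob {x\<in>space M. (D J x \<in> U) \<noteq> (E x \<in> U)} \<le>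
        (\<Sum>i\<le>k. prob {x\<in>space M. (D J x \<in> a i) \<noteq> (E x \<in> a i)}) + 2 * N.prob (T k)" for J k
    proof -
      have "prob {x\<in>space M. (D J x \<in> U) \<noteq> (E x \<in> U)} \<le>
        prob ((\<Union>i\<le>k. {x\<in>space M. (D J x \<in> a i) \<noteq> (E x \<in> a i)}) \<union>
          ({x\<in>space M. D J x \<in> T k} \<union> {x\<in>space M. E x \<in> T k}))"
        by (intro finite_measure_mono) (auto simp: T_def U_def)
      also have "\<dots> \<le> prob (\<Union>i\<le>k. {x\<in>space M. (D J x \<in> a i) \<noteq> (E x \<in> a i)}) +
          prob ({x\<in>space M. D J x \<in> T k} \<union> {x\<in>space M. E x \<in> T k})"
        by (intro measure_Un_le) auto
      also have "\<dots> \<le> (\<Sum>i\<le>k. prob {x\<in>space M. (D J x \<in> a i) \<noteq> (E x \<in> a i)}) +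
          (prob {x\<in>space M. D J x \<in> T k} + prob {x\<in>space M. E x \<in> T k})"
        by (intro add_mono measure_Un_le measure_UNION_le) auto
      finally show ?thesis by (simp add: TD TE)
    qed
    show ?case unfolding U_def[symmetric]
    proof (rule LIMSEQ_I)
      fix r :: real assume r: "0 < r"
      from LIMSEQ_D[OF T0, of "r / 4"] r obtain k where k: "N.prob (T k) < r / 4" by auto
      have "(\<lambda>J. \<Sum>i\<le>k. prob {x\<in>space M. (D J x \<in> a i) \<noteq> (E x \<in> a i)}) \<longlonglongrightarrow> (\<Sum>i\<le>k. 0)"
        by (intro tendsto_sum Union.IH)
      from LIMSEQ_D[OF this, of "r / 2"] r obtain J0 where
        J0: "\<And>J. J \<ge> J0 \<Longrightarrow> \<bar>\<Sum>i\<le>k. prob {x\<in>space M. (D J x \<in> a i) \<noteq> (E x \<in> a i)}\<bar> < r / 2" by auto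
      show "\<exists>no. \<forall>n\<ge>no. norm (prob {x \<in> space M. (D n x \<in> U) \<noteq> (E x \<in> U)} - 0) < r"
      proof (intro exI allI impI)
        fix n assume "n \<ge> J0"
        from J0[OF this] bd[of n k] k
        show "norm (prob {x \<in> space M. (D n x \<in> U) \<noteq> (E x \<in> U)} - 0) < r" by simp
      qed
    qed
  qed
qed

text \<open>Values more than 1/k apart are separated by a level of the grid of mesh 1/k. One
  separating level already pays 2, the largest distance in [-1, 1].\<close>

lemma abs_diff_le_levels:
  fixes a b :: real
  assumes "\<bar>a\<bar> \<le> 1" "\<bar>b\<bar> \<le> 1" "0 < k"
  shows "\<bar>a - b\<bar> \<le> 1 / real k + (\<Sum>l\<le>2 * k. 2 * of_bool ((a > real l / real k - 1) \<noteq> (b > real l / real k - 1)))"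
proof (cases "\<bar>a - b\<bar> \<le> 1 / real k")
  case True then show ?thesis by (simp add: add_increasing2 sum_nonneg)
next
  case False
  have *: "\<exists>l\<le>2 * k. x \<le> real l / real k - 1 \<and> real l / real k - 1 < y"
    if x: "\<bar>x\<bar> \<le> 1" "\<bar>y\<bar> \<le> 1" "y - x > 1 / real k" for x y :: real
  proof -
    \<comment> \<open>The lowest grid level not below x; as y - x exceeds the mesh, it is still
      strictly below y.\<close>
    define l where "l = nat \<lceil>real k * (x + 1)\<rceil>"
    have "0 \<le> real k * (x + 1)" using x by auto
    then have l: "real k * (x + 1) \<le> real l" "real l < real k * (x + 1) + 1"
      unfolding l_def by linarith+
    have "1 < real k * (y - x)" using x(3) assms(3) by (simp add: field_simps)
    then have "real l < real k * (y + 1)" using l by (simp add: algebra_simps)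
    moreover have "real k * (y + 1) \<le> real k * 2" using x by (intro mult_left_mono) auto
    ultimately have "real l < 2 * real k" by linarith
    then have "l \<le> 2 * k" by linarith
    moreover have "x \<le> real l / real k - 1 \<and> real l / real k - 1 < y"
      using l(1) \<open>real l < real k * (y + 1)\<close> assms(3) by (simp add: field_simps)
    ultimately show ?thesis by blast
  qed
  have "\<exists>l\<le>2 * k. (a > real l / real k - 1) \<noteq> (b > real l / real k - 1)"
    using *[of a b] *[of b a] False assms by (cases "a < b") (force simp: not_less)+
  then obtain l where l: "l \<le> 2 * k" "(a > real l / real k - 1) \<noteq> (b > real l / real k - 1)" by blast
  have "(2::real) = 2 * of_bool ((a > real l / real k - 1) \<noteq> (b > real l / real k - 1))" using l by simp
  also have "\<dots> \<le> (\<Sum>l\<le>2 * k. 2 * of_bool ((a > real l / real k - 1) \<noteq> (b > real l / real k - 1)))"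
    using l(1) by (intro member_le_sum) auto
  finally have "2 \<le> (\<Sum>l\<le>2 * k. 2 * of_bool ((a > real l / real k - 1) \<noteq> (b > real l / real k - 1)) :: real)" .
  moreover have "\<bar>a - b\<bar> \<le> 2" using assms by linarith
  moreover have "0 \<le> 1 / real k" by simp
  ultimately show ?thesis by linarith
qed

text \<open>A bounded function is resolved into finitely many level sets up to 1/k. The mesh is
  fixed before J grows, so the limits for sets suffice.\<close>

lemma (in prob_space) coordinate_limit_fun:
  assumes meas: "\<And>J. random_variable Rinf (D J)" "random_variable Rinf E"
    and law: "\<And>J. distr M Rinf (D J) = N" "distr M Rinf E = N"
    and ev: "\<And>l. \<exists>J0. \<forall>J\<ge>J0. \<forall>x\<in>space M. D J x l = E x l"
    and F[measurable]: "F \<in> borel_measurable Rinf" and F1: "\<And>y. \<bar>F y\<bar> \<le> 1"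
  shows "(\<lambda>J. expectation (\<lambda>x. \<bar>F (D J x) - F (E x)\<bar>)) \<longlonglongrightarrow> (0::real)"
proof (rule LIMSEQ_I)
  note meas[measurable]
  fix r :: real assume r: "0 < r"
  obtain k :: nat where k2: "2 / r < real k" using reals_Archimedean2 by blast
  have "0 < 2 / r" using r by simp
  then have "0 < real k" using k2 by linarith
  then have k: "0 < k" "1 / real k < r / 2" using k2 r by (auto simp: field_simps)
  define A where "A l = {y \<in> space Rinf. F y > real l / real k - 1}" for l :: nat
  have A: "A l \<in> sets Rinf" for l unfolding A_def by measurable
  have inA: "y \<in> A l \<longleftrightarrow> F y > real l / real k - 1" for y l by (simp add: A_def space_PiM)
  have "(\<lambda>J. 1 / real k + (\<Sum>l\<le>2*k. 2 * prob {x\<in>space M. (D J x \<in> A l) \<noteq> (E x \<in> A l)})) \<longlonglongrightarrow> 1 / real k + (\<Sum>l\<le>2*k. 2 * 0)"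
    by (intro tendsto_intros coordinate_limit_set[OF meas law ev A])
  moreover have "1 / real k + (\<Sum>l\<le>2*k. 2 * 0) < r" using k r by simp
  ultimately have "\<forall>\<^sub>F J in sequentially. 1 / real k + (\<Sum>l\<le>2*k. 2 * prob {x\<in>space M. (D J x \<in> A l) \<noteq> (E x \<in> A l)}) < r"
    by (rule order_tendstoD)
  then obtain J0 where J0: "\<And>J. J \<ge> J0 \<Longrightarrow> 1 / real k + (\<Sum>l\<le>2*k. 2 * prob {x\<in>space M. (D J x \<in> A l) \<noteq> (E x \<in> A l)}) < r"
    by (auto simp: eventually_sequentially)
  show "\<exists>no. \<forall>J\<ge>no. norm (expectation (\<lambda>x. \<bar>F (D J x) - F (E x)\<bar>) - 0) < r"
  proof (intro exI allI impI)
    fix J assume J: "J \<ge> J0"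
    let ?S = "\<lambda>l. {x\<in>space M. (D J x \<in> A l) \<noteq> (E x \<in> A l)}"
    have S[measurable]: "?S l \<in> sets M" for l using A[of l] by measurable
    define g where "g l x = (indicator (?S l) x :: real)" for l x
    have g: "integrable M (g l)" "expectation (g l) = prob (?S l)" for l
    proof -
      define B where "B = ?S l"
      have B: "B \<in> events" "B \<inter> space M = B" using S[of l] by (auto simp: B_def)
      then show "integrable M (g l)" "expectation (g l) = prob (?S l)"
        unfolding g_def B_def[symmetric] by (auto simp: less_top[symmetric])
    qed
    have "expectation (\<lambda>x. \<bar>F (D J x) - F (E x)\<bar>) \<le> expectation (\<lambda>x. 1 / real k + (\<Sum>l\<le>2*k. 2 * g l x))"
    proof (rule integral_mono)
      show "integrable M (\<lambda>x. \<bar>F (D J x) - F (E x)\<bar>)"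
        by (rule integrable_const_bound[where B=2])
          (auto intro!: AE_I2 order_trans[OF abs_triangle_ineq4] add_mono[OF F1 F1, simplified])
      show "integrable M (\<lambda>x. 1 / real k + (\<Sum>l\<le>2*k. 2 * g l x))" using g(1) by simp
      fix x assume "x \<in> space M"
      then show "\<bar>F (D J x) - F (E x)\<bar> \<le> 1 / real k + (\<Sum>l\<le>2*k. 2 * g l x)"
        using abs_diff_le_levels[OF F1[of "D J x"] F1[of "E x"] k(1)]
        by (simp add: g_def inA indicator_def of_bool_def)
    qed
    also have "\<dots> = 1 / real k + (\<Sum>l\<le>2*k. 2 * prob (?S l))"
      using g by (simp add: prob_space)
    also have "\<dots> < r" using J0[OF J] .
    finally show "norm (expectation (\<lambda>x. \<bar>F (D J x) - F (E x)\<bar>) - 0) < r" by simp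
  qed
qed

text \<open>Replace the coordinates from \<^term>\<open>h\<close> on by an independent copy, one after the other: the law
  of each hybrid sequence is that of the original one, each step costs at most \<open>C \<rho>\<^sup>j\<close>, and the limit is
  independent of the past up to time \<open>t - h\<close>. A replacement value is the coordinate 0 of an
  independent sequence, so that a single product measure serves for all \<open>j\<close>.\<close>

lemma (in prob_space) covariance_le_geometric:
  fixes a b :: "int \<Rightarrow> 'i" and F H :: "(nat \<Rightarrow> real) \<Rightarrow> real" and C \<rho> :: real
  assumes ind: "indep_vars (\<lambda>_. borel) \<xi> I" and law: "\<And>i. i \<in> I \<Longrightarrow> distr M borel (\<xi> i) = \<nu>"
    and ab: "inj a" "inj b" "range a \<subseteq> I" "range b \<subseteq> I" "range a \<inter> range b = {}"
    and F[measurable]: "F \<in> borel_measurable Rinf" and F1: "\<And>y. \<bar>F y\<bar> \<le> 1"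
    and H[measurable]: "H \<in> borel_measurable Rinf" and H1: "\<And>y. \<bar>H y\<bar> \<le> 1"
    and N: "N = PiM UNIV (\<lambda>_. \<nu>)"
    and dep: "\<And>j. (\<integral>y. \<bar>F (fst y) - F ((fst y)(j := snd y 0))\<bar> \<partial>(N \<Otimes>\<^sub>M N)) \<le> C * \<rho> ^ j"
    and C: "0 \<le> C" "0 < \<rho>" "\<rho> < 1"
  shows "\<bar>expectation (\<lambda>x. F (\<lambda>l. \<xi> (a (t - int l)) x) * H (\<lambda>l. \<xi> (a (t - int h - int l)) x))
     - (\<integral>y. F y \<partial>N) * (\<integral>y. H y \<partial>N)\<bar> \<le> C / (1 - \<rho>) * \<rho> ^ h"
proof -
  \<comment> \<open>In the J-th hybrid the coordinates h, ..., h + J - 1 come from the copy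
    \<open>b\<close>; \<open>D 0\<close> is the original sequence, and \<open>\<sigma>E\<close>
    replaces everything from h on.\<close>
  define \<sigma> where "\<sigma> J l = (if h \<le> l \<and> l < h + J then b (t - int l) else a (t - int l))" for J l
  define \<sigma>E where "\<sigma>E l = (if h \<le> l then b (t - int l) else a (t - int l))" for l
  define D where "D J x l = \<xi> (\<sigma> J l) x" for J x l
  define E where "E x l = \<xi> (\<sigma>E l) x" for x l
  define P where "P x l = \<xi> (a (t - int h - int l)) x" for x l
  have ab': "a i \<noteq> b j" "b j \<noteq> a i" "a i \<in> I" "b i \<in> I" "a i = a j \<longleftrightarrow> i = j" "b i = b j \<longleftrightarrow> i = j" for i j
    using ab(3,4) ab(5)[unfolded disjoint_iff, rule_format, of "a i", OF rangeI]
    by (auto simp: inj_eq[OF ab(1)] inj_eq[OF ab(2)]; metis rangeI)+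
  have \<sigma>: "inj (\<sigma> J)" "range (\<sigma> J) \<subseteq> I" for J
    using ab' by (auto simp: \<sigma>_def image_subset_iff intro!: injI split: if_splits)
  have \<sigma>E: "inj \<sigma>E" "range \<sigma>E \<subseteq> I"
    using ab' by (auto simp: \<sigma>E_def image_subset_iff intro!: injI split: if_splits)
  have P\<sigma>: "inj (\<lambda>l. a (t - int h - int l))" "range (\<lambda>l. a (t - int h - int l)) \<subseteq> I"
    using ab' by (auto simp: image_subset_iff intro!: injI)
  have rv: "random_variable borel (\<xi> i)" if "i \<in> I" for i
    using ind that by (auto simp: indep_vars_def)
  have m[measurable]: "random_variable Rinf (\<lambda>x l. \<xi> (\<tau> l) x)" if "range \<tau> \<subseteq> I" for \<tau> :: "nat \<Rightarrow> 'i"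
    using that by (intro measurable_PiM_single') (auto intro!: rv simp: space_PiM)
  have mD[measurable]: "random_variable Rinf (D J)" for J unfolding D_def by (rule m[OF \<sigma>(2)])
  have mE[measurable]: "random_variable Rinf E" unfolding E_def by (rule m[OF \<sigma>E(2)])
  have mP[measurable]: "random_variable Rinf P" unfolding P_def by (rule m[OF P\<sigma>(2)])
  have lD: "distr M Rinf (D J) = N" for J unfolding D_def N by (rule distr_iid_inj[OF ind law \<sigma>])
  have lE: "distr M Rinf E = N" unfolding E_def N by (rule distr_iid_inj[OF ind law \<sigma>E])
  have lP: "distr M Rinf P = N" unfolding P_def N by (rule distr_iid_inj[OF ind law P\<sigma>])
  have intF: "integrable M (\<lambda>x. F (Y x))" if "random_variable Rinf Y" for Y
    using that by (intro integrable_const_bound[where B=1]) (auto simp: F1)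
  have intd: "integrable M (\<lambda>x. \<bar>F (Y x) - F (Z x)\<bar>)"
    if "random_variable Rinf Y" "random_variable Rinf Z" for Y Z
    using that by (intro integrable_abs Bochner_Integration.integrable_diff intF)
  have step: "expectation (\<lambda>x. \<bar>F (D J x) - F (D (Suc J) x)\<bar>) \<le> C * \<rho> ^ (h + J)" for J
  proof -
    \<comment> \<open>Starts at the first copy variable that hybrid J does not use. Its coordinate 0
      is the value to be inserted at position h + J, and disjointness from hybrid J makes the pair a
      draw from N x N.\<close>
    define \<sigma>' where "\<sigma>' l = b (t - int (h + J) - int l)" for l
    define R where "R x l = \<xi> (\<sigma>' l) x" for x l
    have \<sigma>': "inj \<sigma>'" "range \<sigma>' \<subseteq> I" "range (\<sigma> J) \<inter> range \<sigma>' = {}"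
      using ab' by (auto simp: \<sigma>'_def \<sigma>_def image_subset_iff intro!: injI split: if_splits)
    have pair: "distr M (Rinf \<Otimes>\<^sub>M Rinf) (\<lambda>x. (D J x, R x)) = N \<Otimes>\<^sub>M N"
      unfolding D_def R_def N by (rule indep_iid_pair(2)[OF ind law \<sigma> \<sigma>'])
    have [measurable]: "random_variable Rinf R" unfolding R_def by (rule m[OF \<sigma>'(2)])
    have up[measurable]: "(\<lambda>y. (fst y)(h + J := snd y 0)) \<in> measurable (Rinf \<Otimes>\<^sub>M Rinf) Rinf"
      by (intro measurable_PiM_single') (auto simp: space_PiM)
    have "D (Suc J) x = (D J x)(h + J := R x 0)" for x
      by (auto simp: fun_eq_iff D_def R_def \<sigma>_def \<sigma>'_def)
    then have "expectation (\<lambda>x. \<bar>F (D J x) - F (D (Suc J) x)\<bar>) =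
        (\<integral>y. \<bar>F (fst y) - F ((fst y)(h + J := snd y 0))\<bar> \<partial>distr M (Rinf \<Otimes>\<^sub>M Rinf) (\<lambda>x. (D J x, R x)))"
      by (subst integral_distr) auto
    then show ?thesis using dep[of "h + J"] pair by simp
  qed
  have geo: "(\<Sum>i<J. C * \<rho> ^ (h + i)) \<le> C / (1 - \<rho>) * \<rho> ^ h" for J
  proof -
    have "(\<Sum>i<J. C * \<rho> ^ (h + i)) = C * \<rho> ^ h * (\<Sum>i<J. \<rho> ^ i)"
      by (simp add: power_add sum_distrib_left mult.assoc)
    also have "\<dots> \<le> C * \<rho> ^ h * (1 / (1 - \<rho>))"
      using C by (intro mult_left_mono) (auto simp: sum_gp_strict divide_right_mono)
    finally show ?thesis by simp
  qed
  have DJ: "expectation (\<lambda>x. \<bar>F (D 0 x) - F (D J x)\<bar>) \<le> (\<Sum>i<J. C * \<rho> ^ (h + i))" for J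
  proof (induction J)
    case (Suc J)
    have "expectation (\<lambda>x. \<bar>F (D 0 x) - F (D (Suc J) x)\<bar>) \<le>
        expectation (\<lambda>x. \<bar>F (D 0 x) - F (D J x)\<bar> + \<bar>F (D J x) - F (D (Suc J) x)\<bar>)"
      by (intro integral_mono intd Bochner_Integration.integrable_add mD) auto
    also have "\<dots> = expectation (\<lambda>x. \<bar>F (D 0 x) - F (D J x)\<bar>) + expectation (\<lambda>x. \<bar>F (D J x) - F (D (Suc J) x)\<bar>)"
      by (intro Bochner_Integration.integral_add intd mD)
    finally show ?case using Suc step[of J] by simp
  qed simp
  have ev: "\<exists>J0. \<forall>J\<ge>J0. \<forall>x\<in>space M. D J x l = E x l" for l
    by (rule exI[of _ "Suc l"]) (auto simp: D_def E_def \<sigma>_def \<sigma>E_def)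
  have lim: "(\<lambda>J. expectation (\<lambda>x. \<bar>F (D J x) - F (E x)\<bar>)) \<longlonglongrightarrow> 0"
    by (rule coordinate_limit_fun[OF mD mE lD lE ev F F1])
  \<comment> \<open>The geometric bound is free of J, so J may tend to infinity and
    \<open>D J\<close> may be exchanged for \<open>E\<close>.\<close>
  have "expectation (\<lambda>x. \<bar>F (D 0 x) - F (E x)\<bar>) \<le> C / (1 - \<rho>) * \<rho> ^ h + expectation (\<lambda>x. \<bar>F (D J x) - F (E x)\<bar>)" for J
  proof -
    have "expectation (\<lambda>x. \<bar>F (D 0 x) - F (E x)\<bar>) \<le>
        expectation (\<lambda>x. \<bar>F (D 0 x) - F (D J x)\<bar> + \<bar>F (D J x) - F (E x)\<bar>)"
      by (intro integral_mono intd Bochner_Integration.integrable_add mD mE) auto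
    also have "\<dots> = expectation (\<lambda>x. \<bar>F (D 0 x) - F (D J x)\<bar>) + expectation (\<lambda>x. \<bar>F (D J x) - F (E x)\<bar>)"
      by (intro Bochner_Integration.integral_add intd mD mE)
    finally show ?thesis using DJ[of J] geo[of J] by simp
  qed
  then have le: "\<exists>J0. \<forall>J\<ge>J0. expectation (\<lambda>x. \<bar>F (D 0 x) - F (E x)\<bar>) \<le> C / (1 - \<rho>) * \<rho> ^ h + expectation (\<lambda>x. \<bar>F (D J x) - F (E x)\<bar>)"
    by blast
  have "(\<lambda>J. C / (1 - \<rho>) * \<rho> ^ h + expectation (\<lambda>x. \<bar>F (D J x) - F (E x)\<bar>)) \<longlonglongrightarrow> C / (1 - \<rho>) * \<rho> ^ h + 0"
    by (intro tendsto_intros lim)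
  from LIMSEQ_le_const[OF this le]
  have close: "expectation (\<lambda>x. \<bar>F (D 0 x) - F (E x)\<bar>) \<le> C / (1 - \<rho>) * \<rho> ^ h" by simp
  \<comment> \<open>The original variables left in \<open>E\<close> belong to times after t - h,
    whereas \<open>P\<close> uses times up to t - h.\<close>
  have disj: "range \<sigma>E \<inter> range (\<lambda>l. a (t - int h - int l)) = {}"
    using ab' by (auto simp: \<sigma>E_def split: if_splits)
  have "indep_var Rinf E Rinf P"
    unfolding E_def P_def by (rule indep_iid_pair(1)[OF ind law \<sigma>E P\<sigma> disj])
  then have "indep_var borel (F \<circ> E) borel (H \<circ> P)" by (rule indep_var_compose) auto
  then have "indep_var borel (\<lambda>x. F (E x)) borel (\<lambda>x. H (P x))" by (simp add: comp_def)
  moreover have iP: "integrable M (\<lambda>x. H (P x))"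
    by (intro integrable_const_bound[where B=1]) (auto simp: H1)
  ultimately have prod: "expectation (\<lambda>x. F (E x) * H (P x)) = expectation (\<lambda>x. F (E x)) * expectation (\<lambda>x. H (P x))"
    by (intro indep_var_lebesgue_integral intF mE)
  have eF: "expectation (\<lambda>x. F (E x)) = (\<integral>y. F y \<partial>N)" unfolding lE[symmetric] by (subst integral_distr) auto
  have eH: "expectation (\<lambda>x. H (P x)) = (\<integral>y. H y \<partial>N)" unfolding lP[symmetric] by (subst integral_distr) auto
  have iFH: "integrable M (\<lambda>x. F (Y x) * H (P x))" if "random_variable Rinf Y" for Y
    using that by (intro integrable_const_bound[where B=1])
      (auto simp: abs_mult intro!: mult_le_one F1 H1)
  have D0: "D 0 x = (\<lambda>l. \<xi> (a (t - int l)) x)" for x by (auto simp: D_def \<sigma>_def fun_eq_iff)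
  \<comment> \<open>By independence the product of the means is the mean of F(\<open>E\<close>)
    H(\<open>P\<close>). The covariance thus becomes the mean of a difference of the F values times
    a factor of absolute value at most 1.\<close>
  have "expectation (\<lambda>x. F (D 0 x) * H (P x)) - (\<integral>y. F y \<partial>N) * (\<integral>y. H y \<partial>N) =
      expectation (\<lambda>x. F (D 0 x) * H (P x) - F (E x) * H (P x))"
    using prod eF eH by (subst Bochner_Integration.integral_diff) (auto intro: iFH mD mE)
  also have "\<bar>\<dots>\<bar> \<le> expectation (\<lambda>x. \<bar>F (D 0 x) * H (P x) - F (E x) * H (P x)\<bar>)"
    by (rule integral_abs_bound)
  also have "\<dots> \<le> expectation (\<lambda>x. \<bar>F (D 0 x) - F (E x)\<bar>)"
  proof (intro integral_mono integrable_abs Bochner_Integration.integrable_diff iFH intF mD mE)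
    fix x
    have "\<bar>F (D 0 x) * H (P x) - F (E x) * H (P x)\<bar> = \<bar>F (D 0 x) - F (E x)\<bar> * \<bar>H (P x)\<bar>"
      by (simp add: left_diff_distrib flip: abs_mult)
    also have "\<dots> \<le> \<bar>F (D 0 x) - F (E x)\<bar> * 1" by (intro mult_left_mono H1) auto
    finally show "\<bar>F (D 0 x) * H (P x) - F (E x) * H (P x)\<bar> \<le> \<bar>F (D 0 x) - F (E x)\<bar>" by simp
  qed
  also note close
  finally show ?thesis by (simp add: D0 P_def[abs_def])
qed

text \<open>On either side of t the distance to t is injective, so each half is dominated by a full
  geometric series.\<close>

lemma sum_power_abs_diff_le:
  fixes \<rho> :: real
  assumes "finite T" "0 < \<rho>" "\<rho> < 1"
  shows "(\<Sum>t'\<in>T. \<rho> ^ nat \<bar>t - t'\<bar>) \<le> 2 / (1 - \<rho>)"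
proof -
  have geo: "(\<Sum>i\<in>S. \<rho> ^ i) \<le> 1 / (1 - \<rho>)" if "finite S" for S
  proof -
    have "(\<Sum>i\<in>S. \<rho> ^ i) \<le> (\<Sum>i. \<rho> ^ i)"
      using assms that by (intro sum_le_suminf summable_geometric) auto
    then show ?thesis using assms by (simp add: suminf_geometric)
  qed
  have half: "(\<Sum>t'\<in>S. \<rho> ^ nat \<bar>t - t'\<bar>) \<le> 1 / (1 - \<rho>)"
    if "finite S" "inj_on (\<lambda>t'. nat \<bar>t - t'\<bar>) S" for S
    using geo[of "(\<lambda>t'. nat \<bar>t - t'\<bar>) ` S"] that by (simp add: sum.reindex)
  have "(\<Sum>t'\<in>T. \<rho> ^ nat \<bar>t - t'\<bar>) = (\<Sum>t'\<in>{t'\<in>T. t' < t}. \<rho> ^ nat \<bar>t - t'\<bar>) + (\<Sum>t'\<in>{t'\<in>T. \<not> t' < t}. \<rho> ^ nat \<bar>t - t'\<bar>)"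
    using assms(1) by (subst sum.union_disjoint[symmetric]) (auto intro!: sum.cong)
  also have "\<dots> \<le> 1 / (1 - \<rho>) + 1 / (1 - \<rho>)"
    using assms(1) by (intro add_mono half) (auto simp: inj_on_def)
  finally show ?thesis by simp
qed

text \<open>The second moment is a double sum of covariances that decay geometrically in the
  distance of the times, so one of the two factors card T disappears. The functionals may change
  with t, and the weights are arbitrary: the window means use 1/(w+1), the cross term of the
  criterion uses h.\<close>

lemma (in prob_space) weighted_sum_deviation:
  fixes a b :: "int \<Rightarrow> 'i" and F :: "int \<Rightarrow> (nat \<Rightarrow> real) \<Rightarrow> real"
  assumes ind: "indep_vars (\<lambda>_. borel) \<xi> I" and law: "\<And>i. i \<in> I \<Longrightarrow> distr M borel (\<xi> i) = \<nu>"
    and ab: "inj a" "inj b" "range a \<subseteq> I" "range b \<subseteq> I" "range a \<inter> range b = {}"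
    and N: "N = PiM UNIV (\<lambda>_. \<nu>)"
    and T: "finite T"
    and F[measurable]: "\<And>t. t \<in> T \<Longrightarrow> F t \<in> borel_measurable Rinf"
    and F1: "\<And>t y. t \<in> T \<Longrightarrow> \<bar>F t y\<bar> \<le> 1"
    and dep: "\<And>t j. t \<in> T \<Longrightarrow> (\<integral>y. \<bar>F t (fst y) - F t ((fst y)(j := snd y 0))\<bar> \<partial>(N \<Otimes>\<^sub>M N)) \<le> C * \<rho> ^ j"
    and C: "0 \<le> C" "0 < \<rho>" "\<rho> < 1"
    and c: "\<And>t. t \<in> T \<Longrightarrow> \<bar>c t\<bar> \<le> B" "0 \<le> B"
  shows "expectation (\<lambda>x. \<bar>\<Sum>t\<in>T. c t * (F t (\<lambda>l. \<xi> (a (t - int l)) x) - (\<integral>y. F t y \<partial>N))\<bar>)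
     \<le> B * sqrt (2 * C / (1 - \<rho>)\<^sup>2) * sqrt (card T)"
proof -
  define \<mu> where "\<mu> t = (\<integral>y. F t y \<partial>N)" for t
  define X where "X t x l = \<xi> (a (t - int l)) x" for t x l
  define Z where "Z t x = F t (X t x) - \<mu> t" for t x
  define S where "S x = (\<Sum>t\<in>T. c t * Z t x)" for x
  have rv: "random_variable borel (\<xi> i)" if "i \<in> I" for i
    using ind that by (auto simp: indep_vars_def)
  have mX[measurable]: "random_variable Rinf (X t)" for t
    unfolding X_def using ab by (intro measurable_PiM_single') (auto intro!: rv simp: space_PiM)
  have lX: "distr M Rinf (X t) = N" for t
    unfolding X_def N using ab by (intro distr_iid_inj[OF ind law]) (auto simp: inj_eq intro!: injI)
  have iF: "integrable M (\<lambda>x. F t (X t x))" if "t \<in> T" for t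
    using that F[OF that] by (intro integrable_const_bound[where B=1]) (auto simp: F1)
  have eF: "expectation (\<lambda>x. F t (X t x)) = \<mu> t" if "t \<in> T" for t
    unfolding \<mu>_def lX[of t, symmetric] using F[OF that] by (subst integral_distr) auto
  have iFF: "integrable M (\<lambda>x. F t (X t x) * F t' (X t' x))" if "t \<in> T" "t' \<in> T" for t t'
    using F[OF that(1)] F[OF that(2)] that by (intro integrable_const_bound[where B=1])
      (auto simp: abs_mult intro!: mult_le_one F1)
  have ZZ: "integrable M (\<lambda>x. Z t x * Z t' x)"
    "expectation (\<lambda>x. Z t x * Z t' x) = expectation (\<lambda>x. F t (X t x) * F t' (X t' x)) - \<mu> t * \<mu> t'"
    if "t \<in> T" "t' \<in> T" for t t'
  proof -
    have eq: "Z t x * Z t' x = F t (X t x) * F t' (X t' x) - \<mu> t * F t' (X t' x) - \<mu> t' * F t (X t x) + \<mu> t * \<mu> t'" for x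
      by (simp add: Z_def algebra_simps)
    note i = iFF[OF that] iF[OF that(1)] iF[OF that(2)]
    show "integrable M (\<lambda>x. Z t x * Z t' x)" unfolding eq using i by auto
    show "expectation (\<lambda>x. Z t x * Z t' x) = expectation (\<lambda>x. F t (X t x) * F t' (X t' x)) - \<mu> t * \<mu> t'"
      unfolding eq using i eF[OF that(1)] eF[OF that(2)] by (simp add: prob_space)
  qed
  have cov1: "\<bar>expectation (\<lambda>x. Z t x * Z t' x)\<bar> \<le> C / (1 - \<rho>) * \<rho> ^ nat \<bar>t - t'\<bar>"
    if "t \<in> T" "t' \<in> T" "t' \<le> t" for t t'
  proof -
    have "X t' x = (\<lambda>l. \<xi> (a (t - int (nat \<bar>t - t'\<bar>) - int l)) x)" for x
      using that(3) by (auto simp: X_def fun_eq_iff)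
    moreover have "X t x = (\<lambda>l. \<xi> (a (t - int l)) x)" for x by (simp add: X_def fun_eq_iff)
    ultimately show ?thesis
      unfolding ZZ(2)[OF that(1,2)] \<mu>_def
      using covariance_le_geometric[OF ind law ab F[OF that(1)] F1[OF that(1)] F[OF that(2)] F1[OF that(2)] N dep[OF that(1)] C,
          of t "nat \<bar>t - t'\<bar>"] by simp
  qed
  have cov: "\<bar>expectation (\<lambda>x. Z t x * Z t' x)\<bar> \<le> C / (1 - \<rho>) * \<rho> ^ nat \<bar>t - t'\<bar>"
    if "t \<in> T" "t' \<in> T" for t t'
    using cov1[of t t'] cov1[of t' t] that by (cases "t' \<le> t") (auto simp: mult.commute abs_minus_commute)
  have S2: "(S x)\<^sup>2 = (\<Sum>t\<in>T. \<Sum>t'\<in>T. (c t * c t') * (Z t x * Z t' x))" for x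
    by (simp add: S_def power2_eq_square sum_product algebra_simps)
  have iS2: "integrable M (\<lambda>x. (S x)\<^sup>2)"
    unfolding S2 by (intro Bochner_Integration.integrable_sum integrable_mult_right ZZ)
  have iS: "integrable M S"
    unfolding S_def Z_def by (intro Bochner_Integration.integrable_sum integrable_mult_right Bochner_Integration.integrable_diff iF) auto
  have "expectation (\<lambda>x. (S x)\<^sup>2) = (\<Sum>t\<in>T. \<Sum>t'\<in>T. (c t * c t') * expectation (\<lambda>x. Z t x * Z t' x))"
    unfolding S2 by (subst Bochner_Integration.integral_sum; (intro Bochner_Integration.integrable_sum integrable_mult_right ZZ)?)
       (auto intro!: sum.cong simp: ZZ Bochner_Integration.integral_sum)
  also have "\<dots> \<le> (\<Sum>t\<in>T. \<Sum>t'\<in>T. B\<^sup>2 * (C / (1 - \<rho>) * \<rho> ^ nat \<bar>t - t'\<bar>))"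
  proof (intro sum_mono)
    fix t t' assume t: "t \<in> T" "t' \<in> T"
    have "(c t * c t') * expectation (\<lambda>x. Z t x * Z t' x) \<le> \<bar>c t * c t'\<bar> * \<bar>expectation (\<lambda>x. Z t x * Z t' x)\<bar>"
      by (metis abs_ge_self abs_mult)
    also have "\<dots> \<le> B\<^sup>2 * (C / (1 - \<rho>) * \<rho> ^ nat \<bar>t - t'\<bar>)"
      using c t by (intro mult_mono cov) (auto simp: abs_mult power2_eq_square intro!: mult_mono)
    finally show "(c t * c t') * expectation (\<lambda>x. Z t x * Z t' x) \<le> B\<^sup>2 * (C / (1 - \<rho>) * \<rho> ^ nat \<bar>t - t'\<bar>)" .
  qed
  also have "\<dots> = B\<^sup>2 * (C / (1 - \<rho>)) * (\<Sum>t\<in>T. \<Sum>t'\<in>T. \<rho> ^ nat \<bar>t - t'\<bar>)"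
    by (simp add: sum_distrib_left mult.assoc)
  also have "\<dots> \<le> B\<^sup>2 * (C / (1 - \<rho>)) * (\<Sum>t\<in>T. 2 / (1 - \<rho>))"
    using C T by (intro mult_left_mono sum_mono sum_power_abs_diff_le) auto
  also have "\<dots> = B\<^sup>2 * (2 * C / (1 - \<rho>)\<^sup>2) * card T"
    by (simp add: power2_eq_square)
  finally have E2: "expectation (\<lambda>x. (S x)\<^sup>2) \<le> B\<^sup>2 * (2 * C / (1 - \<rho>)\<^sup>2) * card T" .
  \<comment> \<open>Nonnegativity of this variance is the Cauchy-Schwarz bound of the first absolute
    moment by the second moment.\<close>
  have "0 \<le> variance (\<lambda>x. \<bar>S x\<bar>)" by (rule variance_positive)
  also have "\<dots> = expectation (\<lambda>x. (S x)\<^sup>2) - (expectation (\<lambda>x. \<bar>S x\<bar>))\<^sup>2"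
    using iS iS2 by (subst variance_eq) auto
  finally have "(expectation (\<lambda>x. \<bar>S x\<bar>))\<^sup>2 \<le> B\<^sup>2 * (2 * C / (1 - \<rho>)\<^sup>2) * card T" using E2 by linarith
  then have "expectation (\<lambda>x. \<bar>S x\<bar>) \<le> sqrt (B\<^sup>2 * (2 * C / (1 - \<rho>)\<^sup>2) * card T)"
    by (rule real_le_rsqrt)
  also have "\<dots> = B * sqrt (2 * C / (1 - \<rho>)\<^sup>2) * sqrt (card T)"
    using c(2) unfolding real_sqrt_mult by simp
  finally show ?thesis by (simp add: S_def Z_def X_def[abs_def] \<mu>_def)
qed

subsection \<open>The criterion for a scalar series\<close>

text \<open>The part of the criterion that belongs to one feature. The squared norm and the inner
  product in \<open>Q_RW\<close> split over the coordinates, and the rolling means act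
  coordinatewise.\<close>

definition rw_crit :: "nat \<Rightarrow> nat \<Rightarrow> nat \<Rightarrow> nat \<Rightarrow> nat \<Rightarrow> (int \<Rightarrow> real) \<Rightarrow> real" where
  "rw_crit m w \<tau> L n y = 1 / (real n - real m) * (\<Sum>t\<in>{int m + int \<tau> + int L..int n}.
     (let \<Delta> = rolling_mean m w y (t - int L) in \<Delta>\<^sup>2 + 2 * (\<Delta> * (y t - \<Delta>))))"

lemma rolling_mean_nth:
  fixes f :: "int \<Rightarrow> real^'k"
  shows "rolling_mean m w f t $ c = rolling_mean m w (\<lambda>t. f t $ c) t"
  by (simp add: rolling_mean_def)

lemma rolling_mean_diff:
  "rolling_mean m w f t - rolling_mean m w g t = rolling_mean m w (\<lambda>t. f t - g t) t"
  by (simp add: rolling_mean_def sum_subtractf scaleR_right_diff_distrib)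

lemma Q_RW_eq_sum_rw_crit:
  fixes \<phi> :: "real^'d::finite^'m::finite \<Rightarrow> real^'k::finite"
  shows "Q_RW m s \<phi> w \<tau> L n Xobs Xsim = (\<Sum>c\<in>UNIV. rw_crit m w \<tau> L n
    (\<lambda>t. \<phi> (window m Xobs t) $ c - 1 / real s * (\<Sum>r=1..s. \<phi> (window m (Xsim r) t) $ c)))"
proof -
  let ?f = "\<lambda>t. \<phi> (window m Xobs t) - (1 / real s) *\<^sub>R (\<Sum>r=1..s. \<phi> (window m (Xsim r) t))"
  have nth: "?f t $ c = \<phi> (window m Xobs t) $ c - 1 / real s * (\<Sum>r=1..s. \<phi> (window m (Xsim r) t) $ c)" for t c
    by simp
  have "Q_RW m s \<phi> w \<tau> L n Xobs Xsim = 1 / (real n - real m) * (\<Sum>t\<in>{int m + int \<tau> + int L..int n}.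
     (norm (rolling_mean m w ?f (t - int L)))\<^sup>2 +
     2 * (rolling_mean m w ?f (t - int L) \<bullet> (?f t - rolling_mean m w ?f (t - int L))))"
    unfolding Q_RW_def Let_def rolling_mean_diff ..
  also have "\<dots> = 1 / (real n - real m) * (\<Sum>t\<in>{int m + int \<tau> + int L..int n}. \<Sum>c\<in>UNIV.
     (let \<Delta> = rolling_mean m w (\<lambda>t. ?f t $ c) (t - int L) in \<Delta>\<^sup>2 + 2 * (\<Delta> * (?f t $ c - \<Delta>))))"
    unfolding power2_norm_eq_inner inner_vec_def Let_def
    by (simp add: rolling_mean_nth sum.distrib sum_distrib_left power2_eq_square)
  also have "\<dots> = (\<Sum>c\<in>UNIV. rw_crit m w \<tau> L n (\<lambda>t. ?f t $ c))"
    unfolding rw_crit_def by (subst sum.swap) (simp add: sum_distrib_left)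
  finally show ?thesis unfolding nth .
qed

section \<open>Elementary properties of the window mean\<close>

lemma rolling_mean_cong:
  assumes "\<And>j. int m < j \<Longrightarrow> j \<le> t \<Longrightarrow> f j = g j"
  shows "rolling_mean m w f t = rolling_mean m w g t"
  using assms unfolding rolling_mean_def by (intro arg_cong2[where f=scaleR] sum.cong) auto

lemma rolling_mean_mono:
  fixes f g :: "int \<Rightarrow> real"
  assumes "int m \<le> t" "\<And>j. int m < j \<Longrightarrow> j \<le> t \<Longrightarrow> f j \<le> g j"
  shows "rolling_mean m w f t \<le> rolling_mean m w g t"
  using assms unfolding rolling_mean_def real_scaleR_def
  by (intro mult_left_mono sum_mono) auto

lemma abs_rolling_mean_le:
  fixes f :: "int \<Rightarrow> real"
  assumes "int m \<le> t"
  shows "\<bar>rolling_mean m w f t\<bar> \<le> rolling_mean m w (\<lambda>j. \<bar>f j\<bar>) t"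
  using assms unfolding rolling_mean_def real_scaleR_def abs_mult
  by (intro mult_mono sum_abs) auto

text \<open>The normalising factor is the number of indices in the window. At t = m the window is
  empty and the mean is 0, hence the strict inequality.\<close>

lemma rolling_mean_const:
  assumes "int m < t"
  shows "rolling_mean m w (\<lambda>_. B::real) t = B"
proof -
  have "int (card {max (t - int w) (int m + 1)..t}) = min (int w + 1) (t - int m)"
    using assms by auto
  then have "real (card {max (t - int w) (int m + 1)..t}) = real_of_int (min (int w + 1) (t - int m))"
    by linarith
  moreover have "0 < real_of_int (min (int w + 1) (t - int m))" using assms by auto
  ultimately show ?thesis by (simp add: rolling_mean_def)
qed

lemma abs_rolling_mean_le_const:
  fixes f :: "int \<Rightarrow> real"
  assumes "int m < t" "\<And>j. int m < j \<Longrightarrow> j \<le> t \<Longrightarrow> \<bar>f j\<bar> \<le> B"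
  shows "\<bar>rolling_mean m w f t\<bar> \<le> B"
  using abs_rolling_mean_le[of m t w f] rolling_mean_mono[of m t "\<lambda>j. \<bar>f j\<bar>" "\<lambda>_. B" w]
    rolling_mean_const[of m t w B] assms by simp

lemma rolling_mean_full:
  fixes f :: "int \<Rightarrow> real"
  assumes "int m + int w < t"
  shows "rolling_mean m w f t = 1 / (real w + 1) * (\<Sum>i\<in>{0..w}. f (t - int i))"
proof -
  have "(\<Sum>j\<in>{t - int w..t}. f j) = (\<Sum>i\<in>{0..w}. f (t - int i))"
    by (rule sum.reindex_bij_witness[of _ "\<lambda>i. t - int i" "\<lambda>j. nat (t - j)"]) auto
  moreover have "min (int w + 1) (t - int m) = int w + 1" "max (t - int w) (int m + 1) = t - int w"
    using assms by auto
  ultimately show ?thesis by (simp add: rolling_mean_def)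
qed

section \<open>Estimates for one summand and for the scalar criterion\<close>

lemma rw_term_bound:
  fixes \<Delta> y :: real
  assumes "\<bar>\<Delta>\<bar> \<le> 2" "\<bar>y\<bar> \<le> 2"
  shows "\<bar>\<Delta>\<^sup>2 + 2 * (\<Delta> * (y - \<Delta>))\<bar> \<le> 12"
proof -
  have "\<Delta>\<^sup>2 + 2 * (\<Delta> * (y - \<Delta>)) = \<Delta> * (2 * y - \<Delta>)" by (simp add: power2_eq_square algebra_simps)
  moreover have "\<bar>\<Delta> * (2 * y - \<Delta>)\<bar> \<le> 2 * 6"
    unfolding abs_mult using assms by (intro mult_mono) auto
  ultimately show ?thesis by simp
qed

text \<open>The summand is \<open>\<Delta>\<close> (2 y - \<open>\<Delta>\<close>), so exchanging
  \<open>\<Delta>\<close> for h costs a multiple of their distance. What is left, the square of h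
  plus 2 h (y - h), is linear in y with weight h.\<close>

lemma rw_term_approx:
  fixes \<Delta> y h :: real
  assumes "\<bar>\<Delta>\<bar> \<le> 2" "\<bar>y\<bar> \<le> 2" "\<bar>h\<bar> \<le> 2"
  shows "\<bar>\<Delta>\<^sup>2 + 2 * (\<Delta> * (y - \<Delta>)) - h\<^sup>2 - 2 * (h * (y - h))\<bar> \<le> 8 * \<bar>\<Delta> - h\<bar>"
proof -
  have "\<Delta>\<^sup>2 + 2 * (\<Delta> * (y - \<Delta>)) - h\<^sup>2 - 2 * (h * (y - h)) = (\<Delta> - h) * (2 * y - (\<Delta> + h))"
    by (simp add: power2_eq_square algebra_simps)
  also have "\<bar>\<dots>\<bar> \<le> \<bar>\<Delta> - h\<bar> * 8"
    unfolding abs_mult using assms by (intro mult_left_mono) auto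
  finally show ?thesis by simp
qed

lemma rw_term_Lipschitz:
  fixes \<Delta> y \<Delta>' y' :: real
  assumes "\<bar>\<Delta>\<bar> \<le> 2" "\<bar>y\<bar> \<le> 2" "\<bar>\<Delta>'\<bar> \<le> 2" "\<bar>y'\<bar> \<le> 2"
  shows "\<bar>(\<Delta>\<^sup>2 + 2 * (\<Delta> * (y - \<Delta>))) - (\<Delta>'\<^sup>2 + 2 * (\<Delta>' * (y' - \<Delta>')))\<bar> \<le> 8 * \<bar>\<Delta> - \<Delta>'\<bar> + 4 * \<bar>y - y'\<bar>"
proof -
  have "(\<Delta>\<^sup>2 + 2 * (\<Delta> * (y - \<Delta>))) - (\<Delta>'\<^sup>2 + 2 * (\<Delta>' * (y' - \<Delta>'))) =
      (\<Delta> - \<Delta>') * (2 * y - (\<Delta> + \<Delta>')) + (y - y') * (2 * \<Delta>')"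
    by (simp add: power2_eq_square algebra_simps)
  also have "\<bar>\<dots>\<bar> \<le> \<bar>\<Delta> - \<Delta>'\<bar> * 8 + \<bar>y - y'\<bar> * 4"
    by (rule order_trans[OF abs_triangle_ineq], unfold abs_mult, intro add_mono mult_left_mono)
       (use assms in auto)
  finally show ?thesis by simp
qed

text \<open>Three errors separate the criterion from the average of the squares of h: boundary
  terms, the distance of the lagged window mean from h, and a centred sum with weights h. From
  \<open>T0\<close> on, the lagged window is complete.\<close>

lemma rw_crit_approx:
  fixes m n \<tau> w L :: nat and y h :: "int \<Rightarrow> real"
  assumes mn: "m < n" and \<tau>: "1 \<le> \<tau>"
    and y: "\<And>t. t \<in> {int m + 1..int n} \<Longrightarrow> \<bar>y t\<bar> \<le> 2"
    and h: "\<And>t. t \<in> {int m + 1..int n} \<Longrightarrow> \<bar>h t\<bar> \<le> 2"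
  defines "T0 \<equiv> int m + int \<tau> + int w + 1 + int L"
  shows "\<bar>rw_crit m w \<tau> L n y - 1 / (real n - real m) * (\<Sum>t\<in>{int m + 1..int n}. (h t)\<^sup>2)\<bar> \<le>
    1 / (real n - real m) * (16 * (real \<tau> + real w + 1 + real L) +
      8 * (\<Sum>t\<in>{T0..int n}. \<bar>rolling_mean m w y (t - int L) - h t\<bar>) +
      2 * \<bar>\<Sum>t\<in>{T0..int n}. h t * (y t - h t)\<bar>)"
proof -
  define \<Delta> where "\<Delta> t = rolling_mean m w y (t - int L)" for t
  define f where "f t = (\<Delta> t)\<^sup>2 + 2 * (\<Delta> t * (y t - \<Delta> t))" for t
  let ?I = "{int m + int \<tau> + int L..int n}"
  have \<Delta>: "\<bar>\<Delta> t\<bar> \<le> 2" if "t \<in> ?I" for t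
    unfolding \<Delta>_def using that \<tau> by (intro abs_rolling_mean_le_const y) auto
  have f: "\<bar>f t\<bar> \<le> 12" if "t \<in> ?I" for t
    unfolding f_def using that \<tau> by (intro rw_term_bound \<Delta> y) auto
  have split: "(\<Sum>t\<in>A. g t) = (\<Sum>t\<in>{T0..int n}. g t) + (\<Sum>t\<in>{t\<in>A. t < T0}. g t)"
    if "A = {a..int n}" "a \<le> T0" for A a and g :: "int \<Rightarrow> real"
  proof -
    have "finite {t\<in>A. t < T0}" by (rule finite_subset[of _ A]) (auto simp: that(1))
    moreover have "A = {T0..int n} \<union> {t\<in>A. t < T0}" using that by auto
    moreover have "{T0..int n} \<inter> {t\<in>A. t < T0} = {}" by auto
    ultimately show ?thesis by (metis finite_atLeastAtMost_int sum.union_disjoint)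
  qed
  \<comment> \<open>The criterion has at most w + 1 summands before \<open>T0\<close>, each at most
    12 in absolute value.\<close>
  have d1: "\<bar>\<Sum>t\<in>{t\<in>?I. t < T0}. f t\<bar> \<le> 12 * (real w + 1)"
  proof -
    have "\<bar>\<Sum>t\<in>{t\<in>?I. t < T0}. f t\<bar> \<le> (\<Sum>t\<in>{t\<in>?I. t < T0}. 12)"
      by (rule order_trans[OF sum_abs]) (intro sum_mono f, auto)
    also have "\<dots> = 12 * card {t\<in>?I. t < T0}" by simp
    also have "card {t\<in>?I. t < T0} \<le> card {int m + int \<tau> + int L..<T0}"
      by (intro card_mono) auto
    also have "\<dots> = Suc w" by (simp add: T0_def)
    finally show ?thesis by simp
  qed
  \<comment> \<open>The average of squares starts at m + 1 and so has up to \<open>\<tau>\<close> +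
    w + L times before \<open>T0\<close>, with squares at most 4. Together with the preceding bound
    this explains the constant 16 = 12 + 4.\<close>
  have d2: "\<bar>\<Sum>t\<in>{t\<in>{int m + 1..int n}. t < T0}. (h t)\<^sup>2\<bar> \<le> 4 * (real \<tau> + real w + real L)"
  proof -
    have "\<bar>\<Sum>t\<in>{t\<in>{int m + 1..int n}. t < T0}. (h t)\<^sup>2\<bar> \<le> (\<Sum>t\<in>{t\<in>{int m + 1..int n}. t < T0}. 4)"
      by (rule order_trans[OF sum_abs], intro sum_mono)
         (use h abs_le_square_iff[of _ "2::real"] in \<open>auto simp: power2_eq_square\<close>)
    also have "\<dots> = 4 * card {t\<in>{int m + 1..int n}. t < T0}" by simp
    also have "card {t\<in>{int m + 1..int n}. t < T0} \<le> card {int m + 1..<T0}"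
      by (intro card_mono) auto
    also have "\<dots> = \<tau> + w + L" by (simp add: T0_def)
    finally show ?thesis by simp
  qed
  have d3: "\<bar>(\<Sum>t\<in>{T0..int n}. f t) - (\<Sum>t\<in>{T0..int n}. (h t)\<^sup>2)\<bar> \<le>
      8 * (\<Sum>t\<in>{T0..int n}. \<bar>\<Delta> t - h t\<bar>) + 2 * \<bar>\<Sum>t\<in>{T0..int n}. h t * (y t - h t)\<bar>"
  proof -
    have "(\<Sum>t\<in>{T0..int n}. f t) - (\<Sum>t\<in>{T0..int n}. (h t)\<^sup>2) =
      (\<Sum>t\<in>{T0..int n}. f t - (h t)\<^sup>2 - 2 * (h t * (y t - h t))) + 2 * (\<Sum>t\<in>{T0..int n}. h t * (y t - h t))"
      by (simp add: sum_subtractf sum_distrib_left)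
    moreover have "\<bar>\<Sum>t\<in>{T0..int n}. f t - (h t)\<^sup>2 - 2 * (h t * (y t - h t))\<bar> \<le> (\<Sum>t\<in>{T0..int n}. 8 * \<bar>\<Delta> t - h t\<bar>)"
      unfolding f_def
      by (rule order_trans[OF sum_abs], intro sum_mono rw_term_approx \<Delta> y h) (use \<tau> in \<open>auto simp: T0_def\<close>)
    ultimately show ?thesis by (simp flip: sum_distrib_left)
  qed
  have "\<bar>(\<Sum>t\<in>?I. f t) - (\<Sum>t\<in>{int m + 1..int n}. (h t)\<^sup>2)\<bar> \<le> 16 * (real \<tau> + real w + 1 + real L) +
      8 * (\<Sum>t\<in>{T0..int n}. \<bar>\<Delta> t - h t\<bar>) + 2 * \<bar>\<Sum>t\<in>{T0..int n}. h t * (y t - h t)\<bar>"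
    using split[of ?I "int m + int \<tau> + int L" f] split[of "{int m + 1..int n}" "int m + 1" "\<lambda>t. (h t)\<^sup>2"] d1 d2 d3
    by (simp add: T0_def)
  then have "1 / (real n - real m) * \<bar>(\<Sum>t\<in>?I. f t) - (\<Sum>t\<in>{int m + 1..int n}. (h t)\<^sup>2)\<bar> \<le>
     1 / (real n - real m) * (16 * (real \<tau> + real w + 1 + real L) +
      8 * (\<Sum>t\<in>{T0..int n}. \<bar>\<Delta> t - h t\<bar>) + 2 * \<bar>\<Sum>t\<in>{T0..int n}. h t * (y t - h t)\<bar>)"
    using mn by (intro mult_left_mono) auto
  moreover have "rw_crit m w \<tau> L n y = 1 / (real n - real m) * (\<Sum>t\<in>?I. f t)"
    by (simp add: rw_crit_def f_def \<Delta>_def Let_def)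
  moreover have "\<bar>1 / (real n - real m) * X - 1 / (real n - real m) * Y\<bar> = 1 / (real n - real m) * \<bar>X - Y\<bar>" for X Y
    using mn by (simp add: abs_mult flip: right_diff_distrib diff_divide_distrib)
  ultimately show ?thesis by (simp only: \<Delta>_def)
qed

text \<open>The right-hand side is linear in d. In the application d is a random majorant for all
  close pairs of parameters, and by linearity its expectation can be taken term by term.\<close>

lemma rw_crit_Lipschitz:
  assumes mn: "m < n" and \<tau>: "1 \<le> \<tau>"
    and y: "\<And>t. t \<in> {int m + 1..int n} \<Longrightarrow> \<bar>y t\<bar> \<le> 2"
    and y': "\<And>t. t \<in> {int m + 1..int n} \<Longrightarrow> \<bar>y' t\<bar> \<le> 2"
    and d: "\<And>t. t \<in> {int m + 1..int n} \<Longrightarrow> \<bar>y t - y' t\<bar> \<le> d t"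
  shows "\<bar>rw_crit m w \<tau> L n y - rw_crit m w \<tau> L n y'\<bar> \<le>
    1 / (real n - real m) * (\<Sum>t\<in>{int m + int \<tau> + int L..int n}. 8 * rolling_mean m w d (t - int L) + 4 * d t)"
proof -
  let ?I = "{int m + int \<tau> + int L..int n}"
  let ?g = "\<lambda>y t. let \<Delta> = rolling_mean m w y (t - int L) in \<Delta>\<^sup>2 + 2 * (\<Delta> * (y t - \<Delta>))"
  have "\<bar>(\<Sum>t\<in>?I. ?g y t) - (\<Sum>t\<in>?I. ?g y' t)\<bar> \<le> (\<Sum>t\<in>?I. 8 * rolling_mean m w d (t - int L) + 4 * d t)"
    unfolding sum_subtractf[symmetric]
  proof (rule order_trans[OF sum_abs], rule sum_mono)
    fix t assume t: "t \<in> ?I"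
    have "\<bar>rolling_mean m w y (t - int L) - rolling_mean m w y' (t - int L)\<bar> \<le> rolling_mean m w (\<lambda>t. \<bar>y t - y' t\<bar>) (t - int L)"
      unfolding rolling_mean_diff using t by (intro abs_rolling_mean_le) auto
    also have "\<dots> \<le> rolling_mean m w d (t - int L)"
      using t by (intro rolling_mean_mono d) auto
    finally have 1: "\<bar>rolling_mean m w y (t - int L) - rolling_mean m w y' (t - int L)\<bar> \<le> rolling_mean m w d (t - int L)" .
    have "\<bar>?g y t - ?g y' t\<bar> \<le> 8 * \<bar>rolling_mean m w y (t - int L) - rolling_mean m w y' (t - int L)\<bar> + 4 * \<bar>y t - y' t\<bar>"
      unfolding Let_def using t \<tau> by (intro rw_term_Lipschitz abs_rolling_mean_le_const y y') auto
    also have "\<dots> \<le> 8 * rolling_mean m w d (t - int L) + 4 * d t"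
      using 1 d[of t] t \<tau> by auto
    finally show "\<bar>?g y t - ?g y' t\<bar> \<le> 8 * rolling_mean m w d (t - int L) + 4 * d t" .
  qed
  then have "1 / (real n - real m) * \<bar>(\<Sum>t\<in>?I. ?g y t) - (\<Sum>t\<in>?I. ?g y' t)\<bar> \<le>
     1 / (real n - real m) * (\<Sum>t\<in>?I. 8 * rolling_mean m w d (t - int L) + 4 * d t)"
    using mn by (intro mult_left_mono) auto
  moreover have "\<bar>1 / (real n - real m) * X - 1 / (real n - real m) * Y\<bar> = 1 / (real n - real m) * \<bar>X - Y\<bar>" for X Y
    using mn by (simp add: abs_mult flip: right_diff_distrib diff_divide_distrib)
  ultimately show ?thesis by (simp only: rw_crit_def)
qed

lemma rw_crit_cong:
  assumes "1 \<le> \<tau>" "\<And>t. t \<in> {int m + 1..int n} \<Longrightarrow> y t = y' t"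
  shows "rw_crit m w \<tau> L n y = rw_crit m w \<tau> L n y'"
proof -
  have "rolling_mean m w y (t - int L) = rolling_mean m w y' (t - int L) \<and> y t = y' t"
    if "t \<in> {int m + int \<tau> + int L..int n}" for t
    using that assms by (intro conjI rolling_mean_cong) auto
  then show ?thesis unfolding rw_crit_def by (intro arg_cong2[where f="(*)"] sum.cong) auto
qed

section \<open>Measurability and expected error of the scalar criterion\<close>

lemma borel_measurable_rolling_mean:
  fixes y :: "int \<Rightarrow> 'w \<Rightarrow> real"
  assumes "\<And>j. int m < j \<Longrightarrow> j \<le> t \<Longrightarrow> y j \<in> borel_measurable M"
  shows "(\<lambda>x. rolling_mean m w (\<lambda>j. y j x) t) \<in> borel_measurable M"
  unfolding rolling_mean_def real_scaleR_def
  using assms by (intro borel_measurable_times borel_measurable_const borel_measurable_sum) auto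

lemma borel_measurable_rw_crit:
  assumes "1 \<le> \<tau>" "\<And>t. t \<in> {int m + 1..int n} \<Longrightarrow> y t \<in> borel_measurable M"
  shows "(\<lambda>x. rw_crit m w \<tau> L n (\<lambda>t. y t x)) \<in> borel_measurable M"
proof -
  have [measurable]: "(\<lambda>x. rolling_mean m w (\<lambda>j. y j x) (t - int L)) \<in> borel_measurable M" "y t \<in> borel_measurable M"
    if "t \<in> {int m + int \<tau> + int L..int n}" for t
    using that assms by (auto intro!: borel_measurable_rolling_mean)
  show ?thesis unfolding rw_crit_def Let_def by measurable
qed

text \<open>The constants have separate origins: C is stochastic and enters through one window and
  through the full weighted sum; A is the total bias between the means \<open>\<mu>\<close> and the
  smoother proxy h; D is the price of shifting h by a lag inside the window, which is at most L +
  w.\<close>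

lemma (in prob_space) expectation_rw_crit_approx:
  fixes y :: "int \<Rightarrow> 'a \<Rightarrow> real"
  assumes mn: "m < n" and \<tau>: "1 \<le> \<tau>"
    and ym: "\<And>t. t \<in> {int m + 1..int n} \<Longrightarrow> y t \<in> borel_measurable M"
    and y: "\<And>t x. t \<in> {int m + 1..int n} \<Longrightarrow> \<bar>y t x\<bar> \<le> 2"
    and h: "\<And>t. t \<in> {int m + 1..int n} \<Longrightarrow> \<bar>h t\<bar> \<le> 2"
    and dev: "\<And>T c B. T \<subseteq> {int m + 1..int n} \<Longrightarrow> (\<And>t. t \<in> T \<Longrightarrow> \<bar>c t\<bar> \<le> B) \<Longrightarrow> 0 \<le> B \<Longrightarrow>
       expectation (\<lambda>x. \<bar>\<Sum>t\<in>T. c t * (y t x - \<mu> t)\<bar>) \<le> B * C * sqrt (card T)"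
    and C: "0 \<le> C"
    and bias: "(\<Sum>t\<in>{int m + 1..int n}. \<bar>\<mu> t - h t\<bar>) \<le> A"
    and lag: "\<And>j. j \<le> L + w \<Longrightarrow> (\<Sum>t\<in>{int m + 1 + int j..int n}. \<bar>h t - h (t - int j)\<bar>) \<le> D"
  shows "expectation (\<lambda>x. \<bar>rw_crit m w \<tau> L n (\<lambda>t. y t x) - 1 / (real n - real m) * (\<Sum>t\<in>{int m + 1..int n}. (h t)\<^sup>2)\<bar>) \<le>
    1 / (real n - real m) * (16 * (real \<tau> + real w + 1 + real L) +
      8 * (real n * C / sqrt (real w + 1) + A + D) + 4 * (C * sqrt n + A))"
proof -
  define T0 where "T0 = int m + int \<tau> + int w + 1 + int L"
  define \<Delta> where "\<Delta> t x = rolling_mean m w (\<lambda>t. y t x) (t - int L)" for t x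
  define \<Delta>\<mu> where "\<Delta>\<mu> t = rolling_mean m w \<mu> (t - int L)" for t
  let ?I = "{T0..int n}"
  have D0: "0 \<le> D" using order_trans[OF sum_nonneg lag[of 0]] by simp
  have A0: "0 \<le> A" using order_trans[OF sum_nonneg bias] by simp
  have I: "t \<in> {int m + 1..int n}" "int m + 1 \<le> t - int L - int i" "t - int L - int i \<in> {int m + 1..int n}"
    if "t \<in> ?I" "i \<le> w" for t i
    using that by (auto simp: T0_def)
  have cardI: "real (card ?I) \<le> real n" by (simp add: T0_def)
  have iy: "integrable M (y t)" if "t \<in> {int m + 1..int n}" for t
    using ym[OF that] y[OF that] by (intro integrable_const_bound[where B=2]) auto
  have full: "rolling_mean m w f (t - int L) = 1 / (real w + 1) * (\<Sum>i\<in>{0..w}. f (t - int L - int i))"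
    if "t \<in> ?I" for f :: "int \<Rightarrow> real" and t
    using that by (intro rolling_mean_full) (auto simp: T0_def)
  have i\<Delta>: "integrable M (\<Delta> t)" if "t \<in> ?I" for t
    unfolding \<Delta>_def[abs_def] full[OF that]
    using I[OF that] by (intro integrable_mult_right Bochner_Integration.integrable_sum iy) auto
  \<comment> \<open>Weights 1/(w+1) on w + 1 times turn the deviation bound into C /
    sqrt(w+1).\<close>
  have dev1: "expectation (\<lambda>x. \<bar>\<Delta> t x - \<Delta>\<mu> t\<bar>) \<le> C / sqrt (real w + 1)" if t: "t \<in> ?I" for t
  proof -
    let ?T = "{t - int L - int w..t - int L}"
    have eq: "\<Delta> t x - \<Delta>\<mu> t = (\<Sum>j\<in>?T. 1 / (real w + 1) * (y j x - \<mu> j))" for x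
    proof -
      have "(\<Sum>j\<in>?T. 1 / (real w + 1) * (y j x - \<mu> j)) = (\<Sum>i\<in>{0..w}. 1 / (real w + 1) * (y (t - int L - int i) x - \<mu> (t - int L - int i)))"
        by (rule sum.reindex_bij_witness[of _ "\<lambda>i. t - int L - int i" "\<lambda>j. nat (t - int L - j)"]) auto
      then show ?thesis
        unfolding \<Delta>_def \<Delta>\<mu>_def full[OF t]
        by (simp add: sum_divide_distrib sum_subtractf diff_divide_distrib)
    qed
    have "expectation (\<lambda>x. \<bar>\<Delta> t x - \<Delta>\<mu> t\<bar>) \<le> 1 / (real w + 1) * C * sqrt (card ?T)"
      unfolding eq using t by (intro dev) (auto simp: T0_def)
    also have "card ?T = w + 1" by simp
    also have "1 / (real w + 1) * C * sqrt (real (w + 1)) = C / sqrt (real w + 1)"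
      by (simp add: field_simps real_sqrt_mult_self flip: real_sqrt_mult)
    finally show ?thesis .
  qed
  have avg: "(\<Sum>t\<in>?I. \<bar>\<Delta>\<mu> t - h t\<bar>) \<le> A + D"
  proof -
    have "(\<Sum>t\<in>?I. \<bar>\<Delta>\<mu> t - h t\<bar>) \<le> (\<Sum>t\<in>?I. 1 / (real w + 1) * (\<Sum>i\<in>{0..w}. \<bar>\<mu> (t - int L - int i) - h t\<bar>))"
    proof (rule sum_mono)
      fix t assume t: "t \<in> ?I"
      have "\<Delta>\<mu> t - h t = 1 / (real w + 1) * (\<Sum>i\<in>{0..w}. \<mu> (t - int L - int i) - h t)"
        unfolding \<Delta>\<mu>_def full[OF t] by (simp add: sum_subtractf field_simps)
      also have "\<bar>\<dots>\<bar> \<le> 1 / (real w + 1) * (\<Sum>i\<in>{0..w}. \<bar>\<mu> (t - int L - int i) - h t\<bar>)"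
        unfolding abs_mult by (intro mult_mono sum_abs) auto
      finally show "\<bar>\<Delta>\<mu> t - h t\<bar> \<le> 1 / (real w + 1) * (\<Sum>i\<in>{0..w}. \<bar>\<mu> (t - int L - int i) - h t\<bar>)" .
    qed
    also have "\<dots> = 1 / (real w + 1) * (\<Sum>i\<in>{0..w}. \<Sum>t\<in>?I. \<bar>\<mu> (t - int L - int i) - h t\<bar>)"
      by (subst sum.swap) (simp add: sum_distrib_left)
    also have "\<dots> \<le> 1 / (real w + 1) * (\<Sum>i\<in>{0..w}. A + D)"
    proof (intro mult_left_mono sum_mono)
      fix i assume i: "i \<in> {0..w}"
      \<comment> \<open>Inserting h at the shifted time separates a translate of the bias sum from a
        shift of h by L + i. Averaging over i keeps a bound that is uniform in i.\<close>
      have "(\<Sum>t\<in>?I. \<bar>\<mu> (t - int L - int i) - h t\<bar>) \<le>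
          (\<Sum>t\<in>?I. \<bar>\<mu> (t - int L - int i) - h (t - int L - int i)\<bar> + \<bar>h t - h (t - int (L + i))\<bar>)"
        by (intro sum_mono) (auto simp: algebra_simps)
      also have "\<dots> = (\<Sum>t\<in>?I. \<bar>\<mu> (t - int L - int i) - h (t - int L - int i)\<bar>) + (\<Sum>t\<in>?I. \<bar>h t - h (t - int (L + i))\<bar>)"
        by (rule sum.distrib)
      also have "(\<Sum>t\<in>?I. \<bar>\<mu> (t - int L - int i) - h (t - int L - int i)\<bar>) =
          (\<Sum>t\<in>(\<lambda>t. t - int L - int i) ` ?I. \<bar>\<mu> t - h t\<bar>)"
        by (subst sum.reindex) (auto simp: inj_on_def)
      also have "\<dots> \<le> (\<Sum>t\<in>{int m + 1..int n}. \<bar>\<mu> t - h t\<bar>)"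
        using I i by (intro sum_mono2) auto
      also note bias
      also have "(\<Sum>t\<in>?I. \<bar>h t - h (t - int (L + i))\<bar>) \<le> (\<Sum>t\<in>{int m + 1 + int (L + i)..int n}. \<bar>h t - h (t - int (L + i))\<bar>)"
        using i by (intro sum_mono2) (auto simp: T0_def)
      also have "\<dots> \<le> D" using i by (intro lag) auto
      finally show "(\<Sum>t\<in>?I. \<bar>\<mu> (t - int L - int i) - h t\<bar>) \<le> A + D" by simp
    qed auto
    also have "\<dots> = A + D" by (simp add: add.commute)
    finally show ?thesis .
  qed
  have E1: "expectation (\<lambda>x. \<Sum>t\<in>?I. \<bar>\<Delta> t x - h t\<bar>) \<le> real n * C / sqrt (real w + 1) + A + D"
  proof -
    have "expectation (\<lambda>x. \<Sum>t\<in>?I. \<bar>\<Delta> t x - h t\<bar>) \<le> expectation (\<lambda>x. \<Sum>t\<in>?I. \<bar>\<Delta> t x - \<Delta>\<mu> t\<bar> + \<bar>\<Delta>\<mu> t - h t\<bar>)"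
      by (intro integral_mono Bochner_Integration.integrable_sum Bochner_Integration.integrable_add integrable_abs
          Bochner_Integration.integrable_diff i\<Delta> sum_mono) auto
    also have "\<dots> = (\<Sum>t\<in>?I. expectation (\<lambda>x. \<bar>\<Delta> t x - \<Delta>\<mu> t\<bar>) + \<bar>\<Delta>\<mu> t - h t\<bar>)"
      by (subst Bochner_Integration.integral_sum)
        (auto simp: prob_space intro!: sum.cong Bochner_Integration.integrable_add integrable_abs Bochner_Integration.integrable_diff i\<Delta>
           simp: Bochner_Integration.integral_add i\<Delta>)
    also have "\<dots> \<le> (\<Sum>t\<in>?I. C / sqrt (real w + 1)) + (A + D)"
      unfolding sum.distrib by (intro add_mono sum_mono dev1 avg)
    also have "(\<Sum>t\<in>?I. C / sqrt (real w + 1)) = real (card ?I) * (C / sqrt (real w + 1))" by simp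
    also have "\<dots> \<le> real n * (C / sqrt (real w + 1))" using C cardI by (intro mult_right_mono) auto
    finally show ?thesis by simp
  qed
  \<comment> \<open>Centring at \<open>\<mu>\<close> instead of h costs at most 2 A, as h is bounded
    by 2; the rest is a weighted deviation with weights h.\<close>
  have E2: "expectation (\<lambda>x. \<bar>\<Sum>t\<in>?I. h t * (y t x - h t)\<bar>) \<le> 2 * (C * sqrt n + A)"
  proof -
    have "expectation (\<lambda>x. \<bar>\<Sum>t\<in>?I. h t * (y t x - h t)\<bar>) \<le>
        expectation (\<lambda>x. \<bar>\<Sum>t\<in>?I. h t * (y t x - \<mu> t)\<bar> + 2 * A)"
    proof (intro integral_mono Bochner_Integration.integrable_sum Bochner_Integration.integrable_add integrable_abs
          Bochner_Integration.integrable_diff integrable_mult_right iy)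
      fix x
      have "(\<Sum>t\<in>?I. h t * (y t x - h t)) = (\<Sum>t\<in>?I. h t * (y t x - \<mu> t)) + (\<Sum>t\<in>?I. h t * (\<mu> t - h t))"
        by (simp add: algebra_simps flip: sum.distrib)
      moreover have "\<bar>\<Sum>t\<in>?I. h t * (\<mu> t - h t)\<bar> \<le> 2 * A"
      proof -
        have "\<bar>\<Sum>t\<in>?I. h t * (\<mu> t - h t)\<bar> \<le> (\<Sum>t\<in>?I. 2 * \<bar>\<mu> t - h t\<bar>)"
          by (rule order_trans[OF sum_abs], intro sum_mono, unfold abs_mult, intro mult_right_mono h)
             (auto simp: T0_def)
        also have "\<dots> \<le> 2 * (\<Sum>t\<in>{int m + 1..int n}. \<bar>\<mu> t - h t\<bar>)"
          unfolding sum_distrib_left[symmetric] by (intro mult_left_mono sum_mono2) (auto simp: T0_def)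
        finally show ?thesis using bias by simp
      qed
      ultimately show "\<bar>\<Sum>t\<in>?I. h t * (y t x - h t)\<bar> \<le> \<bar>\<Sum>t\<in>?I. h t * (y t x - \<mu> t)\<bar> + 2 * A" by linarith
    qed (use I[of _ 0] in auto)
    also have "\<dots> = expectation (\<lambda>x. \<bar>\<Sum>t\<in>?I. h t * (y t x - \<mu> t)\<bar>) + 2 * A"
      using I[of _ 0] by (subst Bochner_Integration.integral_add)
        (auto simp: prob_space intro!: integrable_abs Bochner_Integration.integrable_sum Bochner_Integration.integrable_diff integrable_mult_right iy)
    also have "expectation (\<lambda>x. \<bar>\<Sum>t\<in>?I. h t * (y t x - \<mu> t)\<bar>) \<le> 2 * C * sqrt (card ?I)"
      by (intro dev h) (auto simp: T0_def)
    also have "\<dots> \<le> 2 * C * sqrt n" using C cardI by (intro mult_left_mono) auto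
    finally show ?thesis by simp
  qed
  have int2: "integrable M (\<lambda>x. \<bar>\<Sum>t\<in>?I. h t * (y t x - h t)\<bar>)" "integrable M (\<lambda>x. \<Sum>t\<in>?I. \<bar>\<Delta> t x - h t\<bar>)"
    using I[of _ 0] by (auto intro!: integrable_abs Bochner_Integration.integrable_sum Bochner_Integration.integrable_diff integrable_mult_right iy i\<Delta>)
  let ?q = "1 / (real n - real m) * (\<Sum>t\<in>{int m + 1..int n}. (h t)\<^sup>2)"
  let ?U = "\<lambda>x. 1 / (real n - real m) * (16 * (real \<tau> + real w + 1 + real L) +
      8 * (\<Sum>t\<in>?I. \<bar>\<Delta> t x - h t\<bar>) + 2 * \<bar>\<Sum>t\<in>?I. h t * (y t x - h t)\<bar>)"
  have iU: "integrable M ?U"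
    by (intro integrable_mult_right Bochner_Integration.integrable_add int2) auto
  have le: "\<bar>rw_crit m w \<tau> L n (\<lambda>t. y t x) - ?q\<bar> \<le> ?U x" for x
    unfolding \<Delta>_def T0_def by (intro rw_crit_approx mn \<tau> y h) auto
  have "expectation (\<lambda>x. \<bar>rw_crit m w \<tau> L n (\<lambda>t. y t x) - ?q\<bar>) \<le> expectation ?U"
  proof (rule integral_mono[OF _ iU le])
    show "integrable M (\<lambda>x. \<bar>rw_crit m w \<tau> L n (\<lambda>t. y t x) - ?q\<bar>)"
    proof (rule Bochner_Integration.integrable_bound[OF iU])
      show "(\<lambda>x. \<bar>rw_crit m w \<tau> L n (\<lambda>t. y t x) - ?q\<bar>) \<in> borel_measurable M"
        by (intro borel_measurable_abs borel_measurable_diff borel_measurable_rw_crit \<tau> ym) auto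
      show "AE x in M. norm \<bar>rw_crit m w \<tau> L n (\<lambda>t. y t x) - ?q\<bar> \<le> norm (?U x)"
        unfolding real_norm_def abs_idempotent using le by (intro AE_I2 order_trans[OF le abs_ge_self])
    qed
  qed
  also have "\<dots> = 1 / (real n - real m) * (16 * (real \<tau> + real w + 1 + real L) +
      8 * expectation (\<lambda>x. \<Sum>t\<in>?I. \<bar>\<Delta> t x - h t\<bar>) + 2 * expectation (\<lambda>x. \<bar>\<Sum>t\<in>?I. h t * (y t x - h t)\<bar>))"
    using int2 by (simp add: prob_space)
  also have "\<dots> \<le> 1 / (real n - real m) * (16 * (real \<tau> + real w + 1 + real L) +
      8 * (real n * C / sqrt (real w + 1) + A + D) + 2 * (2 * (C * sqrt n + A)))"
    using mn by (intro mult_left_mono add_mono order_refl E1 E2) auto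
  finally show ?thesis by simp
qed

subsection \<open>Mean features and their approximation\<close>

text \<open>Turns the past at time t into the past at time t - b.\<close>

definition shift_seq :: "nat \<Rightarrow> (nat \<Rightarrow> real) \<Rightarrow> nat \<Rightarrow> real" where
  "shift_seq b y = (\<lambda>l. y (l + b))"

lemma measurable_shift_seq[measurable]: "shift_seq b \<in> measurable Rinf Rinf"
  unfolding shift_seq_def by (intro measurable_PiM_single') (auto simp: space_PiM)

text \<open>The Fourier feature of a whole window as a function of one noise sequence, the past at
  the time of the last row: row b sees it shifted by m - b. The map may vary with the row because
  every row of a sample window has its own rescaled time.\<close>

definition feature :: "nat \<Rightarrow> real^'d::finite^'m::finite \<Rightarrow> real \<Rightarrow>
    (nat \<Rightarrow> (nat \<Rightarrow> real) \<Rightarrow> real^'d) \<Rightarrow> (nat \<Rightarrow> real) \<Rightarrow> real" where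
  "feature m \<omega> \<alpha> H y = cos (\<omega> \<bullet> (\<chi> a. H (to_nat_on UNIV a) (shift_seq (m - to_nat_on UNIV a) y)) + \<alpha>)"

lemma to_nat_on_le:
  assumes "CARD('m::finite) = m + 1"
  shows "to_nat_on UNIV (a::'m) \<le> m"
proof -
  have "to_nat_on UNIV a \<in> {0..<CARD('m)}"
    using to_nat_on_finite[of "UNIV::'m set"] by (auto simp: bij_betw_def)
  then show ?thesis using assms by simp
qed

lemma abs_feature_le: "\<bar>feature m \<omega> \<alpha> H y\<bar> \<le> 1"
  by (simp add: feature_def)

lemma abs_cos_diff_le: "\<bar>cos x - cos y\<bar> \<le> \<bar>x - y\<bar>" for x y :: real
proof -
  have *: "\<bar>cos v - cos u\<bar> \<le> v - u" if "u < v" for u v :: real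
  proof -
    have "\<exists>z>u. z < v \<and> cos v - cos u = (v - u) * (- sin z)"
      using that by (intro MVT2) (auto intro!: derivative_eq_intros)
    then obtain z where "cos v - cos u = (v - u) * (- sin z)" by blast
    then have "\<bar>cos v - cos u\<bar> = (v - u) * \<bar>sin z\<bar>" using that by (simp add: abs_mult)
    also have "\<dots> \<le> (v - u) * 1" using that by (intro mult_left_mono) auto
    finally show ?thesis by simp
  qed
  show ?thesis using *[of x y] *[of y x] by (cases x y rule: linorder_cases) auto
qed

text \<open>Both the maps and the noise sequences may differ, so this one inequality covers changes
  of time and of parameter, the passage to the limit map, and the replacement of a
  coordinate.\<close>

lemma abs_feature_diff_le:
  fixes \<omega> :: "real^'d::finite^'m::finite"
  assumes "\<And>a. norm (\<omega> $ a) \<le> B"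
  shows "\<bar>feature m \<omega> \<alpha> H y - feature m \<omega> \<alpha> H' y'\<bar> \<le>
    B * (\<Sum>a\<in>(UNIV::'m set). norm (H (to_nat_on UNIV a) (shift_seq (m - to_nat_on UNIV a) y) -
      H' (to_nat_on UNIV a) (shift_seq (m - to_nat_on UNIV a) y')))"
proof -
  let ?d = "\<lambda>a::'m. H (to_nat_on UNIV a) (shift_seq (m - to_nat_on UNIV a) y) -
      H' (to_nat_on UNIV a) (shift_seq (m - to_nat_on UNIV a) y')"
  have "\<bar>feature m \<omega> \<alpha> H y - feature m \<omega> \<alpha> H' y'\<bar> \<le> \<bar>\<omega> \<bullet> (\<chi> a. ?d a)\<bar>"
    unfolding feature_def
  proof (rule order_trans[OF abs_cos_diff_le])
    have "(\<chi> a. ?d a) = (\<chi> a. H (to_nat_on UNIV a) (shift_seq (m - to_nat_on UNIV a) y)) -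
       (\<chi> a. H' (to_nat_on UNIV a) (shift_seq (m - to_nat_on UNIV a) y'))"
      by (simp add: vec_eq_iff)
    then show "\<bar>\<omega> \<bullet> (\<chi> a. H (to_nat_on UNIV a) (shift_seq (m - to_nat_on UNIV a) y)) + \<alpha> -
       (\<omega> \<bullet> (\<chi> a. H' (to_nat_on UNIV a) (shift_seq (m - to_nat_on UNIV a) y')) + \<alpha>)\<bar> \<le> \<bar>\<omega> \<bullet> (\<chi> a. ?d a)\<bar>"
      by (simp add: inner_diff_right)
  qed
  also have "\<omega> \<bullet> (\<chi> a. ?d a) = (\<Sum>a\<in>UNIV. \<omega> $ a \<bullet> ?d a)"
    by (subst inner_vec_def) simp
  finally have "\<bar>feature m \<omega> \<alpha> H y - feature m \<omega> \<alpha> H' y'\<bar> \<le> \<bar>\<Sum>a\<in>UNIV. \<omega> $ a \<bullet> ?d a\<bar>" .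
  also have "\<dots> \<le> (\<Sum>a\<in>UNIV. norm (\<omega> $ a) * norm (?d a))"
    by (rule order_trans[OF sum_abs]) (intro sum_mono Cauchy_Schwarz_ineq2)
  also have "\<dots> \<le> (\<Sum>a\<in>UNIV. B * norm (?d a))"
    by (intro sum_mono mult_right_mono assms) auto
  finally show ?thesis by (simp add: sum_distrib_left)
qed

lemma measurable_feature:
  fixes \<omega> :: "real^'d::finite^'m::finite"
  assumes "CARD('m) = m + 1" and "\<And>b. b \<le> m \<Longrightarrow> H b \<in> borel_measurable Rinf"
  shows "feature m \<omega> \<alpha> H \<in> borel_measurable Rinf"
proof -
  have "(\<lambda>y. \<omega> $ a \<bullet> H (to_nat_on UNIV a) (shift_seq (m - to_nat_on UNIV a) y)) \<in> borel_measurable Rinf" for a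
    using assms(2)[OF to_nat_on_le[OF assms(1), of a]] by measurable
  then show ?thesis unfolding feature_def inner_vec_def by simp
qed

text \<open>The maps \<open>Y\<close> and \<open>Y'\<close> from an arbitrary measure allow two
  readings: identical sequences under \<open>N\<close>, and a sequence against its version with one
  coordinate replaced under the product measure.\<close>

lemma nn_integral_feature_diff_le:
  fixes \<omega> :: "real^'d::finite^'m::finite"
  assumes \<omega>: "\<And>a. norm (\<omega> $ a) \<le> B"
    and meas: "\<And>a. (\<lambda>z. norm (H (to_nat_on UNIV a) (shift_seq (m - to_nat_on UNIV (a::'m)) (Y z)) -
      H' (to_nat_on UNIV a) (shift_seq (m - to_nat_on UNIV a) (Y' z)))) \<in> borel_measurable R"
    and e: "\<And>a. (\<integral>\<^sup>+z. ennreal (norm (H (to_nat_on UNIV a) (shift_seq (m - to_nat_on UNIV (a::'m)) (Y z)) -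
      H' (to_nat_on UNIV a) (shift_seq (m - to_nat_on UNIV a) (Y' z)))) \<partial>R) \<le> ennreal (e a)"
    and e0: "\<And>a. 0 \<le> e a"
  shows "(\<integral>\<^sup>+z. ennreal \<bar>feature m \<omega> \<alpha> H (Y z) - feature m \<omega> \<alpha> H' (Y' z)\<bar> \<partial>R) \<le> ennreal (B * (\<Sum>a\<in>UNIV. e a))"
proof -
  have B: "0 \<le> B" using order_trans[OF norm_ge_zero \<omega>] .
  define d where "d a z = norm (H (to_nat_on UNIV a) (shift_seq (m - to_nat_on UNIV a) (Y z)) -
      H' (to_nat_on UNIV a) (shift_seq (m - to_nat_on UNIV a) (Y' z)))" for a :: 'm and z
  have dm[measurable]: "d a \<in> borel_measurable R" for a using meas[of a] by (simp add: d_def[abs_def])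
  have de: "(\<integral>\<^sup>+z. ennreal (d a z) \<partial>R) \<le> ennreal (e a)" for a using e[of a] by (simp add: d_def)
  have d0: "0 \<le> d a z" for a z by (simp add: d_def)
  have "(\<integral>\<^sup>+z. ennreal \<bar>feature m \<omega> \<alpha> H (Y z) - feature m \<omega> \<alpha> H' (Y' z)\<bar> \<partial>R) \<le>
      (\<integral>\<^sup>+z. ennreal (B * (\<Sum>a\<in>UNIV. d a z)) \<partial>R)"
    unfolding d_def by (intro nn_integral_mono ennreal_leI abs_feature_diff_le \<omega>)
  also have "\<dots> = (\<integral>\<^sup>+z. ennreal B * (\<Sum>a\<in>UNIV. ennreal (d a z)) \<partial>R)"
    using B d0 by (simp add: ennreal_mult sum_nonneg sum_ennreal)
  also have "\<dots> = ennreal B * (\<Sum>a\<in>UNIV. \<integral>\<^sup>+z. ennreal (d a z) \<partial>R)"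
    by (simp add: nn_integral_cmult nn_integral_sum)
  also have "\<dots> \<le> ennreal B * (\<Sum>a\<in>UNIV. ennreal (e a))"
    by (intro mult_left_mono sum_mono de) auto
  also have "\<dots> = ennreal (B * (\<Sum>a\<in>UNIV. e a))"
    using B e0 by (simp add: ennreal_mult sum_nonneg sum_ennreal)
  finally show ?thesis .
qed

lemma abs_integral_diff_le:
  fixes f g :: "'a \<Rightarrow> real"
  assumes "integrable R f" "integrable R g" "(\<integral>\<^sup>+z. ennreal \<bar>f z - g z\<bar> \<partial>R) \<le> ennreal E" "0 \<le> E"
  shows "\<bar>(\<integral>z. f z \<partial>R) - (\<integral>z. g z \<partial>R)\<bar> \<le> E" "(\<integral>z. \<bar>f z - g z\<bar> \<partial>R) \<le> E"
proof -
  have "ennreal (\<integral>z. \<bar>f z - g z\<bar> \<partial>R) = (\<integral>\<^sup>+z. ennreal \<bar>f z - g z\<bar> \<partial>R)"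
    using assms by (intro nn_integral_eq_integral[symmetric]) auto
  with assms(3) have "ennreal (\<integral>z. \<bar>f z - g z\<bar> \<partial>R) \<le> ennreal E" by simp
  with assms(4) show *: "(\<integral>z. \<bar>f z - g z\<bar> \<partial>R) \<le> E" by simp
  have "(\<integral>z. f z \<partial>R) - (\<integral>z. g z \<partial>R) = (\<integral>z. f z - g z \<partial>R)" using assms by simp
  also have "\<bar>\<dots>\<bar> \<le> (\<integral>z. \<bar>f z - g z\<bar> \<partial>R)" by (rule integral_abs_bound)
  finally show "\<bar>(\<integral>z. f z \<partial>R) - (\<integral>z. g z \<partial>R)\<bar> \<le> E" using * by simp
qed

lemma sum_int_eq_sum_nat: "(\<Sum>t\<in>{int a..int b}. f t) = (\<Sum>t\<in>{a..b}. f (int t))"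
  by (rule sum.reindex_bij_witness[of _ int nat]) auto

text \<open>The sequence \<open>e\<close> is twice the supremum in (B2), and \<open>\<eta>\<close> the resulting modulus in (B8), both for
  \<open>L\<^sup>1\<close> norms with respect to the law \<open>N\<close> of the past \<open>X r t\<close> of the noise.\<close>

locale rolling_window = prob_space M for M :: "'w measure" +
  fixes N :: "(nat \<Rightarrow> real) measure"
    and X :: "nat \<Rightarrow> int \<Rightarrow> 'w \<Rightarrow> nat \<Rightarrow> real"
    and s m :: nat
    and \<Theta> :: "'c::euclidean_space set"
    and \<theta>0 :: 'c
    and G :: "nat \<Rightarrow> nat \<Rightarrow> real \<Rightarrow> (nat \<Rightarrow> real) \<Rightarrow> 'c \<Rightarrow> real^'d::finite"
    and Glim :: "real \<Rightarrow> (nat \<Rightarrow> real) \<Rightarrow> 'c \<Rightarrow> real^'d"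
    and \<omega> :: "'k::finite \<Rightarrow> real^'d^'m::finite"
    and \<alpha> :: "'k \<Rightarrow> real"
    and w \<tau> L :: "nat \<Rightarrow> nat"
    and \<kappa> K \<rho> \<Lambda> :: real
    and e :: "nat \<Rightarrow> real" and \<eta> :: "real \<Rightarrow> real"
  assumes s: "1 \<le> s"
    and m: "CARD('m) = m + 1"
    and \<theta>0: "\<theta>0 \<in> \<Theta>"
    and compact_\<Theta>: "compact \<Theta>"
    and N: "prob_space N" "sets N = sets Rinf" "\<And>b. distr N Rinf (shift_seq b) = N"
    and X_meas[measurable]: "\<And>r t. r \<le> s \<Longrightarrow> X r t \<in> measurable M Rinf"
    and X_law: "\<And>r t. r \<le> s \<Longrightarrow> distr M Rinf (X r t) = N"
    and X_dev: "\<And>r T F C c B. r \<le> s \<Longrightarrow> finite T \<Longrightarrow> (\<And>t. t \<in> T \<Longrightarrow> F t \<in> borel_measurable Rinf) \<Longrightarrow>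
      (\<And>t y. t \<in> T \<Longrightarrow> \<bar>F t y :: real\<bar> \<le> 1) \<Longrightarrow>
      (\<And>t j. t \<in> T \<Longrightarrow> (\<integral>y. \<bar>F t (fst y) - F t ((fst y)(j := snd y 0))\<bar> \<partial>(N \<Otimes>\<^sub>M N)) \<le> C * \<rho> ^ j) \<Longrightarrow>
      0 \<le> C \<Longrightarrow> (\<And>t. t \<in> T \<Longrightarrow> \<bar>c t\<bar> \<le> B) \<Longrightarrow> 0 \<le> B \<Longrightarrow>
      expectation (\<lambda>x. \<bar>\<Sum>t\<in>T. c t * (F t (X r t x) - (\<integral>y. F t y \<partial>N))\<bar>)
        \<le> B * sqrt (2 * C / (1 - \<rho>)\<^sup>2) * sqrt (card T)"
    and G_meas: "\<And>i r u \<theta>. 1 \<le> i \<Longrightarrow> r \<le> s \<Longrightarrow> u \<in> {0..1} \<Longrightarrow> \<theta> \<in> \<Theta> \<Longrightarrow> (\<lambda>y. G i r u y \<theta>) \<in> borel_measurable Rinf"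
    and Glim_meas: "\<And>u \<theta>. u \<in> {0..1} \<Longrightarrow> \<theta> \<in> \<Theta> \<Longrightarrow> (\<lambda>y. Glim u y \<theta>) \<in> borel_measurable Rinf"
    and G_dep: "\<And>i r u \<theta> j. 1 \<le> i \<Longrightarrow> r \<le> s \<Longrightarrow> u \<in> {0..1} \<Longrightarrow> \<theta> \<in> \<Theta> \<Longrightarrow>
      (\<integral>\<^sup>+z. ennreal (norm (G i r u (fst z) \<theta> - G i r u ((fst z)(j := snd z 0)) \<theta>)) \<partial>(N \<Otimes>\<^sub>M N)) \<le> ennreal (\<Lambda> * \<rho> ^ j)"
    and const: "0 < \<rho>" "\<rho> < 1" "0 < \<Lambda>" "1 \<le> \<kappa>" "0 \<le> K"
    and e_lim: "e \<longlonglongrightarrow> 0"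
    and G_lim: "\<forall>\<^sub>F i in sequentially. 0 \<le> e i \<and> (\<forall>r u \<theta>. r \<le> s \<longrightarrow> u \<in> {0..1} \<longrightarrow> \<theta> \<in> \<Theta> \<longrightarrow>
      (\<integral>\<^sup>+y. ennreal (norm (G i r u y \<theta> - Glim u y \<theta>)) \<partial>N) \<le> ennreal (e i))"
    and G_kvar: "\<And>i r \<theta>. 1 \<le> i \<Longrightarrow> r \<le> s \<Longrightarrow> \<theta> \<in> \<Theta> \<Longrightarrow> \<exists>d. bounded_kvar \<kappa> K d \<and>
      (\<forall>u\<in>{0..1}. \<forall>v\<in>{0..1}. (\<integral>\<^sup>+y. ennreal (norm (G i r u y \<theta> - G i r v y \<theta>)) \<partial>N) \<le> ennreal (d u v))"
    and \<eta>_lim: "(\<eta> \<longlongrightarrow> 0) (at_right 0)"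
    and G_equi: "\<And>i r u \<epsilon>. 1 \<le> i \<Longrightarrow> r \<le> s \<Longrightarrow> u \<in> {0..1} \<Longrightarrow> 0 < \<epsilon> \<Longrightarrow> 0 \<le> \<eta> \<epsilon> \<and>
      (\<exists>g\<in>borel_measurable Rinf. (\<integral>\<^sup>+y. g y \<partial>N) \<le> ennreal (\<eta> \<epsilon>) \<and>
        (\<forall>y. \<forall>\<theta>\<in>\<Theta>. \<forall>\<theta>'\<in>\<Theta>. norm (\<theta> - \<theta>') \<le> \<epsilon> \<longrightarrow> ennreal (norm (G i r u y \<theta> - G i r u y \<theta>')) \<le> g y))"
    and seq_pos: "\<And>n. 1 \<le> n \<Longrightarrow> 1 \<le> w n \<and> 1 \<le> \<tau> n \<and> 1 \<le> L n"
    and w_lim: "filterlim w at_top sequentially"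
    and rates: "(\<lambda>n. real (w n) / real n) \<longlonglongrightarrow> 0" "(\<lambda>n. real (\<tau> n) / real n) \<longlonglongrightarrow> 0" "(\<lambda>n. real (L n) / real n) \<longlonglongrightarrow> 0"
begin

definition "B = (\<Sum>c\<in>UNIV. \<Sum>a\<in>UNIV. norm (\<omega> c $ a))"

lemma B: "norm (\<omega> c $ a) \<le> B" "0 \<le> B"
proof -
  have "norm (\<omega> c $ a) \<le> (\<Sum>a\<in>UNIV. norm (\<omega> c $ a))" by (intro member_le_sum) auto
  also have "\<dots> \<le> B" unfolding B_def by (intro member_le_sum sum_nonneg) auto
  finally show "norm (\<omega> c $ a) \<le> B" .
qed (auto simp: B_def intro!: sum_nonneg)

abbreviation "feat c \<equiv> feature m (\<omega> c) (\<alpha> c)"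

text \<open>Rescaled time of row b in the window ending at t, whose rows run from t - m to
  t.\<close>

definition "rtime n t b = real_of_int (t - int m + int b) / real n"

text \<open>The index r = 0 is the observed series, r >= 1 a simulated one.\<close>

definition "Fobs c n r \<theta> t = feat c (\<lambda>b y. G n r (rtime n t b) y \<theta>)"

text \<open>\<open>\<mu>\<close> is the true mean feature, with a different rescaled time in each
  row. \<open>\<Phi>\<close> freezes all rows at one time u, and \<open>\<Phi>lim\<close> also
  replaces the map by its limit. Likewise \<open>\<mu>Y\<close> is the mean of \<open>Y\<close>, and
  \<open>h\<close> is its frozen version.\<close>

definition "\<mu> c n r \<theta> t = (\<integral>y. Fobs c n r \<theta> t y \<partial>N)"
definition "\<Phi> c n r u \<theta> = (\<integral>y. feat c (\<lambda>b y. G n r u y \<theta>) y \<partial>N)"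
definition "\<Phi>lim c u \<theta> = (\<integral>y. feat c (\<lambda>b y. Glim u y \<theta>) y \<partial>N)"

definition "Y c n \<theta> t x = Fobs c n 0 \<theta>0 t (X 0 t x) - 1 / real s * (\<Sum>r=1..s. Fobs c n r \<theta> t (X r t x))"
definition "\<mu>Y c n \<theta> t = \<mu> c n 0 \<theta>0 t - 1 / real s * (\<Sum>r=1..s. \<mu> c n r \<theta> t)"
definition "h c n \<theta> t = \<Phi> c n 0 (real_of_int t / real n) \<theta>0 - 1 / real s * (\<Sum>r=1..s. \<Phi> c n r (real_of_int t / real n) \<theta>)"

definition "Q n \<theta> x = (\<Sum>c\<in>UNIV. rw_crit m (w n) (\<tau> n) (L n) n (\<lambda>t. Y c n \<theta> t x))"
text \<open>The deterministic counterpart of \<open>Q\<close>. It still depends on n; what is shown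
  is that it tends to 0 at \<open>\<theta>0\<close> and is eventually bounded below away from
  \<open>\<theta>0\<close>.\<close>

definition "q n \<theta> = (\<Sum>c\<in>UNIV. 1 / (real n - real m) * (\<Sum>t\<in>{int m + 1..int n}. (h c n \<theta> t)\<^sup>2))"

section \<open>Integrals of window features: comparison, bounds, dependence on one
  coordinate\<close>

lemma rtime_in: "rtime n t b \<in> {0..1}" if "t \<in> {int m + 1..int n}" "b \<le> m"
  using that by (auto simp: rtime_def divide_le_eq)

lemma time_in: "real_of_int t / real n \<in> {0..1}" if "t \<in> {int m + 1..int n}"
  using that by (auto simp: divide_le_eq)

lemma measurable_N: "f \<in> measurable Rinf R \<Longrightarrow> f \<in> measurable N R"
  by (simp add: measurable_cong_sets[OF N(2) refl])

lemma feat_meas: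
  assumes "\<And>b. b \<le> m \<Longrightarrow> H b \<in> borel_measurable Rinf"
  shows "feat c H \<in> borel_measurable Rinf"
  by (rule measurable_feature[OF m assms])

lemma feat_integrable:
  assumes "\<And>b. b \<le> m \<Longrightarrow> H b \<in> borel_measurable Rinf"
  shows "integrable N (feat c H)"
proof -
  interpret N: prob_space N by (rule N)
  have "feat c H \<in> borel_measurable N" by (rule measurable_N[OF feat_meas[OF assms]])
  then show ?thesis by (intro N.integrable_const_bound[where B=1]) (auto simp: abs_feature_le)
qed

lemma nn_integral_shift_seq:
  assumes "f \<in> borel_measurable Rinf"
  shows "(\<integral>\<^sup>+y. f (shift_seq b y) \<partial>N) = (\<integral>\<^sup>+y. f y \<partial>N)"
proof -
  have "shift_seq b \<in> measurable N Rinf" by (rule measurable_N[OF measurable_shift_seq])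
  then have "(\<integral>\<^sup>+y. f (shift_seq b y) \<partial>N) = (\<integral>\<^sup>+y. f y \<partial>distr N Rinf (shift_seq b))"
    using assms by (subst nn_integral_distr) auto
  then show ?thesis by (simp add: N(3))
qed

text \<open>Row b sees the noise shifted by m - b, but \<open>N\<close> is shift invariant, so an
  \<open>L1\<close> bound for the unshifted maps of each row suffices.\<close>

lemma integral_feat_diff_le:
  assumes H: "\<And>b. b \<le> m \<Longrightarrow> H b \<in> borel_measurable Rinf" "\<And>b. b \<le> m \<Longrightarrow> H' b \<in> borel_measurable Rinf"
    and d: "\<And>b. b \<le> m \<Longrightarrow> (\<integral>\<^sup>+y. ennreal (norm (H b y - H' b y)) \<partial>N) \<le> ennreal (d b)" "\<And>b. 0 \<le> d b"
  shows "\<bar>(\<integral>y. feat c H y \<partial>N) - (\<integral>y. feat c H' y \<partial>N)\<bar> \<le> B * (\<Sum>a\<in>(UNIV::'m set). d (to_nat_on UNIV a))"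
proof (rule abs_integral_diff_le(1))
  show "(\<integral>\<^sup>+z. ennreal \<bar>feat c H z - feat c H' z\<bar> \<partial>N) \<le> ennreal (B * (\<Sum>a\<in>(UNIV::'m set). d (to_nat_on UNIV a)))"
  proof (rule nn_integral_feature_diff_le)
    fix a :: 'm
    let ?b = "to_nat_on UNIV a"
    have b: "?b \<le> m" by (rule to_nat_on_le[OF m])
    note [measurable] = H(1)[OF b] H(2)[OF b]
    have *: "(\<lambda>y. norm (H ?b y - H' ?b y)) \<in> borel_measurable Rinf" by measurable
    have "(\<lambda>z. norm (H ?b (shift_seq (m - ?b) z) - H' ?b (shift_seq (m - ?b) z))) \<in> borel_measurable Rinf"
      by measurable
    then show "(\<lambda>z. norm (H ?b (shift_seq (m - ?b) z) - H' ?b (shift_seq (m - ?b) z))) \<in> borel_measurable N"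
      by (rule measurable_N)
    show "(\<integral>\<^sup>+z. ennreal (norm (H ?b (shift_seq (m - ?b) z) - H' ?b (shift_seq (m - ?b) z))) \<partial>N) \<le> ennreal (d ?b)"
      using nn_integral_shift_seq[of "\<lambda>y. ennreal (norm (H ?b y - H' ?b y))" "m - ?b"] * d(1)[OF b] by simp
  qed (use B d in auto)
  show "0 \<le> B * (\<Sum>a\<in>(UNIV::'m set). d (to_nat_on UNIV a))" using B d by (auto intro!: mult_nonneg_nonneg sum_nonneg)
qed (intro feat_integrable H; assumption)+

lemma integral_feat_diff_le_const:
  assumes H: "\<And>b. b \<le> m \<Longrightarrow> H b \<in> borel_measurable Rinf" "\<And>b. b \<le> m \<Longrightarrow> H' b \<in> borel_measurable Rinf"
    and d: "\<And>b. b \<le> m \<Longrightarrow> (\<integral>\<^sup>+y. ennreal (norm (H b y - H' b y)) \<partial>N) \<le> ennreal d" "0 \<le> d"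
  shows "\<bar>(\<integral>y. feat c H y \<partial>N) - (\<integral>y. feat c H' y \<partial>N)\<bar> \<le> B * (real m + 1) * d"
  using integral_feat_diff_le[of H H' "\<lambda>_. d" c] assms m by (simp add: mult.assoc add.commute)

text \<open>A feature that is not integrable has integral 0 by convention, so the bound holds for
  every H and \<open>abs_h_le\<close> can be stated for all times and parameters.\<close>

lemma abs_integral_feat_le: "\<bar>\<integral>y. feat c H y \<partial>N\<bar> \<le> 1"
proof -
  interpret N: prob_space N by (rule N)
  show ?thesis
  proof (cases "integrable N (feat c H)")
    case True
    have "\<bar>\<integral>y. feat c H y \<partial>N\<bar> \<le> (\<integral>y. \<bar>feat c H y\<bar> \<partial>N)" by (rule integral_abs_bound)
    also have "\<dots> \<le> (\<integral>y. 1 \<partial>N)" using True by (intro integral_mono) (auto simp: abs_feature_le)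
    finally show ?thesis by (simp add: N.prob_space)
  qed (simp add: not_integrable_integral_eq)
qed

lemma abs_diff_avg_le:
  fixes a :: real and f :: "nat \<Rightarrow> real"
  assumes "\<bar>a\<bar> \<le> b" "\<And>r. 1 \<le> r \<Longrightarrow> r \<le> s \<Longrightarrow> \<bar>f r\<bar> \<le> b"
  shows "\<bar>a - 1 / real s * (\<Sum>r=1..s. f r)\<bar> \<le> 2 * b"
proof -
  have "\<bar>\<Sum>r=1..s. f r\<bar> \<le> (\<Sum>r=1..s. b)" by (rule order_trans[OF sum_abs]) (intro sum_mono assms, auto)
  then have "\<bar>1 / real s * (\<Sum>r=1..s. f r)\<bar> \<le> 1 / real s * (real s * b)"
    unfolding abs_mult by (intro mult_mono) auto
  also have "\<dots> = b" using s by simp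
  finally show ?thesis using assms(1) by linarith
qed

lemma abs_Y_le: "\<bar>Y c n \<theta> t x\<bar> \<le> 2"
  unfolding Y_def Fobs_def by (rule order_trans[OF abs_diff_avg_le[of _ 1]]) (auto simp: abs_feature_le)

lemma abs_h_le: "\<bar>h c n \<theta> t\<bar> \<le> 2"
  unfolding h_def \<Phi>_def by (rule order_trans[OF abs_diff_avg_le[of _ 1]]) (auto simp: abs_integral_feat_le)

text \<open>Replacing coordinate j of the past replaces coordinate j - (m - b) of row b, or nothing
  if j < m - b. At most m powers of \<open>\<rho>\<close> are lost, whence the factor
  1/\<open>\<rho>\<close>^m.\<close>

lemma feat_dep:
  assumes H: "\<And>b. b \<le> m \<Longrightarrow> H b \<in> borel_measurable Rinf"
    and dep: "\<And>b j. b \<le> m \<Longrightarrow> (\<integral>\<^sup>+z. ennreal (norm (H b (fst z) - H b ((fst z)(j := snd z 0)))) \<partial>(N \<Otimes>\<^sub>M N)) \<le> ennreal (\<Lambda> * \<rho> ^ j)"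
  shows "(\<integral>y. \<bar>feat c H (fst y) - feat c H ((fst y)(j := snd y 0))\<bar> \<partial>(N \<Otimes>\<^sub>M N)) \<le> B * (real m + 1) * \<Lambda> / \<rho> ^ m * \<rho> ^ j"
proof -
  interpret N: prob_space N by (rule N)
  interpret NN: pair_prob_space N N ..
  have sNN: "sets (N \<Otimes>\<^sub>M N) = sets (Rinf \<Otimes>\<^sub>M Rinf)" by (intro sets_pair_measure_cong N)
  have up[measurable]: "(\<lambda>y. (fst y)(j := snd y 0)) \<in> measurable (Rinf \<Otimes>\<^sub>M Rinf) Rinf" for j :: nat
    by (intro measurable_PiM_single') (auto simp: space_PiM)
  have toN: "f \<in> borel_measurable (N \<Otimes>\<^sub>M N)" if "f \<in> borel_measurable (Rinf \<Otimes>\<^sub>M Rinf)" for f :: "_ \<Rightarrow> real"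
    using that by (simp add: measurable_cong_sets[OF sNN refl])
  have fm[measurable]: "feat c H \<in> borel_measurable Rinf" by (rule feat_meas[OF H])
  have i1: "integrable (N \<Otimes>\<^sub>M N) (\<lambda>y. feat c H (fst y))"
    by (rule NN.P.integrable_const_bound[where B=1]) (auto simp: abs_feature_le intro!: toN)
  have i2: "integrable (N \<Otimes>\<^sub>M N) (\<lambda>y. feat c H ((fst y)(j := snd y 0)))"
    by (rule NN.P.integrable_const_bound[where B=1]) (auto simp: abs_feature_le intro!: toN)
  have *: "(\<integral>\<^sup>+z. ennreal \<bar>feat c H (fst z) - feat c H ((fst z)(j := snd z 0))\<bar> \<partial>(N \<Otimes>\<^sub>M N))
      \<le> ennreal (B * (\<Sum>a\<in>(UNIV::'m set). \<Lambda> / \<rho> ^ m * \<rho> ^ j))"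
  proof (rule nn_integral_feature_diff_le[OF B(1)])
    fix a :: 'm
    let ?b = "to_nat_on UNIV a" and ?k = "m - to_nat_on UNIV a"
    have b: "?b \<le> m" by (rule to_nat_on_le[OF m])
    note [measurable] = H[OF b]
    show "(\<lambda>z. norm (H ?b (shift_seq ?k (fst z)) - H ?b (shift_seq ?k ((fst z)(j := snd z 0))))) \<in> borel_measurable (N \<Otimes>\<^sub>M N)"
      by (rule toN) measurable
    show "(\<integral>\<^sup>+z. ennreal (norm (H ?b (shift_seq ?k (fst z)) - H ?b (shift_seq ?k ((fst z)(j := snd z 0))))) \<partial>(N \<Otimes>\<^sub>M N))
        \<le> ennreal (\<Lambda> / \<rho> ^ m * \<rho> ^ j)"
    \<comment> \<open>A coordinate more recent than the row is invisible to it.\<close>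
    proof (cases "j < ?k")
      case True
      then have "shift_seq ?k ((fst z)(j := snd z 0)) = shift_seq ?k (fst z)" for z :: "(nat \<Rightarrow> real) \<times> (nat \<Rightarrow> real)"
        by (auto simp: shift_seq_def fun_eq_iff)
      then show ?thesis by simp
    next
      case False
      \<comment> \<open>The replacement value sits in the second factor. Shifting only the first
        factor preserves N x N, so the dependence bound for the map applies at coordinate j -
        k.\<close>
      have eq: "shift_seq ?k ((fst z)(j := snd z 0)) = (shift_seq ?k (fst z))(j - ?k := snd z 0)" for z :: "(nat \<Rightarrow> real) \<times> (nat \<Rightarrow> real)"
        using False by (auto simp: shift_seq_def fun_eq_iff)
      let ?f = "\<lambda>z. ennreal (norm (H ?b (fst z) - H ?b ((fst z)(j - ?k := snd z 0))))"
      have sm: "shift_seq ?k \<in> measurable N Rinf" by (rule measurable_N[OF measurable_shift_seq])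
      have im: "(\<lambda>y. y) \<in> measurable N Rinf" by (rule measurable_N) simp
      have dN: "distr N Rinf (\<lambda>y. y) = N" by (rule distr_id2) (simp add: N(2))
      have "N \<Otimes>\<^sub>M N = distr N Rinf (shift_seq ?k) \<Otimes>\<^sub>M distr N Rinf (\<lambda>y. y)" by (simp add: N(3) dN)
      also have "\<dots> = distr (N \<Otimes>\<^sub>M N) (Rinf \<Otimes>\<^sub>M Rinf) (\<lambda>(x, y). (shift_seq ?k x, y))"
        by (rule pair_measure_distr[OF sm im]) (simp add: dN N.sigma_finite_measure_axioms)
      finally have law: "distr (N \<Otimes>\<^sub>M N) (Rinf \<Otimes>\<^sub>M Rinf) (\<lambda>(x, y). (shift_seq ?k x, y)) = N \<Otimes>\<^sub>M N" by simp
      have tm: "(\<lambda>(x, y). (shift_seq ?k x, y)) \<in> measurable (N \<Otimes>\<^sub>M N) (Rinf \<Otimes>\<^sub>M Rinf)"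
        using sm im by measurable
      have fme: "?f \<in> borel_measurable (Rinf \<Otimes>\<^sub>M Rinf)" by measurable
      have "(\<integral>\<^sup>+z. ?f z \<partial>(N \<Otimes>\<^sub>M N)) = (\<integral>\<^sup>+z. ?f z \<partial>distr (N \<Otimes>\<^sub>M N) (Rinf \<Otimes>\<^sub>M Rinf) (\<lambda>(x, y). (shift_seq ?k x, y)))"
        by (simp only: law)
      also have "\<dots> = (\<integral>\<^sup>+z. ?f (case z of (x, y) \<Rightarrow> (shift_seq ?k x, y)) \<partial>(N \<Otimes>\<^sub>M N))"
        by (rule nn_integral_distr[OF tm]) (simp add: fme)
      also have "\<dots> = (\<integral>\<^sup>+z. ennreal (norm (H ?b (shift_seq ?k (fst z)) - H ?b (shift_seq ?k ((fst z)(j := snd z 0))))) \<partial>(N \<Otimes>\<^sub>M N))"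
        unfolding eq by (intro nn_integral_cong) (simp add: case_prod_beta)
      finally have "(\<integral>\<^sup>+z. ennreal (norm (H ?b (shift_seq ?k (fst z)) - H ?b (shift_seq ?k ((fst z)(j := snd z 0))))) \<partial>(N \<Otimes>\<^sub>M N))
         \<le> ennreal (\<Lambda> * \<rho> ^ (j - ?k))" using dep[OF b, of "j - ?k"] by simp
      also have "\<Lambda> * \<rho> ^ (j - ?k) \<le> \<Lambda> / \<rho> ^ m * \<rho> ^ j"
      proof -
        have "\<rho> ^ (j - ?k) * \<rho> ^ m \<le> \<rho> ^ (j - ?k) * \<rho> ^ ?k"
          using const by (intro mult_left_mono power_decreasing) auto
        also have "\<dots> = \<rho> ^ j" using False by (simp flip: power_add)
        finally show ?thesis using const by (simp add: field_simps)
      qed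
      finally show ?thesis by (simp add: ennreal_leI)
    qed
  qed (use const in auto)
  have eq: "B * (\<Sum>a\<in>(UNIV::'m set). \<Lambda> / \<rho> ^ m * \<rho> ^ j) = B * (real m + 1) * \<Lambda> / \<rho> ^ m * \<rho> ^ j"
    by (simp add: m add.commute)
  have "0 \<le> B * (\<Sum>a\<in>(UNIV::'m set). \<Lambda> / \<rho> ^ m * \<rho> ^ j)"
    using B const by (intro mult_nonneg_nonneg sum_nonneg) auto
  from abs_integral_diff_le(2)[OF i1 i2 * this] show ?thesis unfolding eq .
qed

section \<open>Deviation of the feature differences from their means\<close>

lemma Fobs_meas:
  assumes "t \<in> {int m + 1..int n}" "r \<le> s" "\<theta> \<in> \<Theta>"
  shows "Fobs c n r \<theta> t \<in> borel_measurable Rinf"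
  unfolding Fobs_def using assms by (intro feat_meas G_meas rtime_in) auto

lemma Y_meas:
  assumes "t \<in> {int m + 1..int n}" "\<theta> \<in> \<Theta>"
  shows "Y c n \<theta> t \<in> borel_measurable M"
proof -
  have [measurable]: "(\<lambda>x. Fobs c n r \<theta> t (X r t x)) \<in> borel_measurable M" if "r \<le> s" "\<theta> \<in> \<Theta>" for r \<theta>
    using measurable_compose[OF X_meas[OF that(1)] Fobs_meas[OF assms(1) that]] .
  show ?thesis unfolding Y_def[abs_def] using assms(2) \<theta>0 by measurable
qed

text \<open>The constant of \<open>weighted_sum_deviation\<close> for a window feature, doubled:
  once for the observed series and once for the average of the simulated ones.\<close>

definition "Cdev = 2 * sqrt (2 * (B * (real m + 1) * \<Lambda> / \<rho> ^ m) / (1 - \<rho>)\<^sup>2)"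

lemma Cdev_nonneg: "0 \<le> Cdev"
  using B const by (auto simp: Cdev_def)

text \<open>The triangle inequality reduces the claim to one noise copy at a time; averaging over
  the simulated series does not enlarge the bound.\<close>

lemma Y_dev:
  assumes T: "T \<subseteq> {int m + 1..int n}" and \<theta>: "\<theta> \<in> \<Theta>"
    and c: "\<And>t. t \<in> T \<Longrightarrow> \<bar>a t\<bar> \<le> b" "0 \<le> b"
  shows "expectation (\<lambda>x. \<bar>\<Sum>t\<in>T. a t * (Y c n \<theta> t x - \<mu>Y c n \<theta> t)\<bar>) \<le> b * Cdev * sqrt (card T)"
proof -
  have fin: "finite T" using T finite_subset by blast
  let ?Z = "\<lambda>r \<theta> x. \<Sum>t\<in>T. a t * (Fobs c n r \<theta> t (X r t x) - \<mu> c n r \<theta> t)"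
  have dev: "expectation (\<lambda>x. \<bar>?Z r \<theta> x\<bar>) \<le> b * (Cdev / 2) * sqrt (card T)" if "r \<le> s" "\<theta> \<in> \<Theta>" for r \<theta>
  proof -
    have "expectation (\<lambda>x. \<bar>?Z r \<theta> x\<bar>) \<le> b * sqrt (2 * (B * (real m + 1) * \<Lambda> / \<rho> ^ m) / (1 - \<rho>)\<^sup>2) * sqrt (card T)"
      unfolding \<mu>_def
    proof (rule X_dev[OF that(1) fin])
      fix t assume t: "t \<in> T"
      then have t': "t \<in> {int m + 1..int n}" using T by auto
      then have n1: "1 \<le> n" by auto
      show "Fobs c n r \<theta> t \<in> borel_measurable Rinf" by (rule Fobs_meas[OF t' that])
      show "\<And>y. \<bar>Fobs c n r \<theta> t y\<bar> \<le> 1" by (simp add: Fobs_def abs_feature_le)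
      show "(\<integral>y. \<bar>Fobs c n r \<theta> t (fst y) - Fobs c n r \<theta> t ((fst y)(j := snd y 0))\<bar> \<partial>(N \<Otimes>\<^sub>M N))
          \<le> B * (real m + 1) * \<Lambda> / \<rho> ^ m * \<rho> ^ j" for j
        unfolding Fobs_def using n1 that t'
        by (intro feat_dep G_meas G_dep rtime_in) auto
    qed (use B const c in auto)
    then show ?thesis by (simp add: Cdev_def)
  qed
  have iZ: "integrable M (\<lambda>x. ?Z r \<theta> x)" if "r \<le> s" "\<theta> \<in> \<Theta>" for r \<theta>
  proof (intro Bochner_Integration.integrable_sum integrable_mult_right Bochner_Integration.integrable_diff)
    fix t assume "t \<in> T"
    then have "t \<in> {int m + 1..int n}" using T by auto
    then show "integrable M (\<lambda>x. Fobs c n r \<theta> t (X r t x))"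
      using measurable_compose[OF X_meas[OF that(1)] Fobs_meas[OF _ that]]
      by (intro integrable_const_bound[where B=1]) (auto simp: Fobs_def abs_feature_le)
  qed simp
  have eq: "(\<Sum>t\<in>T. a t * (Y c n \<theta> t x - \<mu>Y c n \<theta> t)) = ?Z 0 \<theta>0 x - 1 / real s * (\<Sum>r=1..s. ?Z r \<theta> x)" for x
  proof -
    have "(\<Sum>t\<in>T. a t * (Y c n \<theta> t x - \<mu>Y c n \<theta> t)) =
      (\<Sum>t\<in>T. a t * (Fobs c n 0 \<theta>0 t (X 0 t x) - \<mu> c n 0 \<theta>0 t)
         - 1 / real s * (\<Sum>r=1..s. a t * (Fobs c n r \<theta> t (X r t x) - \<mu> c n r \<theta> t)))"
      unfolding Y_def \<mu>Y_def
      by (intro sum.cong refl) (simp add: sum_subtractf sum_distrib_left algebra_simps)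
    also have "\<dots> = ?Z 0 \<theta>0 x - 1 / real s * (\<Sum>t\<in>T. \<Sum>r=1..s. a t * (Fobs c n r \<theta> t (X r t x) - \<mu> c n r \<theta> t))"
      by (simp add: sum_subtractf sum_distrib_left)
    also have "(\<Sum>t\<in>T. \<Sum>r=1..s. a t * (Fobs c n r \<theta> t (X r t x) - \<mu> c n r \<theta> t)) = (\<Sum>r=1..s. ?Z r \<theta> x)"
      by (rule sum.swap)
    finally show ?thesis .
  qed
  have "expectation (\<lambda>x. \<bar>\<Sum>t\<in>T. a t * (Y c n \<theta> t x - \<mu>Y c n \<theta> t)\<bar>) \<le>
      expectation (\<lambda>x. \<bar>?Z 0 \<theta>0 x\<bar> + 1 / real s * (\<Sum>r=1..s. \<bar>?Z r \<theta> x\<bar>))"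
    unfolding eq
  proof (rule integral_mono)
    show "integrable M (\<lambda>x. \<bar>?Z 0 \<theta>0 x - 1 / real s * (\<Sum>r=1..s. ?Z r \<theta> x)\<bar>)"
      using \<theta> \<theta>0 by (intro integrable_abs Bochner_Integration.integrable_diff integrable_mult_right Bochner_Integration.integrable_sum[where I="{1..s}"] iZ) auto
    show "integrable M (\<lambda>x. \<bar>?Z 0 \<theta>0 x\<bar> + 1 / real s * (\<Sum>r=1..s. \<bar>?Z r \<theta> x\<bar>))"
      using \<theta> \<theta>0 by (intro Bochner_Integration.integrable_add integrable_mult_right Bochner_Integration.integrable_sum[where I="{1..s}"] integrable_abs iZ) auto
    fix x
    have "\<bar>1 / real s * (\<Sum>r=1..s. ?Z r \<theta> x)\<bar> \<le> 1 / real s * (\<Sum>r=1..s. \<bar>?Z r \<theta> x\<bar>)"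
      unfolding abs_mult by (intro mult_mono sum_abs) auto
    then show "\<bar>?Z 0 \<theta>0 x - 1 / real s * (\<Sum>r=1..s. ?Z r \<theta> x)\<bar> \<le> \<bar>?Z 0 \<theta>0 x\<bar> + 1 / real s * (\<Sum>r=1..s. \<bar>?Z r \<theta> x\<bar>)"
      by linarith
  qed
  also have "\<dots> = expectation (\<lambda>x. \<bar>?Z 0 \<theta>0 x\<bar>) + 1 / real s * (\<Sum>r=1..s. expectation (\<lambda>x. \<bar>?Z r \<theta> x\<bar>))"
  proof -
    have "expectation (\<lambda>x. \<Sum>r=1..s. \<bar>?Z r \<theta> x\<bar>) = (\<Sum>r=1..s. expectation (\<lambda>x. \<bar>?Z r \<theta> x\<bar>))"
      using \<theta> by (intro Bochner_Integration.integral_sum integrable_abs iZ) auto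
    moreover have "integrable M (\<lambda>x. 1 / real s * (\<Sum>r=1..s. \<bar>?Z r \<theta> x\<bar>))"
      using \<theta> by (intro integrable_mult_right Bochner_Integration.integrable_sum[where I="{1..s}"] integrable_abs iZ) auto
    ultimately show ?thesis
      using iZ[of 0 \<theta>0] \<theta>0 by (subst Bochner_Integration.integral_add) auto
  qed
  also have "\<dots> \<le> b * (Cdev / 2) * sqrt (card T) + 1 / real s * (\<Sum>r=1..s. b * (Cdev / 2) * sqrt (card T))"
    using \<theta> \<theta>0 by (intro add_mono mult_left_mono sum_mono dev) auto
  also have "\<dots> = b * Cdev * sqrt (card T)" using s by simp
  finally show ?thesis .
qed

text \<open>Common bound for the errors of freezing and of shifting time. The largest lag to be
  covered is L + w for the lagged window and m for the rows.\<close>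

definition "rate n = B * (real m + 1) * (real n * ((1 + K) * (real (L n + w n + m) / real n) powr (1 / \<kappa>)))"

text \<open>The lower end suits both uses: it equals m + 1 for the row offsets j <= m, and it lies
  below m + 1 + j, where the sums over lagged windows start.\<close>

lemma kvar_lag_sum:
  assumes d: "bounded_kvar \<kappa> K d" and n: "m < n" and j: "j \<le> L n + w n + m"
  shows "(\<Sum>t\<in>{max (int m) (int j) + 1..int n}. d (real_of_int t / real n) (real_of_int (t - int j) / real n))
    \<le> real n * ((1 + K) * (real (L n + w n + m) / real n) powr (1 / \<kappa>))"
proof -
  let ?d = "\<lambda>t. d (real t / real n) (real (t - j) / real n)"
  have "(\<Sum>t\<in>{max (int m) (int j) + 1..int n}. d (real_of_int t / real n) (real_of_int (t - int j) / real n)) =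
      (\<Sum>t\<in>{int (Suc (max m j))..int n}. d (real_of_int t / real n) (real_of_int (t - int j) / real n))"
    by (intro sum.cong) (auto simp: of_nat_max)
  also have "\<dots> = (\<Sum>t\<in>{Suc (max m j)..n}. ?d t)"
    unfolding sum_int_eq_sum_nat by (intro sum.cong) (auto simp: of_nat_diff)
  also have "\<dots> \<le> (\<Sum>t\<in>{Suc j..n}. ?d t)"
    using bounded_kvarD(2)[OF d] by (intro sum_mono2) auto
  also have "\<dots> \<le> real n * ((1 + K) * (real (L n + w n + m) / real n) powr (1 / \<kappa>))"
    using n j const seq_pos[of n] by (intro bounded_kvar_lag_sum d) auto
  finally show ?thesis .
qed

text \<open>Freezing every row at t/n moves row b by the lag m - b, so each row contributes one lag
  sum.\<close>

lemma bias_sum: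
  assumes n: "m < n" and r: "r \<le> s" and \<theta>: "\<theta> \<in> \<Theta>"
  shows "(\<Sum>t\<in>{int m + 1..int n}. \<bar>\<mu> c n r \<theta> t - \<Phi> c n r (real_of_int t / real n) \<theta>\<bar>) \<le> rate n"
proof -
  have n1: "1 \<le> n" using n by simp
  obtain d where d: "bounded_kvar \<kappa> K d"
    "\<And>u v. u \<in> {0..1} \<Longrightarrow> v \<in> {0..1} \<Longrightarrow> (\<integral>\<^sup>+y. ennreal (norm (G n r u y \<theta> - G n r v y \<theta>)) \<partial>N) \<le> ennreal (d u v)"
    using G_kvar[OF n1 r \<theta>] by blast
  have "(\<Sum>t\<in>{int m + 1..int n}. \<bar>\<mu> c n r \<theta> t - \<Phi> c n r (real_of_int t / real n) \<theta>\<bar>) \<le>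
      (\<Sum>t\<in>{int m + 1..int n}. B * (\<Sum>a\<in>(UNIV::'m set). d (rtime n t (to_nat_on UNIV a)) (real_of_int t / real n)))"
  proof (rule sum_mono)
    fix t assume t: "t \<in> {int m + 1..int n}"
    show "\<bar>\<mu> c n r \<theta> t - \<Phi> c n r (real_of_int t / real n) \<theta>\<bar> \<le> B * (\<Sum>a\<in>(UNIV::'m set). d (rtime n t (to_nat_on UNIV a)) (real_of_int t / real n))"
      unfolding \<mu>_def \<Phi>_def Fobs_def
      using n1 r \<theta> t bounded_kvarD(2)[OF d(1)]
      by (intro integral_feat_diff_le[where d="\<lambda>b. d (rtime n t b) (real_of_int t / real n)"] G_meas rtime_in time_in d) auto
  qed
  also have "\<dots> = B * (\<Sum>a\<in>(UNIV::'m set). \<Sum>t\<in>{int m + 1..int n}. d (rtime n t (to_nat_on UNIV a)) (real_of_int t / real n))"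
    by (subst sum.swap) (simp add: sum_distrib_left)
  also have "\<dots> \<le> B * (\<Sum>a\<in>(UNIV::'m set). real n * ((1 + K) * (real (L n + w n + m) / real n) powr (1 / \<kappa>)))"
  proof (intro mult_left_mono sum_mono B)
    fix a :: 'm
    let ?b = "to_nat_on UNIV a"
    have b: "?b \<le> m" by (rule to_nat_on_le[OF m])
    have "(\<Sum>t\<in>{int m + 1..int n}. d (rtime n t ?b) (real_of_int t / real n)) =
      (\<Sum>t\<in>{max (int m) (int (m - ?b)) + 1..int n}. d (real_of_int t / real n) (real_of_int (t - int (m - ?b)) / real n))"
    proof (rule sum.cong)
      show "{int m + 1..int n} = {max (int m) (int (m - ?b)) + 1..int n}" by simp
      fix t
      have "rtime n t ?b = real_of_int (t - int (m - ?b)) / real n" using b by (simp add: rtime_def of_nat_diff)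
      then show "d (rtime n t ?b) (real_of_int t / real n) = d (real_of_int t / real n) (real_of_int (t - int (m - ?b)) / real n)"
        by (simp only: bounded_kvarD(1)[OF d(1), of "real_of_int t / real n"])
    qed
    also have "\<dots> \<le> real n * ((1 + K) * (real (L n + w n + m) / real n) powr (1 / \<kappa>))"
      by (rule kvar_lag_sum[OF d(1) n]) simp
    finally show "(\<Sum>t\<in>{int m + 1..int n}. d (rtime n t ?b) (real_of_int t / real n)) \<le> real n * ((1 + K) * (real (L n + w n + m) / real n) powr (1 / \<kappa>))" .
  qed
  also have "\<dots> = rate n" by (simp add: rate_def m add.commute)
  finally show ?thesis .
qed

lemma lag_sum:
  assumes n: "m < n" and r: "r \<le> s" and \<theta>: "\<theta> \<in> \<Theta>" and j: "j \<le> L n + w n"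
  shows "(\<Sum>t\<in>{int m + 1 + int j..int n}. \<bar>\<Phi> c n r (real_of_int t / real n) \<theta> - \<Phi> c n r (real_of_int (t - int j) / real n) \<theta>\<bar>) \<le> rate n"
proof -
  have n1: "1 \<le> n" using n by simp
  obtain d where d: "bounded_kvar \<kappa> K d"
    "\<And>u v. u \<in> {0..1} \<Longrightarrow> v \<in> {0..1} \<Longrightarrow> (\<integral>\<^sup>+y. ennreal (norm (G n r u y \<theta> - G n r v y \<theta>)) \<partial>N) \<le> ennreal (d u v)"
    using G_kvar[OF n1 r \<theta>] by blast
  let ?d = "\<lambda>t. d (real_of_int t / real n) (real_of_int (t - int j) / real n)"
  have "(\<Sum>t\<in>{int m + 1 + int j..int n}. \<bar>\<Phi> c n r (real_of_int t / real n) \<theta> - \<Phi> c n r (real_of_int (t - int j) / real n) \<theta>\<bar>)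
     \<le> (\<Sum>t\<in>{int m + 1 + int j..int n}. B * (real m + 1) * ?d t)"
  proof (rule sum_mono)
    fix t assume t: "t \<in> {int m + 1 + int j..int n}"
    have t1: "real_of_int t / real n \<in> {0..1}" using t by (intro time_in) auto
    have t2: "real_of_int (t - int j) / real n \<in> {0..1}" using t by (intro time_in) auto
    show "\<bar>\<Phi> c n r (real_of_int t / real n) \<theta> - \<Phi> c n r (real_of_int (t - int j) / real n) \<theta>\<bar> \<le> B * (real m + 1) * ?d t"
      unfolding \<Phi>_def by (intro integral_feat_diff_le_const G_meas n1 r \<theta> t1 t2 d(2) bounded_kvarD(2)[OF d(1)])
  qed
  also have "\<dots> = B * (real m + 1) * (\<Sum>t\<in>{int m + 1 + int j..int n}. ?d t)" by (simp add: sum_distrib_left)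
  also have "\<dots> \<le> B * (real m + 1) * (\<Sum>t\<in>{max (int m) (int j) + 1..int n}. ?d t)"
    using B bounded_kvarD(2)[OF d(1)] by (intro mult_left_mono sum_mono2) auto
  also have "\<dots> \<le> rate n" unfolding rate_def
    using B j by (intro mult_left_mono kvar_lag_sum[OF d(1) n]) auto
  finally show ?thesis .
qed

lemma sum_abs_diff_avg_le:
  fixes A :: "nat \<Rightarrow> 'i \<Rightarrow> real" and A0 :: "'i \<Rightarrow> real"
  assumes "(\<Sum>t\<in>T. \<bar>A0 t\<bar>) \<le> R" "\<And>r. 1 \<le> r \<Longrightarrow> r \<le> s \<Longrightarrow> (\<Sum>t\<in>T. \<bar>A r t\<bar>) \<le> R"
  shows "(\<Sum>t\<in>T. \<bar>A0 t - 1 / real s * (\<Sum>r=1..s. A r t)\<bar>) \<le> 2 * R"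
proof -
  have "(\<Sum>t\<in>T. \<bar>A0 t - 1 / real s * (\<Sum>r=1..s. A r t)\<bar>) \<le> (\<Sum>t\<in>T. \<bar>A0 t\<bar> + 1 / real s * (\<Sum>r=1..s. \<bar>A r t\<bar>))"
  proof (rule sum_mono)
    fix t
    have "\<bar>1 / real s * (\<Sum>r=1..s. A r t)\<bar> \<le> 1 / real s * (\<Sum>r=1..s. \<bar>A r t\<bar>)"
      unfolding abs_mult by (intro mult_mono sum_abs) auto
    then show "\<bar>A0 t - 1 / real s * (\<Sum>r=1..s. A r t)\<bar> \<le> \<bar>A0 t\<bar> + 1 / real s * (\<Sum>r=1..s. \<bar>A r t\<bar>)" by linarith
  qed
  also have "\<dots> = (\<Sum>t\<in>T. \<bar>A0 t\<bar>) + 1 / real s * (\<Sum>t\<in>T. \<Sum>r=1..s. \<bar>A r t\<bar>)"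
    by (simp add: sum.distrib sum_distrib_left)
  also have "(\<Sum>t\<in>T. \<Sum>r=1..s. \<bar>A r t\<bar>) = (\<Sum>r=1..s. \<Sum>t\<in>T. \<bar>A r t\<bar>)" by (rule sum.swap)
  also have "(\<Sum>t\<in>T. \<bar>A0 t\<bar>) + 1 / real s * (\<Sum>r=1..s. \<Sum>t\<in>T. \<bar>A r t\<bar>) \<le> R + 1 / real s * (\<Sum>r=1..s. R)"
    using assms by (intro add_mono mult_left_mono sum_mono) auto
  also have "\<dots> = 2 * R" using s by simp
  finally show ?thesis .
qed

lemma diff_avg_diff:
  fixes a a' :: real
  shows "(a - 1 / real s * (\<Sum>r=1..s. f r)) - (a' - 1 / real s * (\<Sum>r=1..s. f' r)) =
    (a - a') - 1 / real s * (\<Sum>r=1..s. f r - f' r)"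
  by (simp add: sum_subtractf diff_divide_distrib)

text \<open>The bound of \<open>expectation_rw_crit_approx\<close> with A and D both equal to 2
  \<open>rate n\<close>, the 2 standing for the observed series and the simulated average.\<close>

definition "\<gamma> n = 1 / (real n - real m) * (16 * (real (\<tau> n) + real (w n) + 1 + real (L n)) +
      8 * (real n * Cdev / sqrt (real (w n) + 1) + 2 * rate n + 2 * rate n) + 4 * (Cdev * sqrt n + 2 * rate n))"

lemma expectation_crit_approx:
  assumes n: "m < n" and \<theta>: "\<theta> \<in> \<Theta>"
  shows "expectation (\<lambda>x. \<bar>rw_crit m (w n) (\<tau> n) (L n) n (\<lambda>t. Y c n \<theta> t x) -
    1 / (real n - real m) * (\<Sum>t\<in>{int m + 1..int n}. (h c n \<theta> t)\<^sup>2)\<bar>) \<le> \<gamma> n"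
  unfolding \<gamma>_def
proof (rule expectation_rw_crit_approx[where \<mu>="\<mu>Y c n \<theta>"])
  show "(\<Sum>t\<in>{int m + 1..int n}. \<bar>\<mu>Y c n \<theta> t - h c n \<theta> t\<bar>) \<le> 2 * rate n"
    unfolding \<mu>Y_def h_def diff_avg_diff
    using n \<theta> \<theta>0 by (intro sum_abs_diff_avg_le bias_sum) auto
  show "(\<Sum>t\<in>{int m + 1 + int j..int n}. \<bar>h c n \<theta> t - h c n \<theta> (t - int j)\<bar>) \<le> 2 * rate n"
    if "j \<le> L n + w n" for j
    unfolding h_def diff_avg_diff
    using n \<theta> \<theta>0 that by (intro sum_abs_diff_avg_le lag_sum) auto
qed (use n seq_pos[of n] \<theta> in \<open>auto intro!: Y_meas abs_Y_le abs_h_le Y_dev Cdev_nonneg\<close>)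

section \<open>From one feature to the full criterion, and the rate of approximation\<close>

lemma Q_meas:
  assumes n: "m < n" and \<theta>: "\<theta> \<in> \<Theta>"
  shows "Q n \<theta> \<in> borel_measurable M"
  unfolding Q_def[abs_def] using n \<theta> seq_pos[of n]
  by (intro borel_measurable_sum borel_measurable_rw_crit Y_meas) auto

lemma abs_rw_crit_le:
  assumes "m < n"
  shows "\<bar>rw_crit m (w n) (\<tau> n) (L n) n (\<lambda>t. Y c n \<theta> t x)\<bar> \<le> 12"
proof -
  let ?I = "{int m + int (\<tau> n) + int (L n)..int n}"
  have pos: "1 \<le> \<tau> n" using seq_pos[of n] assms by simp
  have "\<bar>rw_crit m (w n) (\<tau> n) (L n) n (\<lambda>t. Y c n \<theta> t x)\<bar> \<le> 1 / (real n - real m) * (\<Sum>t\<in>?I. 12)"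
    unfolding rw_crit_def abs_mult Let_def using assms pos
    by (intro mult_mono order_trans[OF sum_abs] sum_mono rw_term_bound abs_rolling_mean_le_const abs_Y_le) auto
  also have "\<dots> \<le> 1 / (real n - real m) * (12 * (real n - real m))"
  proof (intro mult_left_mono)
    have "real (card ?I) \<le> real n - real m" using assms pos by auto
    then show "(\<Sum>t\<in>?I. (12::real)) \<le> 12 * (real n - real m)" by (simp only: sum_constant mult.commute[of _ 12] mult_left_mono)
  qed (use assms in auto)
  also have "\<dots> = 12"
  proof -
    have "real m < real n" using assms by simp
    then show ?thesis by (simp add: field_simps)
  qed
  finally show ?thesis .
qed

lemma Q_approx_integrable:
  assumes n: "m < n" and \<theta>: "\<theta> \<in> \<Theta>"
  shows "integrable M (\<lambda>x. \<bar>Q n \<theta> x - q n \<theta>\<bar>)"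
proof -
  have "integrable M (Q n \<theta>)"
  proof (rule integrable_const_bound[where B="real CARD('k) * 12"])
    show "AE x in M. norm (Q n \<theta> x) \<le> real CARD('k) * 12"
    proof (rule AE_I2)
      fix x
      have "norm (Q n \<theta> x) \<le> (\<Sum>c\<in>(UNIV::'k set). 12)"
        unfolding Q_def real_norm_def by (rule order_trans[OF sum_abs]) (intro sum_mono abs_rw_crit_le n)
      then show "norm (Q n \<theta> x) \<le> real CARD('k) * 12" by simp
    qed
  qed (rule Q_meas[OF assms])
  then show ?thesis by auto
qed

lemma expectation_Q_approx:
  assumes n: "m < n" and \<theta>: "\<theta> \<in> \<Theta>"
  shows "expectation (\<lambda>x. \<bar>Q n \<theta> x - q n \<theta>\<bar>) \<le> real CARD('k) * \<gamma> n"
proof -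
  let ?d = "\<lambda>c x. \<bar>rw_crit m (w n) (\<tau> n) (L n) n (\<lambda>t. Y c n \<theta> t x) -
    1 / (real n - real m) * (\<Sum>t\<in>{int m + 1..int n}. (h c n \<theta> t)\<^sup>2)\<bar>"
  have i: "integrable M (?d c)" for c
  proof -
    have "integrable M (\<lambda>x. rw_crit m (w n) (\<tau> n) (L n) n (\<lambda>t. Y c n \<theta> t x))"
      using n \<theta> seq_pos[of n] abs_rw_crit_le[OF n]
      by (intro integrable_const_bound[where B=12] borel_measurable_rw_crit Y_meas) auto
    then show ?thesis by (intro integrable_abs Bochner_Integration.integrable_diff) auto
  qed
  have "expectation (\<lambda>x. \<bar>Q n \<theta> x - q n \<theta>\<bar>) \<le> expectation (\<lambda>x. \<Sum>c\<in>UNIV. ?d c x)"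
  proof (rule integral_mono[OF Q_approx_integrable[OF assms]])
    show "integrable M (\<lambda>x. \<Sum>c\<in>UNIV. ?d c x)" by (intro Bochner_Integration.integrable_sum i)
    show "\<bar>Q n \<theta> x - q n \<theta>\<bar> \<le> (\<Sum>c\<in>UNIV. ?d c x)" for x
      unfolding Q_def q_def sum_subtractf[symmetric] by (rule sum_abs)
  qed
  also have "\<dots> = (\<Sum>c\<in>UNIV. expectation (?d c))" by (intro Bochner_Integration.integral_sum i)
  also have "\<dots> \<le> (\<Sum>c\<in>(UNIV::'k set). \<gamma> n)" by (intro sum_mono expectation_crit_approx assms)
  finally show ?thesis by simp
qed

text \<open>Divided by n, the terms are the offset, window and lag over n, the window deviation of
  order (w+1)^(-1/2), the deviation n^(-1/2) of the full sum, and
  ((L+w+m)/n)^(1/\<open>\<kappa>\<close>) from \<open>rate\<close>.\<close>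

lemma \<gamma>_lim: "\<gamma> \<longlonglongrightarrow> 0"
proof -
  have inv: "(\<lambda>n. a / real n) \<longlonglongrightarrow> 0" for a :: real
    by (rule tendsto_divide_0[OF tendsto_const]) (simp add: filterlim_at_infinity_imp_filterlim_at_top filterlim_real_sequentially filterlim_at_top_imp_at_infinity)
  have J: "(\<lambda>n. real (L n + w n + m) / real n) \<longlonglongrightarrow> 0"
    using tendsto_add[OF tendsto_add[OF rates(3) rates(1)] inv[of "real m"]] by (simp add: add_divide_distrib)
  have "(\<lambda>n. (real (L n + w n + m) / real n) powr (1 / \<kappa>)) \<longlonglongrightarrow> 0"
    using const by (intro tendsto_zero_powrI[OF J tendsto_const]) auto
  then have P: "(\<lambda>n. B * (real m + 1) * ((1 + K) * (real (L n + w n + m) / real n) powr (1 / \<kappa>))) \<longlonglongrightarrow> 0"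
    by (intro tendsto_mult_right_zero)
  define R where "R n = B * (real m + 1) * ((1 + K) * (real (L n + w n + m) / real n) powr (1 / \<kappa>))" for n
  have R: "R \<longlonglongrightarrow> 0" using P by (simp add: R_def[abs_def])
  have rate: "rate n = real n * R n" for n by (simp add: rate_def R_def)
  have wl: "(\<lambda>n. Cdev / sqrt (real (w n) + 1)) \<longlonglongrightarrow> 0"
  proof (rule tendsto_divide_0[OF tendsto_const])
    have "filterlim (\<lambda>n. real (w n)) at_top sequentially"
      by (rule filterlim_compose[OF filterlim_real_sequentially w_lim])
    then have "filterlim (\<lambda>n. 1 + real (w n)) at_top sequentially"
      by (rule filterlim_tendsto_add_at_top[OF tendsto_const])
    then have "filterlim (\<lambda>n. sqrt (1 + real (w n))) at_top sequentially"
      by (rule filterlim_compose[OF sqrt_at_top])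
    then show "filterlim (\<lambda>n. sqrt (real (w n) + 1)) at_infinity sequentially"
      by (intro filterlim_at_top_imp_at_infinity) (simp add: add.commute)
  qed
  have sq: "(\<lambda>n. Cdev * (sqrt (real n) / real n)) \<longlonglongrightarrow> 0"
  proof (intro tendsto_mult_right_zero)
    have "(\<lambda>n. 1 / sqrt (real n)) \<longlonglongrightarrow> 0"
      by (intro tendsto_divide_0[OF tendsto_const] filterlim_at_top_imp_at_infinity
          filterlim_compose[OF sqrt_at_top filterlim_real_sequentially])
    moreover have "sqrt (real n) / real n = 1 / sqrt (real n)" for n
      by (metis divide_divide_eq_right mult_1 of_nat_0_le_iff real_div_sqrt real_sqrt_ge_0_iff
          times_divide_eq_left div_by_1 inverse_eq_divide sqrt_divide_self_eq)
    ultimately show "(\<lambda>n. sqrt (real n) / real n) \<longlonglongrightarrow> 0" by simp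
  qed
  define U where "U n = 16 * (real (\<tau> n) / real n + real (w n) / real n + 1 / real n + real (L n) / real n) +
      8 * (Cdev / sqrt (real (w n) + 1) + 2 * R n + 2 * R n) + 4 * (Cdev * (sqrt (real n) / real n) + 2 * R n)" for n
  have "U \<longlonglongrightarrow> 16 * (0 + 0 + 0 + 0) + 8 * (0 + 2 * 0 + 2 * 0) + 4 * (0 + 2 * 0)"
    unfolding U_def[abs_def]
    by (intro tendsto_intros rates inv wl R sq)
  then have U: "U \<longlonglongrightarrow> 0" by simp
  \<comment> \<open>The normalisation in \<open>\<gamma>\<close> is by n - m and that in
    \<open>U\<close> by n; this quotient mediates between them.\<close>
  have "(\<lambda>n. 1 / (1 - real m / real n)) \<longlonglongrightarrow> 1 / (1 - 0)"
    by (intro tendsto_intros inv) auto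
  from tendsto_mult[OF this U] have "(\<lambda>n. 1 / (1 - real m / real n) * U n) \<longlonglongrightarrow> 0" by simp
  moreover have "\<forall>\<^sub>F n in sequentially. 1 / (1 - real m / real n) * U n = \<gamma> n"
    using eventually_gt_at_top[of m]
  proof eventually_elim
    case (elim n)
    have e1: "1 / (1 - real m / real n) = 1 / (real n - real m) * real n"
    proof -
      have "real m < real n" "0 < real n" using elim by linarith+
      then show ?thesis by (simp add: field_simps)
    qed
    have e2: "real n * U n = 16 * (real (\<tau> n) + real (w n) + 1 + real (L n)) +
      8 * (real n * Cdev / sqrt (real (w n) + 1) + 2 * rate n + 2 * rate n) + 4 * (Cdev * sqrt n + 2 * rate n)"
    proof -
      have "0 < n" using elim by (metis gr_zeroI not_less_zero)
      then have [simp]: "real n * (a / real n) = a" for a by simp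
      show ?thesis using \<open>0 < n\<close> unfolding U_def rate distrib_left
        by (simp only: mult.left_commute[of "real n"] distrib_left) (simp add: algebra_simps)
    qed
    show ?case unfolding e1 \<gamma>_def by (simp only: mult.assoc e2)
  qed
  ultimately show ?thesis by (rule Lim_transform_eventually)
qed

end

subsection \<open>Equicontinuity, separation and consistency\<close>

context rolling_window begin

text \<open>One majorant d serves all features and all close pairs of parameters, which replaces a
  supremum over an uncountable set by a measurable function.\<close>

lemma Fobs_modulus:
  assumes t: "t \<in> {int m + 1..int n}" and r: "r \<le> s" and \<epsilon>: "0 < \<epsilon>"
  obtains d where "d \<in> borel_measurable Rinf" "\<And>y. 0 \<le> d y" "\<And>y. d y \<le> 2"
    "(\<integral>\<^sup>+y. ennreal (d y) \<partial>N) \<le> ennreal (B * (real m + 1) * \<eta> \<epsilon>)"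
    "\<And>c y \<theta> \<theta>'. \<theta> \<in> \<Theta> \<Longrightarrow> \<theta>' \<in> \<Theta> \<Longrightarrow> norm (\<theta> - \<theta>') \<le> \<epsilon> \<Longrightarrow> \<bar>Fobs c n r \<theta> t y - Fobs c n r \<theta>' t y\<bar> \<le> d y"
proof -
  have n1: "1 \<le> n" using t by auto
  define P where "P b g \<longleftrightarrow> g \<in> borel_measurable Rinf \<and> (\<integral>\<^sup>+y. g y \<partial>N) \<le> ennreal (\<eta> \<epsilon>) \<and>
      (\<forall>y. \<forall>\<theta>\<in>\<Theta>. \<forall>\<theta>'\<in>\<Theta>. norm (\<theta> - \<theta>') \<le> \<epsilon> \<longrightarrow>
        ennreal (norm (G n r (rtime n t b) y \<theta> - G n r (rtime n t b) y \<theta>')) \<le> g y)" for b g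
  have "\<exists>g. P b g" if "b \<le> m" for b
    using G_equi[OF n1 r rtime_in[OF t that] \<epsilon>] unfolding P_def by blast
  then obtain g where "\<And>b. b \<le> m \<Longrightarrow> P b (g b)" by metis
  then have g: "\<And>b. b \<le> m \<Longrightarrow> g b \<in> borel_measurable Rinf"
    "\<And>b. b \<le> m \<Longrightarrow> (\<integral>\<^sup>+y. g b y \<partial>N) \<le> ennreal (\<eta> \<epsilon>)"
    "\<And>b y \<theta> \<theta>'. b \<le> m \<Longrightarrow> \<theta> \<in> \<Theta> \<Longrightarrow> \<theta>' \<in> \<Theta> \<Longrightarrow> norm (\<theta> - \<theta>') \<le> \<epsilon> \<Longrightarrow>
        ennreal (norm (G n r (rtime n t b) y \<theta> - G n r (rtime n t b) y \<theta>')) \<le> g b y"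
    unfolding P_def by blast+
  have \<eta>0: "0 \<le> \<eta> \<epsilon>" using G_equi[OF n1 r _ \<epsilon>, of 0] by simp
  let ?i = "to_nat_on (UNIV::'m set)"
  have i: "?i a \<le> m" for a by (rule to_nat_on_le[OF m])
  define S where "S y = ennreal B * (\<Sum>a\<in>(UNIV::'m set). g (?i a) (shift_seq (m - ?i a) y))" for y
  have gs[measurable]: "(\<lambda>y. g (?i a) (shift_seq (m - ?i a) y)) \<in> borel_measurable Rinf" for a
    by (rule measurable_compose[OF measurable_shift_seq g(1)[OF i]])
  have Sm[measurable]: "S \<in> borel_measurable Rinf" unfolding S_def[abs_def] by measurable
  \<comment> \<open>The majorants g may be infinite. Clipping at 2, the largest distance of two
    cosines, makes d real-valued without losing domination.\<close>
  define d where "d y = enn2real (min 2 (S y))" for y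
  have dS: "ennreal (d y) = min 2 (S y)" for y
    unfolding d_def by (intro ennreal_enn2real) (auto simp: min_less_iff_disj)
  show ?thesis
  proof
    show "d \<in> borel_measurable Rinf" unfolding d_def[abs_def] by measurable
    show "0 \<le> d y" for y by (simp add: d_def)
    show "d y \<le> 2" for y
    proof -
      have "ennreal (d y) \<le> ennreal 2" unfolding dS by simp
      then show ?thesis by (subst (asm) ennreal_le_iff) auto
    qed
    have "(\<integral>\<^sup>+y. ennreal (d y) \<partial>N) \<le> (\<integral>\<^sup>+y. S y \<partial>N)"
      unfolding dS by (intro nn_integral_mono) simp
    also have "\<dots> = ennreal B * (\<Sum>a\<in>(UNIV::'m set). \<integral>\<^sup>+y. g (?i a) (shift_seq (m - ?i a) y) \<partial>N)"
      unfolding S_def using measurable_N[OF gs]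
      by (subst nn_integral_cmult) (auto simp: nn_integral_sum intro!: borel_measurable_sum)
    also have "\<dots> = ennreal B * (\<Sum>a\<in>(UNIV::'m set). \<integral>\<^sup>+y. g (?i a) y \<partial>N)"
      by (intro arg_cong2[where f="(*)"] refl sum.cong nn_integral_shift_seq g(1) i)
    also have "\<dots> \<le> ennreal B * (\<Sum>a\<in>(UNIV::'m set). ennreal (\<eta> \<epsilon>))"
      by (intro mult_left_mono sum_mono g(2) i) auto
    also have "\<dots> = ennreal (B * (real m + 1) * \<eta> \<epsilon>)"
    proof -
      have "ennreal (B * (real m + 1) * \<eta> \<epsilon>) = ennreal B * (ennreal (real m + 1) * ennreal (\<eta> \<epsilon>))"
        using B \<eta>0 by (simp add: ennreal_mult mult.assoc)
      moreover have "ennreal (real m + 1) = of_nat (m + 1)" by (simp add: ennreal_of_nat_eq_real_of_nat add.commute)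
      ultimately show ?thesis using m by (simp add: add.commute)
    qed
    finally show "(\<integral>\<^sup>+y. ennreal (d y) \<partial>N) \<le> ennreal (B * (real m + 1) * \<eta> \<epsilon>)" .
    fix c y \<theta> \<theta>' assume \<theta>: "\<theta> \<in> \<Theta>" "\<theta>' \<in> \<Theta>" "norm (\<theta> - \<theta>') \<le> \<epsilon>"
    have "ennreal \<bar>Fobs c n r \<theta> t y - Fobs c n r \<theta>' t y\<bar> \<le> S y"
    proof -
      let ?H = "\<lambda>\<theta> b y. G n r (rtime n t b) y \<theta>"
      have "\<bar>Fobs c n r \<theta> t y - Fobs c n r \<theta>' t y\<bar> \<le>
        B * (\<Sum>a\<in>(UNIV::'m set). norm (?H \<theta> (?i a) (shift_seq (m - ?i a) y) - ?H \<theta>' (?i a) (shift_seq (m - ?i a) y)))"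
        unfolding Fobs_def by (rule abs_feature_diff_le[OF B(1)])
      then have "ennreal \<bar>Fobs c n r \<theta> t y - Fobs c n r \<theta>' t y\<bar> \<le>
        ennreal B * (\<Sum>a\<in>(UNIV::'m set). ennreal (norm (?H \<theta> (?i a) (shift_seq (m - ?i a) y) - ?H \<theta>' (?i a) (shift_seq (m - ?i a) y))))"
        using B by (simp add: sum_ennreal flip: ennreal_mult) (simp add: ennreal_leI sum_nonneg flip: ennreal_mult)
      also have "\<dots> \<le> S y" unfolding S_def
        by (intro mult_left_mono sum_mono g(3) i \<theta>) auto
      finally show ?thesis .
    qed
    moreover have "\<bar>Fobs c n r \<theta> t y - Fobs c n r \<theta>' t y\<bar> \<le> 1 + 1"
      unfolding Fobs_def by (rule order_trans[OF abs_triangle_ineq4]) (intro add_mono abs_feature_le)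
    then have "ennreal \<bar>Fobs c n r \<theta> t y - Fobs c n r \<theta>' t y\<bar> \<le> ennreal 2" by (intro ennreal_leI) simp
    ultimately have "ennreal \<bar>Fobs c n r \<theta> t y - Fobs c n r \<theta>' t y\<bar> \<le> ennreal (d y)"
      unfolding dS by simp
    then show "\<bar>Fobs c n r \<theta> t y - Fobs c n r \<theta>' t y\<bar> \<le> d y" by (simp add: d_def)
  qed
qed

text \<open>The observed part cancels in the difference, so the average of the simulated majorants
  dominates.\<close>

lemma Y_modulus:
  assumes t: "t \<in> {int m + 1..int n}" and \<epsilon>: "0 < \<epsilon>"
  shows "\<exists>d. d \<in> borel_measurable M \<and> (\<forall>x. 0 \<le> d x \<and> d x \<le> 2) \<and> expectation d \<le> B * (real m + 1) * \<eta> \<epsilon> \<and>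
    (\<forall>c x. \<forall>\<theta>\<in>\<Theta>. \<forall>\<theta>'\<in>\<Theta>. norm (\<theta> - \<theta>') \<le> \<epsilon> \<longrightarrow> \<bar>Y c n \<theta> t x - Y c n \<theta>' t x\<bar> \<le> d x)"
proof -
  have n1: "1 \<le> n" using t by auto
  have \<eta>0: "0 \<le> \<eta> \<epsilon>" using G_equi[OF n1 _ _ \<epsilon>, of 0 0] by simp
  define P where "P r d \<longleftrightarrow> d \<in> borel_measurable Rinf \<and> (\<forall>y. 0 \<le> d y \<and> d y \<le> 2) \<and>
    (\<integral>\<^sup>+y. ennreal (d y) \<partial>N) \<le> ennreal (B * (real m + 1) * \<eta> \<epsilon>) \<and>
    (\<forall>c y. \<forall>\<theta>\<in>\<Theta>. \<forall>\<theta>'\<in>\<Theta>. norm (\<theta> - \<theta>') \<le> \<epsilon> \<longrightarrow> \<bar>Fobs c n r \<theta> t y - Fobs c n r \<theta>' t y\<bar> \<le> d y)" for r d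
  have "\<exists>d. P r d" if "r \<le> s" for r
    by (rule Fobs_modulus[OF t that \<epsilon>]) (unfold P_def, blast)
  then obtain d where "\<And>r. r \<le> s \<Longrightarrow> P r (d r)" by metis
  then have d: "\<And>r. r \<le> s \<Longrightarrow> d r \<in> borel_measurable Rinf" "\<And>r y. r \<le> s \<Longrightarrow> 0 \<le> d r y \<and> d r y \<le> 2"
    "\<And>r. r \<le> s \<Longrightarrow> (\<integral>\<^sup>+y. ennreal (d r y) \<partial>N) \<le> ennreal (B * (real m + 1) * \<eta> \<epsilon>)"
    "\<And>r c y \<theta> \<theta>'. r \<le> s \<Longrightarrow> \<theta> \<in> \<Theta> \<Longrightarrow> \<theta>' \<in> \<Theta> \<Longrightarrow> norm (\<theta> - \<theta>') \<le> \<epsilon> \<Longrightarrow> \<bar>Fobs c n r \<theta> t y - Fobs c n r \<theta>' t y\<bar> \<le> d r y"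
    unfolding P_def by blast+
  define D where "D x = 1 / real s * (\<Sum>r=1..s. d r (X r t x))" for x
  have m1: "(\<lambda>x. d r (X r t x)) \<in> borel_measurable M" if "r \<le> s" for r
    by (rule measurable_compose[OF X_meas[OF that] d(1)[OF that]])
  have i1: "integrable M (\<lambda>x. d r (X r t x))" if "r \<le> s" for r
    using m1[OF that] d(2)[OF that] by (intro integrable_const_bound[where B=2]) auto
  have e1: "expectation (\<lambda>x. d r (X r t x)) \<le> B * (real m + 1) * \<eta> \<epsilon>" if "r \<le> s" for r
  proof -
    have "ennreal (expectation (\<lambda>x. d r (X r t x))) = (\<integral>\<^sup>+x. ennreal (d r (X r t x)) \<partial>M)"
      using d(2)[OF that] by (intro nn_integral_eq_integral[symmetric] i1 that) auto
    also have "\<dots> = (\<integral>\<^sup>+y. ennreal (d r y) \<partial>distr M Rinf (X r t))"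
      using d(1)[OF that] by (intro nn_integral_distr[symmetric] X_meas that) auto
    also have "\<dots> \<le> ennreal (B * (real m + 1) * \<eta> \<epsilon>)"
      unfolding X_law[OF that] by (rule d(3)[OF that])
    finally show ?thesis using B \<eta>0 by (subst (asm) ennreal_le_iff) auto
  qed
  have "D \<in> borel_measurable M" unfolding D_def[abs_def] using m1 by (intro borel_measurable_times borel_measurable_sum) auto
  moreover have "0 \<le> D x \<and> D x \<le> 2" for x
  proof -
    have "0 \<le> (\<Sum>r=1..s. d r (X r t x))" using d(2) by (intro sum_nonneg) auto
    moreover have "(\<Sum>r=1..s. d r (X r t x)) \<le> (\<Sum>r=1..s. 2)" using d(2) by (intro sum_mono) auto
    ultimately show ?thesis using s by (simp add: D_def divide_le_eq)
  qed
  moreover have "expectation D \<le> B * (real m + 1) * \<eta> \<epsilon>"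
  proof -
    have "expectation D = 1 / real s * (\<Sum>r=1..s. expectation (\<lambda>x. d r (X r t x)))"
      unfolding D_def by (subst integral_mult_right_zero, subst Bochner_Integration.integral_sum) (auto intro: i1)
    also have "\<dots> \<le> 1 / real s * (\<Sum>r=1..s. B * (real m + 1) * \<eta> \<epsilon>)"
      by (intro mult_left_mono sum_mono e1) auto
    finally show ?thesis using s by simp
  qed
  moreover have "\<bar>Y c n \<theta> t x - Y c n \<theta>' t x\<bar> \<le> D x" if "\<theta> \<in> \<Theta>" "\<theta>' \<in> \<Theta>" "norm (\<theta> - \<theta>') \<le> \<epsilon>" for c x \<theta> \<theta>'
  proof -
    have "\<bar>Y c n \<theta> t x - Y c n \<theta>' t x\<bar> = \<bar>1 / real s * (\<Sum>r=1..s. Fobs c n r \<theta> t (X r t x) - Fobs c n r \<theta>' t (X r t x))\<bar>"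
      unfolding Y_def diff_avg_diff by simp
    also have "\<dots> \<le> 1 / real s * (\<Sum>r=1..s. d r (X r t x))"
      unfolding abs_mult
      by (intro mult_mono order_trans[OF sum_abs] sum_mono d(4) that) auto
    finally show ?thesis by (simp add: D_def)
  qed
  ultimately show ?thesis by blast
qed

text \<open>The 12 is 8 + 4 from \<open>rw_crit_Lipschitz\<close>: a window mean of expectations
  bounded by E is again bounded by E. The resulting bound does not depend on n, so a net can be
  fixed before n grows.\<close>

lemma Q_modulus:
  assumes n: "m < n" and \<epsilon>: "0 < \<epsilon>"
  shows "\<exists>D. integrable M D \<and> (\<forall>x\<in>space M. 0 \<le> D x) \<and> expectation D \<le> real CARD('k) * (12 * (B * (real m + 1) * \<eta> \<epsilon>)) \<and>
    (\<forall>x. \<forall>\<theta>\<in>\<Theta>. \<forall>\<theta>'\<in>\<Theta>. norm (\<theta> - \<theta>') \<le> \<epsilon> \<longrightarrow> \<bar>Q n \<theta> x - Q n \<theta>' x\<bar> \<le> D x)"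
proof -
  let ?E = "B * (real m + 1) * \<eta> \<epsilon>"
  have n1: "1 \<le> n" using n by auto
  have \<tau>: "1 \<le> \<tau> n" using seq_pos[OF n1] by simp
  have \<eta>0: "0 \<le> \<eta> \<epsilon>" using G_equi[OF n1 _ _ \<epsilon>, of 0 0] by simp
  let ?R = "{int m + 1..int n}"
  define P where "P t d \<longleftrightarrow> d \<in> borel_measurable M \<and> (\<forall>x. 0 \<le> d x \<and> d x \<le> 2) \<and> expectation d \<le> ?E \<and>
    (\<forall>c x. \<forall>\<theta>\<in>\<Theta>. \<forall>\<theta>'\<in>\<Theta>. norm (\<theta> - \<theta>') \<le> \<epsilon> \<longrightarrow> \<bar>Y c n \<theta> t x - Y c n \<theta>' t x\<bar> \<le> d x)" for t d
  have "\<exists>d. P t d" if "t \<in> ?R" for t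
    unfolding P_def by (rule Y_modulus[OF that \<epsilon>])
  then obtain d where "\<And>t. t \<in> ?R \<Longrightarrow> P t (d t)" by metis
  then have d: "\<And>t. t \<in> ?R \<Longrightarrow> d t \<in> borel_measurable M" "\<And>t x. t \<in> ?R \<Longrightarrow> 0 \<le> d t x \<and> d t x \<le> 2"
    "\<And>t. t \<in> ?R \<Longrightarrow> expectation (d t) \<le> ?E"
    "\<And>t c x \<theta> \<theta>'. t \<in> ?R \<Longrightarrow> \<theta> \<in> \<Theta> \<Longrightarrow> \<theta>' \<in> \<Theta> \<Longrightarrow> norm (\<theta> - \<theta>') \<le> \<epsilon> \<Longrightarrow> \<bar>Y c n \<theta> t x - Y c n \<theta>' t x\<bar> \<le> d t x"
    unfolding P_def by blast+
  have id: "integrable M (d t)" if "t \<in> ?R" for t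
    using d(1)[OF that] d(2)[OF that] by (intro integrable_const_bound[where B=2]) auto
  let ?I = "{int m + int (\<tau> n) + int (L n)..int n}"
  let ?D1 = "\<lambda>t x. 8 * rolling_mean m (w n) (\<lambda>t. d t x) (t - int (L n)) + 4 * d t x"
  define D where "D x = real CARD('k) * (1 / (real n - real m) * (\<Sum>t\<in>?I. ?D1 t x))" for x
  have irm: "integrable M (\<lambda>x. rolling_mean m (w n) (\<lambda>t. d t x) (t - int (L n)))" if "t \<in> ?I" for t
    unfolding rolling_mean_def real_scaleR_def using that
    by (intro integrable_mult_right Bochner_Integration.integrable_sum id) auto
  have erm: "expectation (\<lambda>x. rolling_mean m (w n) (\<lambda>t. d t x) (t - int (L n))) \<le> ?E" if t: "t \<in> ?I" for t
  proof -
    have "expectation (\<lambda>x. rolling_mean m (w n) (\<lambda>t. d t x) (t - int (L n))) =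
       rolling_mean m (w n) (\<lambda>t. expectation (d t)) (t - int (L n))"
      unfolding rolling_mean_def real_scaleR_def using t
      by (subst integral_mult_right_zero, subst Bochner_Integration.integral_sum) (auto intro!: id)
    also have "\<dots> \<le> rolling_mean m (w n) (\<lambda>t. ?E) (t - int (L n))"
      using t by (intro rolling_mean_mono d(3)) auto
    also have "\<dots> = ?E" using t \<tau> by (intro rolling_mean_const) auto
    finally show ?thesis .
  qed
  have inI: "t \<in> ?R" if "t \<in> ?I" for t using that \<tau> by auto
  have iD1: "integrable M (?D1 t)" if "t \<in> ?I" for t
    by (intro Bochner_Integration.integrable_add integrable_mult_right irm id inI that)
  have eD1: "expectation (?D1 t) \<le> 12 * ?E" if "t \<in> ?I" for t
    using erm[OF that] d(3)[OF inI[OF that]] irm[OF that] id[OF inI[OF that]] by simp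
  have iD: "integrable M D"
    unfolding D_def[abs_def] by (intro integrable_mult_right Bochner_Integration.integrable_sum iD1)
  have D0: "0 \<le> D x" for x
    unfolding D_def
  proof (intro mult_nonneg_nonneg sum_nonneg add_nonneg_nonneg)
    fix t assume t: "t \<in> ?I"
    have "rolling_mean m (w n) (\<lambda>_. 0) (t - int (L n)) \<le> rolling_mean m (w n) (\<lambda>t. d t x) (t - int (L n))"
      using t d(2) by (intro rolling_mean_mono) auto
    then show "0 \<le> rolling_mean m (w n) (\<lambda>t. d t x) (t - int (L n))" by (simp add: rolling_mean_def)
  qed (use n d(2) inI in auto)
  have "expectation D = real CARD('k) * (1 / (real n - real m) * (\<Sum>t\<in>?I. expectation (?D1 t)))"
    unfolding D_def
    by (subst integral_mult_right_zero, subst integral_mult_right_zero, subst Bochner_Integration.integral_sum) (auto intro: iD1)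
  also have "\<dots> \<le> real CARD('k) * (1 / (real n - real m) * (\<Sum>t\<in>?I. 12 * ?E))"
    using n by (intro mult_left_mono sum_mono eD1) auto
  also have "\<dots> \<le> real CARD('k) * (12 * ?E)"
  proof (intro mult_left_mono)
    have "real (card ?I) \<le> real n - real m" using \<tau> n by auto
    then have "real (card ?I) * (12 * ?E) \<le> (real n - real m) * (12 * ?E)"
      using B \<eta>0 by (intro mult_right_mono) auto
    then show "1 / (real n - real m) * (\<Sum>t\<in>?I. 12 * ?E) \<le> 12 * ?E"
      using n by (simp only: sum_constant) (simp add: divide_le_eq mult.commute)
  qed auto
  finally have "expectation D \<le> real CARD('k) * (12 * ?E)" .
  moreover have "\<bar>Q n \<theta> x - Q n \<theta>' x\<bar> \<le> D x" if "\<theta> \<in> \<Theta>" "\<theta>' \<in> \<Theta>" "norm (\<theta> - \<theta>') \<le> \<epsilon>" for x \<theta> \<theta>'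
  proof -
    have "\<bar>Q n \<theta> x - Q n \<theta>' x\<bar> \<le> (\<Sum>c\<in>(UNIV::'k set). 1 / (real n - real m) * (\<Sum>t\<in>?I. ?D1 t x))"
      unfolding Q_def sum_subtractf[symmetric]
      by (rule order_trans[OF sum_abs], intro sum_mono rw_crit_Lipschitz n \<tau> abs_Y_le d(4) that)
    then show ?thesis by (simp add: D_def)
  qed
  ultimately show ?thesis using iD D0 by blast
qed

lemma abs_h_diff_le:
  assumes t: "t \<in> {int m + 1..int n}" and \<epsilon>: "0 < \<epsilon>"
    and \<theta>: "\<theta> \<in> \<Theta>" "\<theta>' \<in> \<Theta>" "norm (\<theta> - \<theta>') \<le> \<epsilon>"
  shows "\<bar>h c n \<theta> t - h c n \<theta>' t\<bar> \<le> 2 * (B * (real m + 1) * \<eta> \<epsilon>)"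
proof -
  have n1: "1 \<le> n" using t by auto
  have \<eta>0: "0 \<le> \<eta> \<epsilon>" using G_equi[OF n1 _ _ \<epsilon>, of 0 0] by simp
  have "\<bar>\<Phi> c n r (real_of_int t / real n) \<theta> - \<Phi> c n r (real_of_int t / real n) \<theta>'\<bar> \<le> B * (real m + 1) * \<eta> \<epsilon>" if r: "r \<le> s" for r
    unfolding \<Phi>_def
  proof (rule integral_feat_diff_le_const)
    obtain g where g: "(\<integral>\<^sup>+y. g y \<partial>N) \<le> ennreal (\<eta> \<epsilon>)"
      "\<And>y. ennreal (norm (G n r (real_of_int t / real n) y \<theta> - G n r (real_of_int t / real n) y \<theta>')) \<le> g y"
      using G_equi[OF n1 r time_in[OF t] \<epsilon>] \<theta> by blast
    show "(\<integral>\<^sup>+y. ennreal (norm (G n r (real_of_int t / real n) y \<theta> - G n r (real_of_int t / real n) y \<theta>')) \<partial>N) \<le> ennreal (\<eta> \<epsilon>)"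
      by (rule order_trans[OF nn_integral_mono g(1)]) (rule g(2))
  qed (use n1 r time_in[OF t] \<theta> \<eta>0 in \<open>auto intro!: G_meas\<close>)
  then show ?thesis unfolding h_def diff_avg_diff using B \<eta>0 by (intro abs_diff_avg_le) auto
qed

lemma \<Phi>_lim:
  assumes \<delta>: "0 < \<delta>"
  shows "\<forall>\<^sub>F i in sequentially. \<forall>c r u \<theta>. r \<le> s \<longrightarrow> u \<in> {0..1} \<longrightarrow> \<theta> \<in> \<Theta> \<longrightarrow> \<bar>\<Phi> c i r u \<theta> - \<Phi>lim c u \<theta>\<bar> \<le> \<delta>"
proof -
  have "(\<lambda>i. B * (real m + 1) * e i) \<longlonglongrightarrow> 0" by (intro tendsto_mult_right_zero e_lim)
  then have "\<forall>\<^sub>F i in sequentially. B * (real m + 1) * e i < \<delta>" using \<delta> by (rule order_tendstoD)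
  then show ?thesis using G_lim eventually_ge_at_top[of 1]
  proof eventually_elim
    case (elim i)
    show ?case
    proof (intro allI impI)
      fix c r u \<theta> assume a: "r \<le> s" "u \<in> {0..1::real}" "\<theta> \<in> \<Theta>"
      have "\<bar>\<Phi> c i r u \<theta> - \<Phi>lim c u \<theta>\<bar> \<le> B * (real m + 1) * e i"
        unfolding \<Phi>_def \<Phi>lim_def
        using a elim by (intro integral_feat_diff_le_const G_meas Glim_meas) auto
      then show "\<bar>\<Phi> c i r u \<theta> - \<Phi>lim c u \<theta>\<bar> \<le> \<delta>" using elim by simp
    qed
  qed
qed

lemma h_lim:
  assumes \<delta>: "0 < \<delta>"
  shows "\<forall>\<^sub>F n in sequentially. \<forall>c. \<forall>\<theta>\<in>\<Theta>. \<forall>t\<in>{int m + 1..int n}.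
    \<bar>h c n \<theta> t - (\<Phi>lim c (real_of_int t / real n) \<theta>0 - \<Phi>lim c (real_of_int t / real n) \<theta>)\<bar> \<le> \<delta>"
proof -
  have "0 < \<delta> / 2" using \<delta> by simp
  from \<Phi>_lim[OF this] show ?thesis
  proof eventually_elim
    case (elim n)
    show ?case
    proof (intro allI ballI)
      fix c \<theta> t assume \<theta>: "\<theta> \<in> \<Theta>" and t: "t \<in> {int m + 1..int n}"
      let ?u = "real_of_int t / real n"
      \<comment> \<open>The limit map is the same for every r, so it may be written as an average
        over r and compared term by term.\<close>
      have "\<Phi>lim c ?u \<theta>0 - \<Phi>lim c ?u \<theta> = \<Phi>lim c ?u \<theta>0 - 1 / real s * (\<Sum>r=1..s. \<Phi>lim c ?u \<theta>)" using s by simp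
      then have "\<bar>h c n \<theta> t - (\<Phi>lim c ?u \<theta>0 - \<Phi>lim c ?u \<theta>)\<bar> \<le> 2 * (\<delta> / 2)"
        unfolding h_def using elim \<theta> \<theta>0 time_in[OF t]
        by (simp only: diff_avg_diff) (intro abs_diff_avg_le, auto)
      then show "\<bar>h c n \<theta> t - (\<Phi>lim c ?u \<theta>0 - \<Phi>lim c ?u \<theta>)\<bar> \<le> \<delta>" by simp
    qed
  qed
qed

end

text \<open>A neighbourhood of v meets the unit interval in an interval of positive length and hence
  receives a fixed fraction of the times t/n. This turns a lower bound near one time into a lower
  bound for the time average.\<close>

lemma grid_points_near:
  fixes v d :: real
  assumes "v \<in> {0..1}" "0 < d"
  shows "\<exists>a>0. \<forall>\<^sub>F n in sequentially. a * real n \<le> real (card {t\<in>{int m + 1..int n}. \<bar>real_of_int t / real n - v\<bar> < d})"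
proof -
  \<comment> \<open>The neighbourhood of half the radius, clipped to the unit interval; it has
    positive length even if v is an endpoint.\<close>
  define a where "a = max 0 (v - d / 2)"
  define b where "b = min 1 (v + d / 2)"
  have ab: "a < b" "0 \<le> a" "b \<le> 1" "v - d < a" "b < v + d" using assms by (auto simp: a_def b_def)
  \<comment> \<open>Rounding at both ends and the skipped m times cost fewer than m + 3 points,
    which half of the length absorbs for large n.\<close>
  have "\<forall>\<^sub>F n in sequentially. real m + 3 < (b - a) / 2 * real n"
    using ab by (intro filterlim_at_top_dense[THEN iffD1, rule_format] filterlim_tendsto_pos_mult_at_top[OF tendsto_const]
      filterlim_real_sequentially) auto
  then have "\<forall>\<^sub>F n in sequentially. (b - a) / 2 * real n \<le> real (card {t\<in>{int m + 1..int n}. \<bar>real_of_int t / real n - v\<bar> < d})"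
    using eventually_gt_at_top[of 0]
  proof eventually_elim
    case (elim n)
    let ?S = "{t\<in>{int m + 1..int n}. \<bar>real_of_int t / real n - v\<bar> < d}"
    let ?T = "{\<lceil>real n * a\<rceil> + int m + 1..\<lfloor>real n * b\<rfloor>}"
    have "?T \<subseteq> ?S"
    proof
      fix t assume t: "t \<in> ?T"
      have "real n * a \<le> real_of_int \<lceil>real n * a\<rceil>" by linarith
      also have "\<dots> \<le> real_of_int t" using t by auto
      finally have 1: "real n * a \<le> real_of_int t" .
      have "real_of_int t \<le> real_of_int \<lfloor>real n * b\<rfloor>" using t by auto
      also have "\<dots> \<le> real n * b" by linarith
      finally have 2: "real_of_int t \<le> real n * b" .
      have "real n * b \<le> real n * 1" using ab by (intro mult_left_mono) auto
      with 2 have "t \<le> int n" by simp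
      moreover have "0 \<le> real n * a" using ab by simp
      then have "0 \<le> \<lceil>real n * a\<rceil>" by linarith
      then have "int m + 1 \<le> t" using t unfolding atLeastAtMost_iff by linarith
      moreover have "a \<le> real_of_int t / real n" "real_of_int t / real n \<le> b"
        using 1 2 elim by (auto simp: field_simps)
      then have "\<bar>real_of_int t / real n - v\<bar> < d" using ab by auto
      ultimately show "t \<in> ?S" by auto
    qed
    then have "card ?T \<le> card ?S"
      by (intro card_mono finite_subset[of ?S "{int m + 1..int n}"]) auto
    moreover have "real n * (b - a) - real m - 3 \<le> real (card ?T)"
    proof -
      have "real_of_int (\<lfloor>real n * b\<rfloor> - \<lceil>real n * a\<rceil> - int m) \<le> real (card ?T)" by simp
      moreover have "real n * b - 1 < real_of_int \<lfloor>real n * b\<rfloor>" "real_of_int \<lceil>real n * a\<rceil> < real n * a + 1" by linarith+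
      ultimately show ?thesis by (simp add: algebra_simps)
    qed
    moreover have "(b - a) / 2 * real n = real n * (b - a) - (b - a) / 2 * real n" by (simp add: field_simps)
    ultimately show ?case using elim by linarith
  qed
  moreover have "0 < (b - a) / 2" using ab by simp
  ultimately show ?thesis by blast
qed

section \<open>Separation of the true parameter and the minimum contrast argument\<close>

context rolling_window begin

lemma q_nonneg: "m < n \<Longrightarrow> 0 \<le> q n \<theta>"
  unfolding q_def by (intro sum_nonneg mult_nonneg_nonneg) auto

text \<open>Among the infinitely many times in the level set there is one at which the mean features at
  \<^term>\<open>\<theta>0\<close> and \<^term>\<open>\<theta>\<close> oscillate little.\<close>

lemma q_lower_local:
  assumes \<theta>: "\<theta> \<in> \<Theta>" and \<delta>: "0 < \<delta>"
    and inf: "infinite {u\<in>{0..1}. \<delta> \<le> \<bar>\<Phi>lim c u \<theta>0 - \<Phi>lim c u \<theta>\<bar>}"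
  shows "\<exists>a>0. \<exists>r>0. \<forall>\<^sub>F n in sequentially. \<forall>\<theta>'\<in>\<Theta>. norm (\<theta> - \<theta>') \<le> r \<longrightarrow> a \<le> q n \<theta>'"
proof -
  define F where "F u = \<Phi>lim c u \<theta>0 - \<Phi>lim c u \<theta>" for u
  have \<delta>16: "0 < \<delta> / 16" using \<delta> by simp
  \<comment> \<open>The variation bound belongs to the maps of finite index. One index i is fixed
    whose mean features are within \<open>\<delta>\<close>/16 of the limit, uniformly in time and
    parameter.\<close>
  obtain i where i: "1 \<le> i" and \<Phi>i: "\<And>u \<theta>. u \<in> {0..1} \<Longrightarrow> \<theta> \<in> \<Theta> \<Longrightarrow> \<bar>\<Phi> c i 0 u \<theta> - \<Phi>lim c u \<theta>\<bar> \<le> \<delta> / 16"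
    using eventually_happens[OF eventually_conj[OF \<Phi>_lim[OF \<delta>16] eventually_ge_at_top[of 1]]] by auto
  \<comment> \<open>Small enough that an \<open>L1\<close> oscillation below \<open>e0\<close> moves
    a mean feature by at most \<open>\<delta>\<close>/16; the added 1 keeps the denominator positive
    when B is 0.\<close>
  define e0 where "e0 = \<delta> / (16 * (B * (real m + 1) + 1))"
  have B1: "0 < B * (real m + 1) + 1" using B by (intro add_nonneg_pos mult_nonneg_nonneg) auto
  have e0: "0 < e0" using \<delta> B1 by (simp add: e0_def)
  have Be0: "B * (real m + 1) * e0 \<le> \<delta> / 16"
  proof -
    have "B * (real m + 1) * e0 \<le> (B * (real m + 1) + 1) * e0" using e0 by (intro mult_right_mono) auto
    also have "\<dots> = \<delta> / 16"
    proof -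
      have "b * (\<delta> / (16 * b)) = \<delta> / 16" if "0 < b" for b using that by simp
      from this[OF B1] show ?thesis by (simp only: e0_def)
    qed
    finally show ?thesis .
  qed
  have ex: "\<exists>d. bounded_kvar \<kappa> K d \<and> (\<forall>u\<in>{0..1}. \<forall>v\<in>{0..1}. \<bar>\<Phi> c i 0 u \<theta> - \<Phi> c i 0 v \<theta>\<bar> \<le> B * (real m + 1) * d u v)"
    if \<theta>: "\<theta> \<in> \<Theta>" for \<theta>
  proof -
    obtain d where d: "bounded_kvar \<kappa> K d"
      "\<And>u v. u \<in> {0..1} \<Longrightarrow> v \<in> {0..1} \<Longrightarrow> (\<integral>\<^sup>+y. ennreal (norm (G i 0 u y \<theta> - G i 0 v y \<theta>)) \<partial>N) \<le> ennreal (d u v)"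
      using G_kvar[OF i _ \<theta>, of 0] by auto
    have "\<bar>\<Phi> c i 0 u \<theta> - \<Phi> c i 0 v \<theta>\<bar> \<le> B * (real m + 1) * d u v" if "u \<in> {0..1}" "v \<in> {0..1}" for u v
      unfolding \<Phi>_def using that i \<theta>
      by (intro integral_feat_diff_le_const G_meas d(2) bounded_kvarD(2)[OF d(1)]) auto
    then show ?thesis using d(1) by blast
  qed
  obtain d0 where d0: "bounded_kvar \<kappa> K d0" "\<And>u v. u \<in> {0..1} \<Longrightarrow> v \<in> {0..1} \<Longrightarrow> \<bar>\<Phi> c i 0 u \<theta>0 - \<Phi> c i 0 v \<theta>0\<bar> \<le> B * (real m + 1) * d0 u v"
    using ex[OF \<theta>0] by blast
  obtain d1 where d1: "bounded_kvar \<kappa> K d1" "\<And>u v. u \<in> {0..1} \<Longrightarrow> v \<in> {0..1} \<Longrightarrow> \<bar>\<Phi> c i 0 u \<theta> - \<Phi> c i 0 v \<theta>\<bar> \<le> B * (real m + 1) * d1 u v"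
    using ex[OF \<theta>] by blast
  have \<kappa>: "0 < \<kappa>" using const by simp
  \<comment> \<open>Times with an oscillation of size \<open>e0\<close> in every neighbourhood, for
    the observed parameter and for \<open>\<theta>\<close>. Both sets are finite, so the infinite
    level set contains a time outside them.\<close>
  let ?bad = "\<lambda>d. {v \<in> {0..1}. \<forall>\<delta>>0. \<exists>u\<in>{0..1}. \<bar>u - v\<bar> < \<delta> \<and> e0 \<le> d u v}"
  have "finite (?bad d0 \<union> ?bad d1)"
    using bounded_kvar_finite_oscillation[OF d0(1) \<kappa> e0] bounded_kvar_finite_oscillation[OF d1(1) \<kappa> e0] by simp
  then have "infinite ({u\<in>{0..1}. \<delta> \<le> \<bar>F u\<bar>} - (?bad d0 \<union> ?bad d1))"
    using inf unfolding F_def by (rule Diff_infinite_finite)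
  then have "\<exists>v. v \<in> {u\<in>{0..1}. \<delta> \<le> \<bar>F u\<bar>} - (?bad d0 \<union> ?bad d1)"
    unfolding ex_in_conv by (rule infinite_imp_nonempty)
  then obtain v where vv: "v \<in> {u\<in>{0..1}. \<delta> \<le> \<bar>F u\<bar>} - (?bad d0 \<union> ?bad d1)" by (rule exE)
  have v: "v \<in> {0..1}" "\<delta> \<le> \<bar>F v\<bar>" using DiffD1[OF vv] by blast+
  have "v \<notin> ?bad d0 \<and> v \<notin> ?bad d1" using vv unfolding Diff_iff Un_iff de_Morgan_disj by (rule conjunct2)
  note v0 = conjunct1[OF this] conjunct2[OF this]
  obtain r0 where r0: "0 < r0" "\<And>u. u \<in> {0..1} \<Longrightarrow> \<bar>u - v\<bar> < r0 \<Longrightarrow> d0 u v < e0"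
    using v(1) v0(1) by (auto simp: not_le)
  obtain r1 where r1: "0 < r1" "\<And>u. u \<in> {0..1} \<Longrightarrow> \<bar>u - v\<bar> < r1 \<Longrightarrow> d1 u v < e0"
    using v(1) v0(2) by (auto simp: not_le)
  define d where "d = min r0 r1"
  have d: "0 < d" using r0 r1 by (simp add: d_def)
  \<comment> \<open>Six errors of \<open>\<delta>\<close>/16: four for passing between
    \<open>\<Phi>lim\<close> and index i at u and v for both parameters, and two for the oscillation
    between u and v.\<close>
  have near: "\<delta> - 6 * (\<delta> / 16) \<le> \<bar>F u\<bar>" if u: "u \<in> {0..1}" "\<bar>u - v\<bar> < d" for u
  proof -
    have "\<bar>\<Phi> c i 0 u \<theta>0 - \<Phi> c i 0 v \<theta>0\<bar> \<le> B * (real m + 1) * d0 u v" by (rule d0(2)[OF u(1) v(1)])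
    also have "\<dots> \<le> B * (real m + 1) * e0" using B r0(2)[of u] u by (intro mult_left_mono) (auto simp: d_def)
    finally have 1: "\<bar>\<Phi> c i 0 u \<theta>0 - \<Phi> c i 0 v \<theta>0\<bar> \<le> \<delta> / 16" using Be0 by linarith
    have "\<bar>\<Phi> c i 0 u \<theta> - \<Phi> c i 0 v \<theta>\<bar> \<le> B * (real m + 1) * d1 u v" by (rule d1(2)[OF u(1) v(1)])
    also have "\<dots> \<le> B * (real m + 1) * e0" using B r1(2)[of u] u by (intro mult_left_mono) (auto simp: d_def)
    finally have 2: "\<bar>\<Phi> c i 0 u \<theta> - \<Phi> c i 0 v \<theta>\<bar> \<le> \<delta> / 16" using Be0 by linarith
    show ?thesis
      using 1 2 v(2) \<Phi>i[OF u(1) \<theta>0] \<Phi>i[OF u(1) \<theta>] \<Phi>i[OF v(1) \<theta>0] \<Phi>i[OF v(1) \<theta>] unfolding F_def by linarith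
  qed
  \<comment> \<open>The modulus does not involve n, so one radius r around \<open>\<theta>\<close>
    works for all large n.\<close>
  have "((\<lambda>\<epsilon>. 2 * (B * (real m + 1) * \<eta> \<epsilon>)) \<longlongrightarrow> 0) (at_right 0)"
    by (intro tendsto_mult_right_zero \<eta>_lim)
  then have "\<forall>\<^sub>F \<epsilon> in at_right 0. 2 * (B * (real m + 1) * \<eta> \<epsilon>) < \<delta> / 16" using \<delta>16 by (rule order_tendstoD)
  then obtain r where r: "0 < r" "2 * (B * (real m + 1) * \<eta> r) < \<delta> / 16"
    using eventually_happens[OF eventually_conj[OF _ eventually_at_right_less[of 0]]] trivial_limit_at_right_real by blast
  obtain a where a: "0 < a" "\<forall>\<^sub>F n in sequentially. a * real n \<le> real (card {t\<in>{int m + 1..int n}. \<bar>real_of_int t / real n - v\<bar> < d})"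
    using grid_points_near[OF v(1) d] by blast
  have "\<forall>\<^sub>F n in sequentially. \<forall>\<theta>'\<in>\<Theta>. norm (\<theta> - \<theta>') \<le> r \<longrightarrow> a * (\<delta> / 4)\<^sup>2 \<le> q n \<theta>'"
    using a(2) h_lim[OF \<delta>16] eventually_gt_at_top[of m]
  proof eventually_elim
    case (elim n)
    show ?case
    proof (intro ballI impI)
      fix \<theta>' assume \<theta>': "\<theta>' \<in> \<Theta>" "norm (\<theta> - \<theta>') \<le> r"
      let ?S = "{t\<in>{int m + 1..int n}. \<bar>real_of_int t / real n - v\<bar> < d}"
      have big: "(\<delta> / 4)\<^sup>2 \<le> (h c n \<theta>' t)\<^sup>2" if "t \<in> ?S" for t
      proof -
        have t: "t \<in> {int m + 1..int n}" "\<bar>real_of_int t / real n - v\<bar> < d" using that by auto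
        have "\<bar>h c n \<theta> t - F (real_of_int t / real n)\<bar> \<le> \<delta> / 16" using elim(2) \<theta> t unfolding F_def by blast
        moreover have "\<bar>h c n \<theta> t - h c n \<theta>' t\<bar> \<le> \<delta> / 16"
          using abs_h_diff_le[OF t(1) r(1) \<theta> \<theta>', of c] r(2) by linarith
        \<comment> \<open>Of the 10/16 left by \<open>near\<close>, the limit in n and the change of
          parameter take 1/16 each.\<close>
        ultimately have "\<delta> / 4 \<le> \<bar>h c n \<theta>' t\<bar>" using near[OF time_in[OF t(1)] t(2)] \<delta> by linarith
        then show ?thesis using \<delta> by (metis abs_le_square_iff abs_of_pos zero_less_divide_iff zero_less_numeral)
      qed
      have "a * (\<delta> / 4)\<^sup>2 \<le> 1 / real n * (real (card ?S) * (\<delta> / 4)\<^sup>2)"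
        using elim(1,3) mult_right_mono[OF elim(1), of "(\<delta> / 4)\<^sup>2"] by (simp add: field_simps)
      also have "\<dots> \<le> 1 / (real n - real m) * (\<Sum>t\<in>?S. (h c n \<theta>' t)\<^sup>2)"
      proof (intro mult_mono)
        have "real (card ?S) * (\<delta> / 4)\<^sup>2 = (\<Sum>t\<in>?S. (\<delta> / 4)\<^sup>2)" by simp
        also have "\<dots> \<le> (\<Sum>t\<in>?S. (h c n \<theta>' t)\<^sup>2)" by (intro sum_mono big)
        finally show "real (card ?S) * (\<delta> / 4)\<^sup>2 \<le> (\<Sum>t\<in>?S. (h c n \<theta>' t)\<^sup>2)" .
      qed (use elim(3) in \<open>auto intro!: divide_left_mono\<close>)
      also have "\<dots> \<le> 1 / (real n - real m) * (\<Sum>t\<in>{int m + 1..int n}. (h c n \<theta>' t)\<^sup>2)"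
        using elim(3) by (intro mult_left_mono sum_mono2) auto
      also have "\<dots> \<le> q n \<theta>'"
        unfolding q_def using elim(3) by (intro member_le_sum[of c UNIV "\<lambda>c. 1 / (real n - real m) * (\<Sum>t\<in>{int m + 1..int n}. (h c n \<theta>' t)\<^sup>2)"]) (auto intro!: divide_nonneg_nonneg sum_nonneg)
      finally show "a * (\<delta> / 4)\<^sup>2 \<le> q n \<theta>'" .
    qed
  qed
  moreover have "0 < a * (\<delta> / 4)\<^sup>2" using a \<delta> by simp
  ultimately show ?thesis using r(1) by blast
qed

lemma compact_far: "compact {\<theta>\<in>\<Theta>. \<delta> \<le> dist \<theta> \<theta>0}"
proof -
  have "{\<theta>\<in>\<Theta>. \<delta> \<le> dist \<theta> \<theta>0} = \<Theta> \<inter> - ball \<theta>0 \<delta>" by (auto simp: dist_commute)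
  then show ?thesis using compact_\<Theta> by (simp add: compact_Int_closed closed_Compl)
qed

text \<open>Finitely many of the neighbourhoods from \<open>q_lower_local\<close> cover the compact
  set of parameters at distance at least \<open>\<delta>\<close>, so the smallest of their levels
  works, for all large n simultaneously.\<close>

lemma q_lower:
  assumes pos: "\<And>\<theta>. \<theta> \<in> \<Theta> \<Longrightarrow> \<theta> \<noteq> \<theta>0 \<Longrightarrow> \<exists>c. \<exists>\<delta>>0. infinite {u\<in>{0..1}. \<delta> \<le> \<bar>\<Phi>lim c u \<theta>0 - \<Phi>lim c u \<theta>\<bar>}"
    and \<delta>: "0 < \<delta>"
  shows "\<exists>a>0. \<forall>\<^sub>F n in sequentially. \<forall>\<theta>\<in>\<Theta>. \<delta> \<le> dist \<theta> \<theta>0 \<longrightarrow> a \<le> q n \<theta>"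
proof -
  define C where "C = {\<theta>\<in>\<Theta>. \<delta> \<le> dist \<theta> \<theta>0}"
  have "compact C" unfolding C_def by (rule compact_far)
  define P where "P \<theta> a r \<longleftrightarrow> 0 < a \<and> 0 < r \<and> (\<forall>\<^sub>F n in sequentially. \<forall>\<theta>'\<in>\<Theta>. norm (\<theta> - \<theta>') \<le> r \<longrightarrow> a \<le> q n \<theta>')" for \<theta> a r
  have "\<exists>a r. P \<theta> a r" if "\<theta> \<in> C" for \<theta>
  proof -
    have \<theta>: "\<theta> \<in> \<Theta>" "\<theta> \<noteq> \<theta>0" using \<delta> that by (auto simp: C_def)
    then obtain c \<delta>' where "0 < \<delta>'" "infinite {u\<in>{0..1}. \<delta>' \<le> \<bar>\<Phi>lim c u \<theta>0 - \<Phi>lim c u \<theta>\<bar>}"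
      using pos by blast
    from q_lower_local[OF \<theta>(1) this] show ?thesis unfolding P_def by blast
  qed
  then obtain a r where "\<And>\<theta>. \<theta> \<in> C \<Longrightarrow> P \<theta> (a \<theta>) (r \<theta>)" by metis
  then have ar: "\<And>\<theta>. \<theta> \<in> C \<Longrightarrow> 0 < a \<theta>" "\<And>\<theta>. \<theta> \<in> C \<Longrightarrow> 0 < r \<theta>"
    "\<And>\<theta>. \<theta> \<in> C \<Longrightarrow> \<forall>\<^sub>F n in sequentially. \<forall>\<theta>'\<in>\<Theta>. norm (\<theta> - \<theta>') \<le> r \<theta> \<longrightarrow> a \<theta> \<le> q n \<theta>'"
    unfolding P_def by blast+
  have "C \<subseteq> (\<Union>\<theta>\<in>C. ball \<theta> (r \<theta>))" using ar(2) by auto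
  from compactE_image[OF \<open>compact C\<close> _ this]
  obtain S where S: "S \<subseteq> C" "finite S" "C \<subseteq> (\<Union>\<theta>\<in>S. ball \<theta> (r \<theta>))" by blast
  \<comment> \<open>The inserted 1 provides a value when the set to be covered is empty.\<close>
  define a0 where "a0 = Min (insert 1 (a ` S))"
  have "0 < a0" unfolding a0_def using S ar(1) by (subst Min_gr_iff) auto
  moreover have "\<forall>\<^sub>F n in sequentially. \<forall>\<theta>\<in>S. \<forall>\<theta>'\<in>\<Theta>. norm (\<theta> - \<theta>') \<le> r \<theta> \<longrightarrow> a \<theta> \<le> q n \<theta>'"
    using S ar(3) by (intro eventually_ball_finite) auto
  then have "\<forall>\<^sub>F n in sequentially. \<forall>\<theta>\<in>\<Theta>. \<delta> \<le> dist \<theta> \<theta>0 \<longrightarrow> a0 \<le> q n \<theta>"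
  proof eventually_elim
    case (elim n)
    show ?case
    proof (intro ballI impI)
      fix \<theta>' assume \<theta>': "\<theta>' \<in> \<Theta>" "\<delta> \<le> dist \<theta>' \<theta>0"
      then have "\<theta>' \<in> C" by (simp add: C_def)
      then obtain \<theta> where \<theta>: "\<theta> \<in> S" "\<theta>' \<in> ball \<theta> (r \<theta>)" using S(3) by blast
      have "a0 \<le> a \<theta>" unfolding a0_def using S \<theta> by (intro Min_le) auto
      also have "a \<theta> \<le> q n \<theta>'" using elim \<theta> \<theta>' by (auto simp: dist_norm)
      finally show "a0 \<le> q n \<theta>'" .
    qed
  qed
  ultimately show ?thesis by blast
qed

text \<open>For finite n the observed and simulated maps may differ even at
  \<open>\<theta>0\<close>, but they share one limit, so \<open>h\<close> tends to 0 uniformly in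
  time.\<close>

lemma q_\<theta>0_lim: "(\<lambda>n. q n \<theta>0) \<longlonglongrightarrow> 0"
proof (rule LIMSEQ_I)
  fix r :: real assume r: "0 < r"
  define \<delta> where "\<delta> = sqrt (r / (2 * real CARD('k)))"
  have \<delta>: "0 < \<delta>" "\<delta>\<^sup>2 * real CARD('k) = r / 2" using r by (auto simp: \<delta>_def)
  have "\<forall>\<^sub>F n in sequentially. norm (q n \<theta>0 - 0) < r"
    using h_lim[OF \<delta>(1)] eventually_gt_at_top[of m]
  proof eventually_elim
    case (elim n)
    have "(\<Sum>t\<in>{int m + 1..int n}. (h c n \<theta>0 t)\<^sup>2) \<le> (real n - real m) * \<delta>\<^sup>2" for c
    proof -
      have "(\<Sum>t\<in>{int m + 1..int n}. (h c n \<theta>0 t)\<^sup>2) \<le> (\<Sum>t\<in>{int m + 1..int n}. \<delta>\<^sup>2)"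
      proof (rule sum_mono)
        fix t assume "t \<in> {int m + 1..int n}"
        then have "\<bar>h c n \<theta>0 t\<bar> \<le> \<delta>" using elim(1) \<theta>0 by (metis diff_self diff_zero)
        then show "(h c n \<theta>0 t)\<^sup>2 \<le> \<delta>\<^sup>2" using \<delta>(1) by (metis abs_le_square_iff abs_of_pos)
      qed
      also have "\<dots> = (real n - real m) * \<delta>\<^sup>2" using elim(2) by (simp add: of_nat_diff)
      finally show ?thesis .
    qed
    then have "q n \<theta>0 \<le> (\<Sum>c\<in>(UNIV::'k set). \<delta>\<^sup>2)"
      unfolding q_def using elim(2) by (intro sum_mono) (simp add: divide_le_eq mult.commute)
    also have "\<dots> = r / 2" using \<delta>(2) by (simp add: mult.commute)
    finally show ?case using q_nonneg[OF elim(2), of \<theta>0] r by simp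
  qed
  then show "\<exists>no. \<forall>n\<ge>no. norm (q n \<theta>0 - 0) < r" by (simp add: eventually_sequentially)
qed

text \<open>An estimate far from \<open>\<theta>0\<close> lies near a point of a finite net. The
  criterion there exceeds its value at \<open>\<theta>0\<close> by a fixed amount unless one of
  finitely many random errors or the remainder \<open>R\<close> is large.\<close>

lemma consistency:
  assumes pos: "\<And>\<theta>. \<theta> \<in> \<Theta> \<Longrightarrow> \<theta> \<noteq> \<theta>0 \<Longrightarrow> \<exists>c. \<exists>\<delta>>0. infinite {u\<in>{0..1}. \<delta> \<le> \<bar>\<Phi>lim c u \<theta>0 - \<Phi>lim c u \<theta>\<bar>}"
    and est: "\<And>n. m < n \<Longrightarrow> \<theta>hat n \<in> measurable M (restrict_space borel \<Theta>)"
    and R: "\<And>n. R n \<in> borel_measurable M" "tendsto_in_prob M R 0"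
    and min: "\<And>n. m < n \<Longrightarrow> AE x in M. \<bar>Q n (\<theta>hat n x) x\<bar> \<le> (INF \<theta>\<in>\<Theta>. \<bar>Q n \<theta> x\<bar>) + R n x"
  shows "tendsto_in_prob M \<theta>hat \<theta>0"
  unfolding tendsto_in_prob_def
proof (intro allI impI)
  fix \<delta> :: real assume \<delta>: "0 < \<delta>"
  obtain a where a: "0 < a" "\<forall>\<^sub>F n in sequentially. \<forall>\<theta>\<in>\<Theta>. \<delta> \<le> dist \<theta> \<theta>0 \<longrightarrow> a \<le> q n \<theta>"
    using q_lower[OF pos \<delta>] by blast
  define C where "C = {\<theta>\<in>\<Theta>. \<delta> \<le> dist \<theta> \<theta>0}"
  show "(\<lambda>n. prob {x \<in> space M. dist (\<theta>hat n x) \<theta>0 > \<delta>}) \<longlonglongrightarrow> 0"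
  proof (rule LIMSEQ_I)
    fix \<zeta> :: real assume \<zeta>: "0 < \<zeta>"
    \<comment> \<open>The mesh \<open>\<epsilon>\<close> of the net is fixed before n. The factor 2
      / a comes from Markov's inequality at the level a / 2; the remainder, the approximation at the
      net and the modulus receive a third of \<open>\<zeta>\<close> each.\<close>
    have "((\<lambda>\<epsilon>. 2 / a * (real CARD('k) * (12 * (B * (real m + 1) * \<eta> \<epsilon>)))) \<longlongrightarrow> 0) (at_right 0)"
      by (intro tendsto_mult_right_zero \<eta>_lim)
    then have "\<forall>\<^sub>F \<epsilon> in at_right 0. 2 / a * (real CARD('k) * (12 * (B * (real m + 1) * \<eta> \<epsilon>))) < \<zeta> / 3"
      using \<zeta> by (intro order_tendstoD) auto
    then obtain \<epsilon> where \<epsilon>: "0 < \<epsilon>" "2 / a * (real CARD('k) * (12 * (B * (real m + 1) * \<eta> \<epsilon>))) < \<zeta> / 3"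
      using eventually_happens[OF eventually_conj[OF _ eventually_at_right_less[of 0]]] trivial_limit_at_right_real by blast
    have "C \<subseteq> (\<Union>\<theta>\<in>C. ball \<theta> \<epsilon>)" using \<epsilon> by auto
    from compactE_image[OF compact_far _ this[unfolded C_def], folded C_def]
    obtain S where S: "S \<subseteq> C" "finite S" "C \<subseteq> (\<Union>\<theta>\<in>S. ball \<theta> \<epsilon>)" by blast
    have S\<Theta>: "S \<subseteq> \<Theta>" using S(1) by (auto simp: C_def)
    have "(\<lambda>n. prob {x\<in>space M. dist (R n x) 0 > a / 8}) \<longlonglongrightarrow> 0"
      using a(1) by (intro R(2)[unfolded tendsto_in_prob_def, rule_format]) simp
    then have evR: "\<forall>\<^sub>F n in sequentially. prob {x\<in>space M. dist (R n x) 0 > a / 8} < \<zeta> / 3"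
      using \<zeta> by (intro order_tendstoD) auto
    have "(\<lambda>n. 2 / a * ((1 + real (card S)) * (real CARD('k) * \<gamma> n))) \<longlonglongrightarrow> 0"
      by (intro tendsto_mult_right_zero \<gamma>_lim)
    then have evG: "\<forall>\<^sub>F n in sequentially. 2 / a * ((1 + real (card S)) * (real CARD('k) * \<gamma> n)) < \<zeta> / 3"
      using \<zeta> by (intro order_tendstoD) auto
    have evq: "\<forall>\<^sub>F n in sequentially. q n \<theta>0 < a / 4"
      using a(1) by (intro order_tendstoD[OF q_\<theta>0_lim]) auto
    have "\<forall>\<^sub>F n in sequentially. norm (prob {x \<in> space M. dist (\<theta>hat n x) \<theta>0 > \<delta>} - 0) < \<zeta>"
      using a(2) evR evG evq eventually_gt_at_top[of m]
    proof eventually_elim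
      case (elim n)
      note n = \<open>m < n\<close>
      obtain D where D: "integrable M D" "\<And>x. x \<in> space M \<Longrightarrow> 0 \<le> D x" "expectation D \<le> real CARD('k) * (12 * (B * (real m + 1) * \<eta> \<epsilon>))"
        "\<And>x \<theta> \<theta>'. \<theta> \<in> \<Theta> \<Longrightarrow> \<theta>' \<in> \<Theta> \<Longrightarrow> norm (\<theta> - \<theta>') \<le> \<epsilon> \<Longrightarrow> \<bar>Q n \<theta> x - Q n \<theta>' x\<bar> \<le> D x"
        using Q_modulus[OF n \<epsilon>(1)] by blast
      \<comment> \<open>All random errors at once: at \<open>\<theta>0\<close>, at the net points,
        and between the estimate and its net point.\<close>
      define W where "W x = (\<bar>Q n \<theta>0 x - q n \<theta>0\<bar> + (\<Sum>\<theta>\<in>S. \<bar>Q n \<theta> x - q n \<theta>\<bar>)) + D x" for x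
      have iS: "integrable M (\<lambda>x. \<Sum>\<theta>\<in>S. \<bar>Q n \<theta> x - q n \<theta>\<bar>)"
        using S\<Theta> by (intro Bochner_Integration.integrable_sum Q_approx_integrable n) auto
      have iW: "integrable M W"
        unfolding W_def[abs_def] by (intro Bochner_Integration.integrable_add iS D(1) Q_approx_integrable n \<theta>0)
      have "expectation W = expectation (\<lambda>x. \<bar>Q n \<theta>0 x - q n \<theta>0\<bar>) + (\<Sum>\<theta>\<in>S. expectation (\<lambda>x. \<bar>Q n \<theta> x - q n \<theta>\<bar>)) + expectation D"
        unfolding W_def using S\<Theta> iS D(1) Q_approx_integrable[OF n \<theta>0] Q_approx_integrable[OF n]
        by (subst Bochner_Integration.integral_add; (subst Bochner_Integration.integral_add)?;
            (subst Bochner_Integration.integral_sum)?) auto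
      also have "\<dots> \<le> real CARD('k) * \<gamma> n + (\<Sum>\<theta>\<in>S. real CARD('k) * \<gamma> n) + real CARD('k) * (12 * (B * (real m + 1) * \<eta> \<epsilon>))"
        using S\<Theta> by (intro add_mono sum_mono expectation_Q_approx n \<theta>0 D(3)) auto
      also have "\<dots> = (1 + real (card S)) * (real CARD('k) * \<gamma> n) + real CARD('k) * (12 * (B * (real m + 1) * \<eta> \<epsilon>))"
        by (simp add: algebra_simps)
      finally have "2 / a * expectation W \<le> 2 / a * ((1 + real (card S)) * (real CARD('k) * \<gamma> n) + real CARD('k) * (12 * (B * (real m + 1) * \<eta> \<epsilon>)))"
        using a(1) by (intro mult_left_mono) auto
      then have EW: "2 / a * expectation W < \<zeta> / 3 + \<zeta> / 3" using elim(3) \<epsilon>(2) unfolding distrib_left by linarith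
      have W0: "0 \<le> W x" if "x \<in> space M" for x unfolding W_def using D(2)[OF that] by (auto intro!: add_nonneg_nonneg sum_nonneg)
      have Wm: "W \<in> borel_measurable M" using iW by auto
      have "prob {x\<in>space M. a / 2 \<le> W x} \<le> expectation W / (a / 2)"
        using a(1) W0 by (intro integral_Markov_inequality_measure[OF iW, where A="{}"]) auto
      also have "\<dots> = 2 / a * expectation W" by simp
      also note EW
      finally have PW: "prob {x\<in>space M. a / 2 \<le> W x} < \<zeta> / 3 + \<zeta> / 3" .
      note [measurable] = Wm R(1)
      let ?U = "{x\<in>space M. a / 2 \<le> W x} \<union> {x\<in>space M. dist (R n x) 0 > a / 8}"
      have "AE x in M. x \<in> {x \<in> space M. dist (\<theta>hat n x) \<theta>0 > \<delta>} \<longrightarrow> x \<in> ?U"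
        using min[OF n]
      proof (eventually_elim, intro impI)
        fix x assume x: "\<bar>Q n (\<theta>hat n x) x\<bar> \<le> (INF \<theta>\<in>\<Theta>. \<bar>Q n \<theta> x\<bar>) + R n x"
          and xd: "x \<in> {x \<in> space M. dist (\<theta>hat n x) \<theta>0 > \<delta>}"
        have \<theta>: "\<theta>hat n x \<in> \<Theta>" using measurable_space[OF est[OF n], of x] xd by (auto simp: space_restrict_space)
        have "(INF \<theta>\<in>\<Theta>. \<bar>Q n \<theta> x\<bar>) \<le> \<bar>Q n \<theta>0 x\<bar>"
          by (intro cINF_lower \<theta>0 bdd_belowI[where m=0]) auto
        then have 1: "\<bar>Q n (\<theta>hat n x) x\<bar> \<le> \<bar>Q n \<theta>0 x\<bar> + R n x" using x by linarith
        have "\<theta>hat n x \<in> C" using \<theta> xd by (simp add: C_def)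
        then obtain \<theta> where \<theta>S: "\<theta> \<in> S" "\<theta>hat n x \<in> ball \<theta> \<epsilon>" using S(3) by blast
        have 2: "\<bar>Q n \<theta> x - Q n (\<theta>hat n x) x\<bar> \<le> D x"
          using \<theta>S S\<Theta> \<theta> by (intro D(4)) (auto simp: dist_norm)
        have 3: "\<bar>Q n \<theta> x - q n \<theta>\<bar> \<le> (\<Sum>\<theta>\<in>S. \<bar>Q n \<theta> x - q n \<theta>\<bar>)"
          using \<theta>S S(2) by (intro member_le_sum[of \<theta> S "\<lambda>\<theta>. \<bar>Q n \<theta> x - q n \<theta>\<bar>"]) auto
        have 4: "a \<le> q n \<theta>" using elim(1) \<theta>S S(1) S\<Theta> by (auto simp: C_def)
        have 5: "q n \<theta>0 < a / 4" by (rule elim(4))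
        have 6: "0 \<le> q n \<theta>0" by (rule q_nonneg[OF n])
        \<comment> \<open>The chain from the net point to the estimate and on to
          \<open>\<theta>0\<close> bounds a by \<open>W x\<close> plus a/4 for \<open>q\<close> at
          \<open>\<theta>0\<close> and a/8 for the remainder, leaving at least 5a/8.\<close>
        have "a / 2 \<le> W x" if "R n x \<le> a / 8"
          using 1 2 3 4 5 6 that a(1) unfolding W_def by linarith
        moreover have "x \<in> space M" using xd by simp
        ultimately show "x \<in> ?U" by (auto simp: dist_real_def)
      qed
      then have "prob {x \<in> space M. dist (\<theta>hat n x) \<theta>0 > \<delta>} \<le> prob ?U"
        by (rule finite_measure_mono_AE) measurable
      also have "\<dots> \<le> prob {x\<in>space M. a / 2 \<le> W x} + prob {x\<in>space M. dist (R n x) 0 > a / 8}"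
        by (rule measure_Un_le) measurable
      also have "\<dots> < \<zeta>" using PW elim(2) by linarith
      finally show ?case by simp
    qed
    then show "\<exists>no. \<forall>n\<ge>no. norm (prob {x \<in> space M. dist (\<theta>hat n x) \<theta>0 > \<delta>} - 0) < \<zeta>"
      by (simp add: eventually_sequentially)
  qed
qed

end

subsection \<open>Transfer to the noise sequences\<close>

definition noise_var ::
    "(int \<Rightarrow> 'w \<Rightarrow> real) \<Rightarrow> (int \<Rightarrow> 'w \<Rightarrow> real) \<Rightarrow> (nat \<Rightarrow> int \<Rightarrow> 'w \<Rightarrow> real) \<Rightarrow> noise_index \<Rightarrow> 'w \<Rightarrow> real" where
  "noise_var eps epsst epsc x = (case x of Base i \<Rightarrow> eps i | Star i \<Rightarrow> epsst i | Copy r i \<Rightarrow> epsc r i)"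

definition noise_indices :: "nat \<Rightarrow> noise_index set" where
  "noise_indices s = range Base \<union> range Star \<union> {Copy r i |r i. r \<le> s}"

locale iid_noise_space = prob_space M for M :: "'w measure" +
  fixes s :: nat and eps epsst :: "int \<Rightarrow> 'w \<Rightarrow> real" and epsc :: "nat \<Rightarrow> int \<Rightarrow> 'w \<Rightarrow> real"
  assumes noise: "iid_noise M s eps epsst epsc"
begin

abbreviation "\<xi> \<equiv> noise_var eps epsst epsc"
abbreviation "\<nu> \<equiv> distr M borel (eps 0)"
abbreviation "N \<equiv> noise_law M eps"

lemma indep: "indep_vars (\<lambda>_. borel) \<xi> (noise_indices s)"
  and distr_noise: "i \<in> noise_indices s \<Longrightarrow> distr M borel (\<xi> i) = \<nu>"
  using noise unfolding iid_noise_def Let_def noise_var_def[abs_def] noise_indices_def by blast+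

lemma past_eq:
  "past eps t x = (\<lambda>l. \<xi> (Base (t - int l)) x)"
  "past epsst t x = (\<lambda>l. \<xi> (Star (t - int l)) x)"
  "past (epsc r) t x = (\<lambda>l. \<xi> (Copy r (t - int l)) x)"
  by (simp_all add: past_def noise_var_def)

lemma N_eq: "N = PiM UNIV (\<lambda>_. \<nu>)"
  unfolding noise_law_def past_eq
  by (rule distr_iid_inj[OF indep distr_noise]) (auto simp: noise_indices_def intro!: injI)

lemma past_law:
  "distr M Rinf (past eps t) = N"
  "r \<le> s \<Longrightarrow> distr M Rinf (past (epsc r) t) = N"
  unfolding N_eq past_eq
  by (rule distr_iid_inj[OF indep distr_noise]; auto simp: noise_indices_def intro!: injI)+

lemma measurable_noise_seq:
  assumes "\<And>l. f l \<in> noise_indices s"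
  shows "(\<lambda>x l. \<xi> (f l) x) \<in> measurable M Rinf"
  using assms indep by (intro measurable_PiM_single') (auto simp: space_PiM indep_vars_def)

lemma measurable_past:
  "past eps t \<in> measurable M Rinf" "past epsst t \<in> measurable M Rinf"
  "r \<le> s \<Longrightarrow> past (epsc r) t \<in> measurable M Rinf"
  unfolding past_eq by (intro measurable_noise_seq; auto simp: noise_indices_def)+

lemma sets_N: "sets N = sets Rinf" by (simp add: noise_law_def)

lemma prob_space_N: "prob_space N"
  unfolding noise_law_def by (rule prob_space_distr[OF measurable_past(1)])

lemma shift_law: "distr N Rinf (shift_seq b) = N"
proof -
  have "distr N Rinf (shift_seq b) = distr M Rinf (shift_seq b \<circ> past eps 0)"
    unfolding noise_law_def by (rule distr_distr[OF measurable_shift_seq measurable_past(1)])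
  also have "shift_seq b \<circ> past eps 0 = past eps (- int b)"
    by (auto simp: fun_eq_iff shift_seq_def past_def intro!: arg_cong2[where f=eps])
  finally show ?thesis by (simp add: past_law)
qed

lemma nn_integral_past:
  assumes "f \<in> borel_measurable Rinf"
  shows "(\<integral>\<^sup>+x. f (past eps t x) \<partial>M) = (\<integral>\<^sup>+y. f y \<partial>N)"
  using assms unfolding past_law(1)[of t, symmetric] by (subst nn_integral_distr) (auto intro: measurable_past)

text \<open>The inserted value is the star variable at time -j, which is coordinate 0 of the star
  past at time -j. With this choice the pair of sequences has law N x N for every j.\<close>

lemma nn_integral_past_replaced:
  assumes [measurable]: "H \<in> borel_measurable Rinf"
  shows "(\<integral>\<^sup>+z. ennreal (norm (H (fst z) - H ((fst z)(j := snd z 0)) :: 'b::euclidean_space)) \<partial>(N \<Otimes>\<^sub>M N)) =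
    (\<integral>\<^sup>+x. ennreal (norm (H (past eps 0 x) - H (past_replaced eps epsst 0 j x))) \<partial>M)"
proof -
  have law: "distr M (Rinf \<Otimes>\<^sub>M Rinf) (\<lambda>x. (past eps 0 x, past epsst (- int j) x)) = N \<Otimes>\<^sub>M N"
    unfolding N_eq past_eq
    by (rule indep_iid_pair(2)[OF indep distr_noise]) (auto simp: noise_indices_def intro!: injI)
  have m: "(\<lambda>x. (past eps 0 x, past epsst (- int j) x)) \<in> measurable M (Rinf \<Otimes>\<^sub>M Rinf)"
    by (intro measurable_Pair measurable_past)
  have [measurable]: "(\<lambda>z. (fst z)(j := snd z 0)) \<in> measurable (Rinf \<Otimes>\<^sub>M Rinf) Rinf"
    by (intro measurable_PiM_single') (auto simp: space_PiM)
  have f: "(\<lambda>z. ennreal (norm (H (fst z) - H ((fst z)(j := snd z 0))))) \<in> borel_measurable (Rinf \<Otimes>\<^sub>M Rinf)"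
    by measurable
  have "(past eps 0 x)(j := past epsst (- int j) x 0) = past_replaced eps epsst 0 j x" for x
    by (auto simp: past_def past_replaced_def fun_eq_iff)
  then show ?thesis
    unfolding law[symmetric] by (subst nn_integral_distr[OF m]) (simp_all add: f)
qed

end

text \<open>The past that drives row a is the past at t shifted by m minus the number of the row, so
  the feature of the window is a function of the past at t alone.\<close>

lemma window_feature:
  fixes \<omega> :: "real^'d::finite^'m::finite"
  assumes "CARD('m) = m + 1"
  shows "feature m \<omega> \<alpha> (\<lambda>b. Z (t - int m + int b)) (past f t x) = cos (\<omega> \<bullet> window m (\<lambda>j. Z j (past f j x)) t + \<alpha>)"
proof -
  have "shift_seq (m - to_nat_on UNIV (a::'m)) (past f t x) = past f (t - int m + int (to_nat_on UNIV a)) x" for a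
    using to_nat_on_le[OF assms, of a]
    by (auto simp: shift_seq_def past_def fun_eq_iff of_nat_diff algebra_simps)
  then show ?thesis by (simp add: feature_def window_def)
qed

lemma borel_measurable_window:
  fixes Z :: "int \<Rightarrow> 'w \<Rightarrow> real^'d::finite"
  assumes "\<And>j. Z j \<in> borel_measurable M"
  shows "(\<lambda>x. window m (\<lambda>j. Z j x) t :: real^'d^'m::finite) \<in> borel_measurable M"
  unfolding borel_measurable_euclidean_space[where 'c="real^'d^'m"]
proof
  fix i :: "real^'d^'m"
  show "(\<lambda>x. window m (\<lambda>j. Z j x) t \<bullet> i) \<in> borel_measurable M"
    unfolding window_def inner_vec_def[where 'a="real^'d"] using assms by simp
qed

section \<open>Passage from measure and law hypotheses to the form used above\<close>

lemma measurable_fix_parameter: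
  assumes "(\<lambda>(x, \<theta>). H x \<theta>) \<in> borel_measurable (Rinf \<Otimes>\<^sub>M restrict_space borel \<Theta>)" "\<theta> \<in> \<Theta>"
  shows "(\<lambda>x. H x \<theta>) \<in> borel_measurable Rinf"
  using measurable_Pair1[OF assms(1), of \<theta>] assms(2) by (simp add: space_restrict_space)

text \<open>If only countably many points of U satisfied P, they would form a null set, and with
  them U would be null. Positive measure and an almost sure property are thereby combined into a
  statement about cardinality.\<close>

lemma uncountable_of_positive_measure:
  assumes U: "U \<in> sets lebesgue" "0 < emeasure lebesgue U" and AE: "AE u in lborel. P u"
  shows "uncountable {u\<in>U. P u}"
proof
  assume "countable {u\<in>U. P u}"
  then have "{u\<in>U. P u} \<in> null_sets lborel" by (rule countable_imp_null_set_lborel)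
  then have "AE u in lborel. u \<notin> {u\<in>U. P u}" by (rule AE_not_in)
  with AE have "AE u in lborel. u \<notin> U" by eventually_elim auto
  then have "AE u in lebesgue. u \<notin> U" by (rule AE_completion)
  then have "U \<in> null_sets lebesgue" using AE_iff_null_sets[OF U(1)] by blast
  then have "emeasure lebesgue U = 0" by (rule null_setsD1)
  with U(2) show False by (simp only: less_irrefl)
qed

text \<open>Otherwise V would be contained in a countable union of finite sets, taken over the
  features and the levels 1/(k+1).\<close>

lemma infinite_level_set:
  fixes f :: "'c::finite \<Rightarrow> real \<Rightarrow> real"
  assumes unc: "uncountable V" and V: "V \<subseteq> A" "\<And>u. u \<in> V \<Longrightarrow> \<exists>c. f c u \<noteq> 0"
  shows "\<exists>c. \<exists>\<delta>>0. infinite {u\<in>A. \<delta> \<le> \<bar>f c u\<bar>}"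
proof (rule ccontr)
  assume "\<not> ?thesis"
  then have fin: "finite {u\<in>A. \<delta> \<le> \<bar>f c u\<bar>}" if "0 < \<delta>" for c \<delta> using that by blast
  have sub: "V \<subseteq> (\<Union>c. \<Union>k. {u\<in>A. 1 / real (Suc k) \<le> \<bar>f c u\<bar>})"
  proof
    fix u assume u: "u \<in> V"
    then obtain c where "0 < \<bar>f c u\<bar>" using V(2) by auto
    then obtain k where "1 / real (Suc k) < \<bar>f c u\<bar>" using nat_approx_posE by blast
    then show "u \<in> (\<Union>c. \<Union>k. {u\<in>A. 1 / real (Suc k) \<le> \<bar>f c u\<bar>})"
      using u V(1) by (auto intro!: less_imp_le)
  qed
  have "countable (\<Union>c. \<Union>k. {u\<in>A. 1 / real (Suc k) \<le> \<bar>f c u\<bar>})"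
    by (intro countable_UN countable_finite[OF fin]) (auto intro: countable_finite)
  from countable_subset[OF sub this] unc show False by simp
qed

text \<open>A strict bound on the infimum defining the outer expectation supplies an actual
  measurable majorant g of the squared differences. With a = sqrt b, a norm x is at most a + x^2 /
  a, which integrates to 2 sqrt b.\<close>

lemma L1_modulus_of_outer_expectation:
  fixes H :: "'a \<Rightarrow> 'c \<Rightarrow> 'b::real_normed_vector"
  assumes R: "prob_space R" and b: "0 < b"
    and outer: "outer_expectation R (\<lambda>e. SUP (\<theta>, \<theta>') \<in> S. ennreal ((norm (H e \<theta> - H e \<theta>'))\<^sup>2)) < ennreal b"
  obtains g where "g \<in> borel_measurable R" "(\<integral>\<^sup>+y. g y \<partial>R) \<le> ennreal (2 * sqrt b)"
    "\<And>y \<theta> \<theta>'. y \<in> space R \<Longrightarrow> (\<theta>, \<theta>') \<in> S \<Longrightarrow> ennreal (norm (H y \<theta> - H y \<theta>')) \<le> g y"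
proof -
  interpret prob_space R by fact
  obtain g where g[measurable]: "g \<in> borel_measurable R"
    and le: "\<And>x. x \<in> space R \<Longrightarrow> (SUP (\<theta>, \<theta>') \<in> S. ennreal ((norm (H x \<theta> - H x \<theta>'))\<^sup>2)) \<le> g x"
    and int: "(\<integral>\<^sup>+x. g x \<partial>R) < ennreal b"
    using outer unfolding outer_expectation_def INF_less_iff by auto
  define a where "a = sqrt b"
  have a: "0 < a" "b = a * a" using b by (auto simp: a_def)
  show ?thesis
  proof
    show "(\<lambda>y. ennreal a + ennreal (1 / a) * g y) \<in> borel_measurable R" by measurable
    have "(\<integral>\<^sup>+y. ennreal a + ennreal (1 / a) * g y \<partial>R) = ennreal a + ennreal (1 / a) * (\<integral>\<^sup>+y. g y \<partial>R)"
      by (subst nn_integral_add) (auto simp: nn_integral_cmult emeasure_space_1)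
    also have "\<dots> \<le> ennreal a + ennreal (1 / a) * ennreal b"
      using int by (intro add_left_mono mult_left_mono) auto
    also have "\<dots> = ennreal (2 * sqrt b)"
      using a by (simp add: a_def[symmetric] flip: ennreal_mult ennreal_plus)
    finally show "(\<integral>\<^sup>+y. ennreal a + ennreal (1 / a) * g y \<partial>R) \<le> ennreal (2 * sqrt b)" .
    fix y \<theta> \<theta>' assume y: "y \<in> space R" and S: "(\<theta>, \<theta>') \<in> S"
    let ?d = "norm (H y \<theta> - H y \<theta>')"
    have "?d \<le> a + 1 / a * ?d\<^sup>2"
    proof (cases "?d \<le> a")
      case False
      then have "a * ?d \<le> ?d * ?d" by (intro mult_right_mono) auto
      then have "?d \<le> 1 / a * ?d\<^sup>2" using a(1) by (simp add: field_simps power2_eq_square)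
      then show ?thesis using a(1) by linarith
    qed (use a(1) in \<open>simp add: add_increasing2\<close>)
    then have "ennreal ?d \<le> ennreal (a + 1 / a * ?d\<^sup>2)" by (rule ennreal_leI)
    also have "\<dots> = ennreal a + ennreal (1 / a) * ennreal (?d\<^sup>2)"
      using a(1) by (simp flip: ennreal_mult ennreal_plus)
    also have "ennreal (?d\<^sup>2) \<le> (SUP (\<theta>, \<theta>') \<in> S. ennreal ((norm (H y \<theta> - H y \<theta>'))\<^sup>2))"
      by (rule SUP_upper2[OF S]) simp
    also note le[OF y]
    finally show "ennreal ?d \<le> ennreal a + ennreal (1 / a) * g y"
      by (simp add: mult_left_mono)
  qed
qed

lemma le_Max_atLeastAtMost:
  fixes f :: "nat \<Rightarrow> 'a::linorder"
  shows "r \<le> s \<Longrightarrow> f r \<le> (MAX r\<in>{0..s}. f r)"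
  by (rule Max_ge) auto

context iid_noise_space
begin

text \<open>Almost sure equality is assumed only along the past at time 0. It is a statement about
  the law of the past, hence holds at every time, and countably many times can be combined.\<close>

lemma window_law_eq:
  fixes H :: "(nat \<Rightarrow> real) \<Rightarrow> 'c \<Rightarrow> real^'d::finite" and H' :: "(nat \<Rightarrow> real) \<Rightarrow> 'e \<Rightarrow> real^'d"
  assumes meas: "(\<lambda>y. H y a) \<in> borel_measurable Rinf" "(\<lambda>y. H' y b) \<in> borel_measurable Rinf"
    and eq: "AE x in M. H (past eps 0 x) a = H' (past eps 0 x) b"
  shows "(window_law M eps m H a :: (real^'d^'m::finite) measure) = window_law M eps m H' b"
  unfolding window_law_def
proof (rule distr_cong_AE)
  have mj: "(\<lambda>x. H (past eps j x) a) \<in> borel_measurable M" "(\<lambda>x. H' (past eps j x) b) \<in> borel_measurable M" for j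
    using measurable_compose[OF measurable_past(1)] meas by blast+
  then show "(\<lambda>x. window m (\<lambda>j. H (past eps j x) a) 0 :: real^'d^'m) \<in> borel_measurable M"
    "(\<lambda>x. window m (\<lambda>j. H' (past eps j x) b) 0 :: real^'d^'m) \<in> borel_measurable M"
    by (auto intro: borel_measurable_window)
  note [measurable] = meas
  have S: "{y \<in> space Rinf. H y a = H' y b} \<in> sets Rinf" by measurable
  have "AE y in N. H y a = H' y b"
    unfolding noise_law_def using eq by (subst AE_distr_iff[OF measurable_past(1) S])
  then have "AE x in M. H (past eps j x) a = H' (past eps j x) b" for j
    unfolding past_law(1)[of j, symmetric] by (subst (asm) AE_distr_iff[OF measurable_past(1) S])
  then have "AE x in M. \<forall>j. H (past eps j x) a = H' (past eps j x) b" by (subst AE_all_countable) blast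
  then show "AE x in M. (window m (\<lambda>j. H (past eps j x) a) 0 :: real^'d^'m) = window m (\<lambda>j. H' (past eps j x) b) 0"
    by eventually_elim simp
qed auto

lemma integral_window_law_rff:
  fixes H :: "(nat \<Rightarrow> real) \<Rightarrow> 'c \<Rightarrow> real^'d::finite" and \<Omega> :: "'k::finite \<Rightarrow> real^'d^'m::finite"
  assumes m: "CARD('m) = m + 1" and meas: "(\<lambda>y. H y a) \<in> borel_measurable Rinf"
  shows "(LINT x|window_law M eps m H a. rff \<Omega> \<alpha> x) $ c = (\<integral>y. feature m (\<Omega> c) (\<alpha> c) (\<lambda>b y. H y a) y \<partial>N)"
proof -
  have mj: "(\<lambda>x. H (past eps j x) a) \<in> borel_measurable M" for j
    using measurable_compose[OF measurable_past(1)] meas by blast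
  then have mw: "(\<lambda>x. window m (\<lambda>j. H (past eps j x) a) 0 :: real^'d^'m) \<in> borel_measurable M"
    by (rule borel_measurable_window)
  interpret W: prob_space "window_law M eps m H a :: (real^'d^'m) measure"
    unfolding window_law_def by (rule prob_space_distr[OF mw])
  have nth: "rff \<Omega> \<alpha> x $ c = cos (\<Omega> c \<bullet> x + \<alpha> c)" for x by (simp add: rff_def)
  have mr: "rff \<Omega> \<alpha> \<in> borel_measurable borel"
    unfolding rff_def by (intro borel_measurable_continuous_onI continuous_intros)
  have "norm (rff \<Omega> \<alpha> x) \<le> real CARD('k)" for x
  proof -
    have "norm (rff \<Omega> \<alpha> x) \<le> (\<Sum>c\<in>UNIV. \<bar>rff \<Omega> \<alpha> x $ c\<bar>)" by (rule norm_le_l1_cart)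
    also have "\<dots> \<le> (\<Sum>c\<in>(UNIV::'k set). 1)" by (intro sum_mono) (simp add: rff_def)
    finally show ?thesis by simp
  qed
  then have int: "integrable (window_law M eps m H a) (rff \<Omega> \<alpha>)"
    using mr by (intro W.integrable_const_bound[where B="real CARD('k)"]) (auto simp: window_law_def)
  have "(LINT x|window_law M eps m H a. rff \<Omega> \<alpha> x) $ c = (LINT x|window_law M eps m H a. rff \<Omega> \<alpha> x $ c)"
    by (rule integral_bounded_linear[OF bounded_linear_vec_nth int, symmetric])
  also have "\<dots> = (\<integral>x. cos (\<Omega> c \<bullet> window m (\<lambda>j. H (past eps j x) a) 0 + \<alpha> c) \<partial>M)"
    unfolding nth window_law_def using mw by (subst integral_distr) auto
  also have "\<dots> = (\<integral>x. feature m (\<Omega> c) (\<alpha> c) (\<lambda>b y. H y a) (past eps 0 x) \<partial>M)"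
    using window_feature[OF m, of "\<Omega> c" "\<alpha> c" "\<lambda>_ y. H y a" 0 eps] by simp
  also have "\<dots> = (\<integral>y. feature m (\<Omega> c) (\<alpha> c) (\<lambda>b y. H y a) y \<partial>N)"
    unfolding noise_law_def using measurable_feature[OF m, of "\<lambda>b y. H y a"] meas
    by (subst integral_distr[OF measurable_past(1)]) auto
  finally show ?thesis .
qed

end

theorem theorem4:
  fixes M :: "'w measure"
    and eps epsst :: "int \<Rightarrow> 'w \<Rightarrow> real"
    and epsc :: "nat \<Rightarrow> int \<Rightarrow> 'w \<Rightarrow> real"
    and D :: "'z measure"
    and \<Omega> :: "'k::finite \<Rightarrow> 'z \<Rightarrow> real^'d::finite^'m::finite"
    and \<alpha> :: "'k \<Rightarrow> 'z \<Rightarrow> real"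
    and z :: 'z
    and \<phi> :: "real^'d^'m \<Rightarrow> real^'k"
    and s m :: nat
    and \<Theta> :: "(real^'p::finite) set"
    and \<theta>0 :: "real^'p"
    and G :: "nat \<Rightarrow> nat \<Rightarrow> real \<Rightarrow> (nat \<Rightarrow> real) \<Rightarrow> real^'p \<Rightarrow> real^'d"
    and Glim :: "real \<Rightarrow> (nat \<Rightarrow> real) \<Rightarrow> real^'p \<Rightarrow> real^'d"
    and g :: "real \<Rightarrow> real^'p \<Rightarrow> real^'pt::finite"
    and Gt :: "real \<Rightarrow> (nat \<Rightarrow> real) \<Rightarrow> real^'pt \<Rightarrow> real^'d"
    and \<Theta>t :: "real \<Rightarrow> (real^'pt) set"
    and P :: "real^'p \<Rightarrow> real \<Rightarrow> (real^'d^'m) measure"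
    and Pt :: "real^'pt \<Rightarrow> real \<Rightarrow> (real^'d^'m) measure"
    and \<psi>t :: "real^'pt \<Rightarrow> real \<Rightarrow> real^'d^'m \<Rightarrow> complex"
    and Xobs :: "nat \<Rightarrow> int \<Rightarrow> 'w \<Rightarrow> real^'d"
    and Xsim :: "nat \<Rightarrow> nat \<Rightarrow> int \<Rightarrow> real^'p \<Rightarrow> 'w \<Rightarrow> real^'d"
    and w \<tau> L :: "nat \<Rightarrow> nat"
    and \<theta>hat :: "nat \<Rightarrow> 'w \<Rightarrow> real^'p"
    and q \<kappa> \<rho> \<Lambda> :: real
  assumes s: "1 \<le> s"
    and m: "CARD('m) = m + 1"
    and k: "CARD('k) = 2 * CARD('p) + 1"
    and \<theta>0: "\<theta>0 \<in> \<Theta>"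
    \<comment> \<open>noise and mappings\<close>
    and M: "prob_space M"
    and noise: "iid_noise M s eps epsst epsc"
    and G_measurable: "\<And>i r u. 1 \<le> i \<Longrightarrow> r \<le> s \<Longrightarrow> u \<in> {0..1} \<Longrightarrow>
      (\<lambda>(x, \<theta>). G i r u x \<theta>) \<in> borel_measurable (Rinf \<Otimes>\<^sub>M restrict_space borel \<Theta>)"
    and G_ergodic: "\<And>i r u \<theta>. 1 \<le> i \<Longrightarrow> r \<le> s \<Longrightarrow> u \<in> {0..1} \<Longrightarrow> \<theta> \<in> \<Theta> \<Longrightarrow>
      stationary_ergodic M (\<lambda>j x. G i r u (past eps j x) \<theta>)"
    \<comment> \<open>random Fourier features at the realized draw\<close>
    and draw: "rff_draw D \<Omega> \<alpha>" "z \<in> space D"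
    and \<phi>: "\<phi> = rff (\<lambda>i. \<Omega> i z) (\<lambda>i. \<alpha> i z)"
    \<comment> \<open>window size, offset, lag, estimator\<close>
    and seq_pos: "\<And>n. 1 \<le> n \<Longrightarrow> 1 \<le> w n \<and> 1 \<le> \<tau> n \<and> 1 \<le> L n"
    and estimator: "approx_minimizer M \<Theta> {n. m < n}
      (\<lambda>n \<theta> x. Q_RW m s \<phi> (w n) (\<tau> n) (L n) n (\<lambda>t. Xobs n t x) (\<lambda>r t. Xsim n r t \<theta> x)) \<theta>hat"
    and B1_obs: "\<And>n t x. 1 \<le> n \<Longrightarrow> t \<in> {1..int n} \<Longrightarrow> x \<in> space M \<Longrightarrow>
      Xobs n t x = G n 0 (real_of_int t / real n) (past (epsc 0) t x) \<theta>0"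
    and B1_sim: "\<And>n r t \<theta> x. 1 \<le> n \<Longrightarrow> r \<in> {1..s} \<Longrightarrow> t \<in> {1..int n} \<Longrightarrow> \<theta> \<in> \<Theta> \<Longrightarrow> x \<in> space M \<Longrightarrow>
      Xsim n r t \<theta> x = G n r (real_of_int t / real n) (past (epsc r) t x) \<theta>"
    and B2_measurable: "\<And>u. u \<in> {0..1} \<Longrightarrow>
      (\<lambda>(x, \<theta>). Glim u x \<theta>) \<in> borel_measurable (Rinf \<Otimes>\<^sub>M restrict_space borel \<Theta>)"
    and B2_ergodic: "\<And>u \<theta>. u \<in> {0..1} \<Longrightarrow> \<theta> \<in> \<Theta> \<Longrightarrow>
      stationary_ergodic M (\<lambda>j x. Glim u (past eps j x) \<theta>)"
    and B2_limit: "\<exists>q2>2. (\<lambda>i. SUP \<theta>\<in>\<Theta>. SUP u\<in>{0..1}. MAX r\<in>{0..s}.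
      Lq_norm M q2 (\<lambda>x. G i r u (past eps 0 x) \<theta> - Glim u (past eps 0 x) \<theta>)) \<longlonglongrightarrow> 0"
    and B3_map: "\<And>u. u \<in> {0..1} \<Longrightarrow> (\<exists>C. C-lipschitz_on \<Theta> (g u)) \<and> semialgebraic_map_on \<Theta> (g u)"
    and B3_image: "\<And>u. \<Theta>t u = g u ` \<Theta>"
    and B3_measurable: "\<And>u. u \<in> {0..1} \<Longrightarrow>
      (\<lambda>(x, \<theta>). Gt u x \<theta>) \<in> borel_measurable (Rinf \<Otimes>\<^sub>M restrict_space borel (\<Theta>t u))"
    and B3_eq: "\<And>u \<theta>. u \<in> {0..1} \<Longrightarrow> \<theta> \<in> \<Theta> \<Longrightarrow>
      AE x in M. Gt u (past eps 0 x) (g u \<theta>) = Glim u (past eps 0 x) \<theta>"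
    and B3_ergodic: "\<And>u \<theta>. u \<in> {0..1} \<Longrightarrow> \<theta> \<in> \<Theta>t u \<Longrightarrow>
      stationary_ergodic M (\<lambda>j x. Gt u (past eps j x) \<theta>)"
    and B3_joint: "(\<lambda>(u, \<theta>). g u \<theta>) \<in> borel_measurable (restrict_space borel ({0..1} \<times> \<Theta>))"
    and P: "\<And>\<theta> u. P \<theta> u = window_law M eps m (Glim u) \<theta>"
    and Pt: "\<And>\<theta> u. Pt \<theta> u = window_law M eps m (Gt u) \<theta>"
    and \<psi>t: "\<And>\<theta> u \<omega>. \<psi>t \<theta> u \<omega> = char_fun (Pt \<theta> u) \<omega>"
    and B4_i: "\<And>u. u \<in> {0..1} \<Longrightarrow> compact (\<Theta>t u)"
      "compact \<Theta>" "semialgebraic \<Theta>" "interior \<Theta> \<noteq> {}"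
    and B4_ii: "\<And>u. u \<in> {0..1} \<Longrightarrow> inj_on (\<lambda>\<theta>. Pt \<theta> u) (\<Theta>t u)"
    and B4_iii: "\<And>u. u \<in> {0..1} \<Longrightarrow> \<exists>U F. open U \<and> \<Theta>t u \<subseteq> U \<and>
      complex_real_analytic_on F (U \<times> (UNIV :: (real^'d^'m) set)) \<and>
      (\<forall>\<theta>\<in>\<Theta>t u. \<forall>\<omega>. F (\<theta>, \<omega>) = \<psi>t \<theta> u \<omega>)"
    and B5_i: "\<And>U. open U \<Longrightarrow> {u \<in> {0..1}. \<Theta>t u \<inter> U \<noteq> {}} \<in> sets borel"
    and B5_ii: "\<exists>\<psi>bar :: real \<Rightarrow> real^'pt \<Rightarrow> real^'d^'m \<Rightarrow> complex.
      (\<lambda>(u, \<theta>, \<omega>). \<psi>bar u \<theta> \<omega>) \<in> borel_measurable (restrict_space borel ({0..1} \<times> UNIV)) \<and>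
      (\<forall>u\<in>{0..1}. \<forall>\<theta>\<in>\<Theta>t u. \<forall>\<omega>. \<psi>bar u \<theta> \<omega> = \<psi>t \<theta> u \<omega>) \<and>
      (\<forall>u\<in>{0..1}. \<forall>\<omega>. continuous_on UNIV (\<lambda>\<theta>. \<psi>bar u \<theta> \<omega>))"
    and B6: "AE u in lborel. u \<in> {0..1} \<longrightarrow> inj_on (\<lambda>\<theta>. LINT x|Pt \<theta> u. \<phi> x) (\<Theta>t u)"
    and B7: "\<And>\<theta>1 \<theta>2. \<theta>1 \<in> \<Theta> \<Longrightarrow> \<theta>2 \<in> \<Theta> \<Longrightarrow> \<theta>1 \<noteq> \<theta>2 \<Longrightarrow>
      \<exists>U\<subseteq>{0..1}. U \<in> sets lebesgue \<and> 0 < emeasure lebesgue U \<and> (\<forall>u\<in>U. P \<theta>1 u \<noteq> P \<theta>2 u)"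
    and B8: "\<exists>\<eta> :: real \<Rightarrow> real. (\<eta> \<longlongrightarrow> 0) (at_right 0) \<and> (\<forall>\<epsilon>>0. 0 < \<eta> \<epsilon> \<and>
      (SUP i\<in>{1..}. SUP u\<in>{0..1}. MAX r\<in>{0..s}. outer_expectation (noise_law M eps)
        (\<lambda>e. SUP (\<theta>, \<theta>') \<in> {(\<theta>, \<theta>'). \<theta> \<in> \<Theta> \<and> \<theta>' \<in> \<Theta> \<and> norm (\<theta> - \<theta>') \<le> \<epsilon>}.
          ennreal ((norm (G i r u e \<theta> - G i r u e \<theta>'))\<^sup>2))) < ennreal (\<eta> \<epsilon>))"
    and B9_const: "0 < \<rho>" "\<rho> < 1" "0 < \<Lambda>" "2 < q"
    and B9_dep: "\<And>j. (SUP i\<in>{1..}. SUP \<theta>\<in>\<Theta>. SUP u\<in>{0..1}. MAX r\<in>{0..s}.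
      Lq_norm M q (\<lambda>x. G i r u (past eps 0 x) \<theta> - G i r u (past_replaced eps epsst 0 j x) \<theta>))
        \<le> ennreal (\<Lambda> * \<rho> ^ j)"
    and B9_bound: "(SUP i\<in>{1..}. SUP \<theta>\<in>\<Theta>. SUP u\<in>{0..1}. MAX r\<in>{0..s}.
      Lq_norm M q (\<lambda>x. G i r u (past eps 0 x) \<theta>)) \<le> ennreal \<Lambda>"
    and B10_const: "1 \<le> \<kappa>" "\<kappa> < 4"
    and B10: "\<exists>q10>2. (SUP i\<in>{1..}. SUP \<theta>\<in>\<Theta>. MAX r\<in>{0..s}.
      (SUP u\<in>{0..1}. Lq_norm M q10 (\<lambda>x. G i r u (past eps 0 x) \<theta>)) +
      kappa_variation M q10 \<kappa> (\<lambda>u x. G i r u (past eps 0 x) \<theta>)) \<le> ennreal \<Lambda>"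
    and B11_i: "(\<lambda>n. real (\<tau> n)) \<in> o(\<lambda>n. real n)"
    and B11_ii: "(\<lambda>n. real n powr (2 / q)) \<in> o(\<lambda>n. real (w n))"
      "(\<lambda>n. real (w n)) \<in> o(\<lambda>n. real n)"
      "(\<lambda>n. real (w n) * real n powr max (1 - 2 / \<kappa>) 0) \<in> o(\<lambda>n. real n)"
    and B11_iii: "\<exists>a. 0 < a \<and> a < 1 \<and> (\<lambda>n. ln (real n) powr (1 + a)) \<in> o(\<lambda>n. real (L n))"
      "(\<lambda>n. real (L n)) \<in> o(\<lambda>n. real (\<tau> n))"
      "(\<lambda>n. real (L n)) \<in> o(\<lambda>n. real n powr (1 / \<kappa> - 1 / 4))"
      "(\<lambda>n. real (L n)) \<in> o(\<lambda>n. real n powr (1 / (2 * \<kappa>)))"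
  shows "tendsto_in_prob M \<theta>hat \<theta>0"
proof -
  interpret noise: iid_noise_space M s eps epsst epsc
    by (intro iid_noise_space.intro M iid_noise_space_axioms.intro noise)
  let ?N = "noise_law M eps"
  have G_meas: "(\<lambda>y. G i r u y \<theta>) \<in> borel_measurable Rinf"
    if "1 \<le> i" "r \<le> s" "u \<in> {0..1}" "\<theta> \<in> \<Theta>" for i r u \<theta>
    using G_measurable[OF that(1-3)] that(4) by (rule measurable_fix_parameter)
  have Glim_meas: "(\<lambda>y. Glim u y \<theta>) \<in> borel_measurable Rinf" if "u \<in> {0..1}" "\<theta> \<in> \<Theta>" for u \<theta>
    using B2_measurable[OF that(1)] that(2) by (rule measurable_fix_parameter)
  have Gp_meas: "(\<lambda>x. G i r u (past eps 0 x) \<theta>) \<in> borel_measurable M"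
    if "1 \<le> i" "r \<le> s" "u \<in> {0..1}" "\<theta> \<in> \<Theta>" for i r u \<theta>
    using measurable_compose[OF noise.measurable_past(1) G_meas[OF that]] .
  have Glimp_meas: "(\<lambda>x. Glim u (past eps 0 x) \<theta>) \<in> borel_measurable M"
    if "u \<in> {0..1}" "\<theta> \<in> \<Theta>" for u \<theta>
    using measurable_compose[OF noise.measurable_past(1) Glim_meas[OF that]] .
  have past_N: "(\<integral>\<^sup>+y. ennreal (norm (H y - H' y)) \<partial>?N) = (\<integral>\<^sup>+x. ennreal (norm (H (past eps 0 x) - H' (past eps 0 x))) \<partial>M)"
    if "H \<in> borel_measurable Rinf" "H' \<in> borel_measurable Rinf" for H H' :: "(nat \<Rightarrow> real) \<Rightarrow> real^'d"
    using noise.nn_integral_past[of "\<lambda>y. ennreal (norm (H y - H' y))" 0] that by simp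
  \<comment> \<open>Here and in the interpretation below, the factor 2 stems from the comparison of
    \<open>L1\<close> with \<open>Lq_norm\<close>.\<close>
  have G_dep: "(\<integral>\<^sup>+z. ennreal (norm (G i r u (fst z) \<theta> - G i r u ((fst z)(j := snd z 0)) \<theta>)) \<partial>(?N \<Otimes>\<^sub>M ?N)) \<le> ennreal (2 * \<Lambda> * \<rho> ^ j)"
    if "1 \<le> i" "r \<le> s" "u \<in> {0..1}" "\<theta> \<in> \<Theta>" for i r u \<theta> j
  proof -
    have pr: "past_replaced eps epsst 0 j \<in> measurable M Rinf"
    proof -
      have "past_replaced eps epsst 0 j = (\<lambda>x l. noise_var eps epsst epsc (if l = j then Star (0 - int l) else Base (0 - int l)) x)"
        by (auto simp: past_replaced_def noise_var_def fun_eq_iff)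
      then show ?thesis using noise.measurable_noise_seq[of "\<lambda>l. if l = j then Star (0 - int l) else Base (0 - int l)"]
        by (simp add: noise_indices_def)
    qed
    have "Lq_norm M q (\<lambda>x. G i r u (past eps 0 x) \<theta> - G i r u (past_replaced eps epsst 0 j x) \<theta>) \<le>
        (MAX r\<in>{0..s}. Lq_norm M q (\<lambda>x. G i r u (past eps 0 x) \<theta> - G i r u (past_replaced eps epsst 0 j x) \<theta>))"
      using that(2) by (rule le_Max_atLeastAtMost)
    also have "\<dots> \<le> (SUP i\<in>{1..}. SUP \<theta>\<in>\<Theta>. SUP u\<in>{0..1}. MAX r\<in>{0..s}.
      Lq_norm M q (\<lambda>x. G i r u (past eps 0 x) \<theta> - G i r u (past_replaced eps epsst 0 j x) \<theta>))"
      using that by (intro SUP_upper2[of i] SUP_upper2[of \<theta>] SUP_upper2[of u]) auto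
    also note B9_dep[of j]
    finally have "(\<integral>\<^sup>+x. ennreal (norm (G i r u (past eps 0 x) \<theta> - G i r u (past_replaced eps epsst 0 j x) \<theta>)) \<partial>M) \<le> ennreal (2 * (\<Lambda> * \<rho> ^ j))"
      using B9_const measurable_compose[OF pr G_meas[OF that]] Gp_meas[OF that]
      by (intro L1_le_of_Lq_norm_le[OF M, of _ q]) auto
    then show ?thesis
      unfolding noise.nn_integral_past_replaced[OF G_meas[OF that]] by (simp add: mult.assoc)
  qed
  obtain q2 where q2: "2 < q2" and lim2: "(\<lambda>i. SUP \<theta>\<in>\<Theta>. SUP u\<in>{0..1}. MAX r\<in>{0..s}.
      Lq_norm M q2 (\<lambda>x. G i r u (past eps 0 x) \<theta> - Glim u (past eps 0 x) \<theta>)) \<longlonglongrightarrow> 0"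
    using B2_limit by blast
  define S2 where "S2 i = (SUP \<theta>\<in>\<Theta>. SUP u\<in>{0..1}. MAX r\<in>{0..s}.
      Lq_norm M q2 (\<lambda>x. G i r u (past eps 0 x) \<theta> - Glim u (past eps 0 x) \<theta>))" for i
  have S2: "S2 \<longlonglongrightarrow> 0" using lim2 by (simp add: S2_def[abs_def])
  define e where "e i = 2 * enn2real (S2 i)" for i
  have e_lim: "e \<longlonglongrightarrow> 0"
  proof -
    have "(\<lambda>i. enn2real (S2 i)) \<longlonglongrightarrow> 0" using S2 by (intro tendsto_enn2real) auto
    then show ?thesis unfolding e_def[abs_def] by (rule tendsto_mult_right_zero)
  qed
  have G_lim: "\<forall>\<^sub>F i in sequentially. 0 \<le> e i \<and> (\<forall>r u \<theta>. r \<le> s \<longrightarrow> u \<in> {0..1} \<longrightarrow> \<theta> \<in> \<Theta> \<longrightarrow>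
      (\<integral>\<^sup>+y. ennreal (norm (G i r u y \<theta> - Glim u y \<theta>)) \<partial>?N) \<le> ennreal (e i))"
    using order_tendstoD(2)[OF S2, of 1, simplified] eventually_ge_at_top[of 1]
  proof eventually_elim
    case (elim i)
    \<comment> \<open>The supremum is known to be finite only once it is below 1, and
      \<open>enn2real\<close> is faithful only there; hence the bound is stated eventually.\<close>
    have S2r: "S2 i = ennreal (enn2real (S2 i))"
      using elim(1) by (intro ennreal_enn2real[symmetric]) (auto intro: less_trans[OF _ ennreal_one_less_top])
    show ?case
    proof (intro conjI allI impI)
      show "0 \<le> e i" by (simp add: e_def)
      fix r u \<theta> assume a: "r \<le> s" "u \<in> {0..1::real}" "\<theta> \<in> \<Theta>"
      have "Lq_norm M q2 (\<lambda>x. G i r u (past eps 0 x) \<theta> - Glim u (past eps 0 x) \<theta>) \<le>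
          (MAX r\<in>{0..s}. Lq_norm M q2 (\<lambda>x. G i r u (past eps 0 x) \<theta> - Glim u (past eps 0 x) \<theta>))"
        using a(1) by (rule le_Max_atLeastAtMost)
      also have "\<dots> \<le> S2 i"
        unfolding S2_def using a by (intro SUP_upper2[of \<theta>] SUP_upper2[of u]) auto
      also note S2r
      finally have "(\<integral>\<^sup>+x. ennreal (norm (G i r u (past eps 0 x) \<theta> - Glim u (past eps 0 x) \<theta>)) \<partial>M) \<le> ennreal (2 * enn2real (S2 i))"
        using q2 Gp_meas[OF elim(2) a] Glimp_meas[OF a(2,3)]
        by (intro L1_le_of_Lq_norm_le[OF M, of _ q2]) auto
      then show "(\<integral>\<^sup>+y. ennreal (norm (G i r u y \<theta> - Glim u y \<theta>)) \<partial>?N) \<le> ennreal (e i)"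
        unfolding e_def using past_N[OF G_meas[OF elim(2) a] Glim_meas[OF a(2,3)]] by simp
    qed
  qed
  obtain q10 where q10: "2 < q10" and B10': "(SUP i\<in>{1..}. SUP \<theta>\<in>\<Theta>. MAX r\<in>{0..s}.
      (SUP u\<in>{0..1}. Lq_norm M q10 (\<lambda>x. G i r u (past eps 0 x) \<theta>)) +
      kappa_variation M q10 \<kappa> (\<lambda>u x. G i r u (past eps 0 x) \<theta>)) \<le> ennreal \<Lambda>"
    using B10 by blast
  have G_kvar: "\<exists>d. bounded_kvar \<kappa> ((2 * \<Lambda>) powr \<kappa>) d \<and>
      (\<forall>u\<in>{0..1}. \<forall>v\<in>{0..1}. (\<integral>\<^sup>+y. ennreal (norm (G i r u y \<theta> - G i r v y \<theta>)) \<partial>?N) \<le> ennreal (d u v))"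
    if i: "1 \<le> i" and r: "r \<le> s" and \<theta>: "\<theta> \<in> \<Theta>" for i r \<theta>
  proof -
    let ?f = "\<lambda>r. (SUP u\<in>{0..1}. Lq_norm M q10 (\<lambda>x. G i r u (past eps 0 x) \<theta>)) +
      kappa_variation M q10 \<kappa> (\<lambda>u x. G i r u (past eps 0 x) \<theta>)"
    have "kappa_variation M q10 \<kappa> (\<lambda>u x. G i r u (past eps 0 x) \<theta>) \<le> ?f r" by simp
    also have "\<dots> \<le> (MAX r\<in>{0..s}. ?f r)" using r by (rule le_Max_atLeastAtMost)
    also have "\<dots> \<le> (SUP i\<in>{1..}. SUP \<theta>\<in>\<Theta>. MAX r\<in>{0..s}.
      (SUP u\<in>{0..1}. Lq_norm M q10 (\<lambda>x. G i r u (past eps 0 x) \<theta>)) +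
      kappa_variation M q10 \<kappa> (\<lambda>u x. G i r u (past eps 0 x) \<theta>))"
      using i \<theta> by (intro SUP_upper2[of i] SUP_upper2[of \<theta>]) auto
    also note B10'
    finally have kv: "kappa_variation M q10 \<kappa> (\<lambda>u x. G i r u (past eps 0 x) \<theta>) \<le> ennreal \<Lambda>" .
    obtain d where d: "bounded_kvar \<kappa> ((2 * \<Lambda>) powr \<kappa>) d"
      "\<And>u v. u \<in> {0..1} \<Longrightarrow> v \<in> {0..1} \<Longrightarrow>
        (\<integral>\<^sup>+x. ennreal (norm (G i r u (past eps 0 x) \<theta> - G i r v (past eps 0 x) \<theta>)) \<partial>M) \<le> ennreal (d u v)"
    proof -
      have "1 \<le> q10" "0 \<le> \<Lambda>" using q10 B9_const by auto
      from kappa_variation_imp_bounded_kvar[OF M Gp_meas[OF i r _ \<theta>] this(1) B10_const(1) this(2) kv]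
      show thesis using that by blast
    qed
    have "(\<integral>\<^sup>+y. ennreal (norm (G i r u y \<theta> - G i r v y \<theta>)) \<partial>?N) \<le> ennreal (d u v)"
      if "u \<in> {0..1}" "v \<in> {0..1}" for u v
      using d(2)[OF that] past_N[OF G_meas[OF i r that(1) \<theta>] G_meas[OF i r that(2) \<theta>]] by simp
    with d(1) show ?thesis by blast
  qed
  obtain \<eta> where \<eta>: "(\<eta> \<longlongrightarrow> 0) (at_right 0)" and \<eta>': "\<And>\<epsilon>. 0 < \<epsilon> \<Longrightarrow> 0 < \<eta> \<epsilon> \<and>
      (SUP i\<in>{1..}. SUP u\<in>{0..1}. MAX r\<in>{0..s}. outer_expectation (noise_law M eps)
        (\<lambda>e. SUP (\<theta>, \<theta>') \<in> {(\<theta>, \<theta>'). \<theta> \<in> \<Theta> \<and> \<theta>' \<in> \<Theta> \<and> norm (\<theta> - \<theta>') \<le> \<epsilon>}.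
          ennreal ((norm (G i r u e \<theta> - G i r u e \<theta>'))\<^sup>2))) < ennreal (\<eta> \<epsilon>)"
    using B8 by blast
  have \<eta>_lim: "((\<lambda>\<epsilon>. 2 * sqrt (\<eta> \<epsilon>)) \<longlongrightarrow> 0) (at_right 0)"
    using tendsto_mult_right_zero[OF tendsto_real_sqrt[OF \<eta>, simplified]] by simp
  have G_equi: "0 \<le> 2 * sqrt (\<eta> \<epsilon>) \<and>
      (\<exists>g\<in>borel_measurable Rinf. (\<integral>\<^sup>+y. g y \<partial>?N) \<le> ennreal (2 * sqrt (\<eta> \<epsilon>)) \<and>
        (\<forall>y. \<forall>\<theta>\<in>\<Theta>. \<forall>\<theta>'\<in>\<Theta>. norm (\<theta> - \<theta>') \<le> \<epsilon> \<longrightarrow> ennreal (norm (G i r u y \<theta> - G i r u y \<theta>')) \<le> g y))"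
    if a: "1 \<le> i" "r \<le> s" "u \<in> {0..1}" "0 < \<epsilon>" for i r u \<epsilon>
  proof -
    let ?S = "{(\<theta>, \<theta>'). \<theta> \<in> \<Theta> \<and> \<theta>' \<in> \<Theta> \<and> norm (\<theta> - \<theta>') \<le> \<epsilon>}"
    let ?o = "\<lambda>i u r. outer_expectation ?N (\<lambda>e. SUP (\<theta>, \<theta>') \<in> ?S. ennreal ((norm (G i r u e \<theta> - G i r u e \<theta>'))\<^sup>2))"
    have "?o i u r \<le> (MAX r\<in>{0..s}. ?o i u r)" using a(2) by (rule le_Max_atLeastAtMost)
    also have "\<dots> \<le> (SUP i\<in>{1..}. SUP u\<in>{0..1}. MAX r\<in>{0..s}. ?o i u r)"
      using a by (intro SUP_upper2[of i] SUP_upper2[of u]) auto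
    also have "\<dots> < ennreal (\<eta> \<epsilon>)" using \<eta>'[OF a(4)] by blast
    finally have lt: "?o i u r < ennreal (\<eta> \<epsilon>)" .
    have pos: "0 < \<eta> \<epsilon>" using \<eta>'[OF a(4)] by blast
    obtain g where "g \<in> borel_measurable ?N" "(\<integral>\<^sup>+y. g y \<partial>?N) \<le> ennreal (2 * sqrt (\<eta> \<epsilon>))"
      "\<And>y \<theta> \<theta>'. y \<in> space ?N \<Longrightarrow> (\<theta>, \<theta>') \<in> ?S \<Longrightarrow> ennreal (norm (G i r u y \<theta> - G i r u y \<theta>')) \<le> g y"
      by (rule L1_modulus_of_outer_expectation[where H="G i r u" and S="?S", OF noise.prob_space_N pos lt]) (rule that; blast)
    moreover have "space ?N = UNIV" by (simp add: noise_law_def space_PiM)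
    ultimately show ?thesis
      using pos measurable_cong_sets[OF noise.sets_N refl, of "borel :: ennreal measure"]
      by (intro conjI bexI[of _ g]) auto
  qed
  have rate0: "(\<lambda>n. real (f n) / real n) \<longlonglongrightarrow> 0" if "(\<lambda>n. real (f n)) \<in> o(\<lambda>n. real n)" for f :: "nat \<Rightarrow> nat"
    using smalloD_tendsto[OF that] .
  have L_rate: "(\<lambda>n. real (L n)) \<in> o(\<lambda>n. real n)"
    using B11_iii(2) B11_i by (rule landau_o.small_trans)
  have w_lim: "filterlim w at_top sequentially"
    unfolding filterlim_at_top
  proof
    fix Z :: nat
    \<comment> \<open>Since n^(2/q) is at least 1 and of smaller order than w, the ratio 1/(Z+1)
      already forces w above Z.\<close>
    have c: "0 < 1 / (real Z + 1)" by simp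
    have "\<forall>\<^sub>F n in sequentially. norm (real n powr (2 / q)) \<le> 1 / (real Z + 1) * norm (real (w n))"
      by (rule landau_o.smallD[OF B11_ii(1) c])
    then show "\<forall>\<^sub>F n in sequentially. Z \<le> w n"
      using eventually_ge_at_top[of 1]
    proof eventually_elim
      case (elim n)
      have "1 \<le> real n powr (2 / q)" using elim(2) B9_const by (intro ge_one_powr_ge_zero) auto
      also have "\<dots> \<le> real (w n) / (real Z + 1)" using elim(1) by simp
      finally have "real Z + 1 \<le> real (w n)" by (simp add: le_divide_eq)
      then show "Z \<le> w n" by simp
    qed
  qed
  interpret rw: rolling_window M ?N "\<lambda>r. past (epsc r)" s m \<Theta> \<theta>0 G Glim "\<lambda>i. \<Omega> i z" "\<lambda>i. \<alpha> i z"
    w \<tau> L \<kappa> "(2 * \<Lambda>) powr \<kappa>" \<rho> "2 * \<Lambda>" e "\<lambda>\<epsilon>. 2 * sqrt (\<eta> \<epsilon>)"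
  proof (intro rolling_window.intro rolling_window_axioms.intro M)
    show "noise.expectation (\<lambda>x. \<bar>\<Sum>t\<in>T. c t * (F t (past (epsc r) t x) - (\<integral>y. F t y \<partial>?N))\<bar>)
        \<le> B * sqrt (2 * C / (1 - \<rho>)\<^sup>2) * sqrt (card T)"
      if "r \<le> s" "finite T" "\<And>t. t \<in> T \<Longrightarrow> F t \<in> borel_measurable Rinf"
        "\<And>t y. t \<in> T \<Longrightarrow> \<bar>F t y\<bar> \<le> 1"
        "\<And>t j. t \<in> T \<Longrightarrow> (\<integral>y. \<bar>F t (fst y) - F t ((fst y)(j := snd y 0))\<bar> \<partial>(?N \<Otimes>\<^sub>M ?N)) \<le> C * \<rho> ^ j"
        "0 \<le> C" "\<And>t. t \<in> T \<Longrightarrow> \<bar>c t\<bar> \<le> B" "0 \<le> B" for r T F C c B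
    proof -
      \<comment> \<open>For the series driven by copy r, the base sequence plays the independent
        copy whose values are swapped in.\<close>
      have ab: "inj (Copy r)" "inj Base" "range (Copy r) \<subseteq> noise_indices s" "range Base \<subseteq> noise_indices s"
        "range (Copy r) \<inter> range Base = {}"
        using that(1) by (auto simp: noise_indices_def intro!: injI)
      show ?thesis
        unfolding noise.past_eq
        by (rule noise.weighted_sum_deviation[OF noise.indep noise.distr_noise ab noise.N_eq that(2-6) B9_const(1,2) that(7,8)])
    qed
  qed (use s m \<theta>0 B4_i(2) noise.prob_space_N noise.sets_N noise.shift_law noise.measurable_past(3)
      noise.past_law(2) G_meas Glim_meas G_dep B9_const B10_const e_lim G_lim G_kvar \<eta>_lim G_equi
      seq_pos w_lim rate0[OF B11_ii(2)] rate0[OF B11_i] rate0[OF L_rate] in \<open>simp_all\<close>)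
  have pos: "\<exists>c. \<exists>\<delta>>0. infinite {u\<in>{0..1}. \<delta> \<le> \<bar>rw.\<Phi>lim c u \<theta>0 - rw.\<Phi>lim c u \<theta>\<bar>}"
    if \<theta>: "\<theta> \<in> \<Theta>" "\<theta> \<noteq> \<theta>0" for \<theta>
  proof -
    obtain U where U: "U \<subseteq> {0..1}" "U \<in> sets lebesgue" "0 < emeasure lebesgue U" "\<And>u. u \<in> U \<Longrightarrow> P \<theta> u \<noteq> P \<theta>0 u"
      using B7[OF \<theta>(1) \<theta>0 \<theta>(2)] by blast
    let ?V = "{u\<in>U. u \<in> {0..1} \<longrightarrow> inj_on (\<lambda>\<theta>. LINT x|Pt \<theta> u. \<phi> x) (\<Theta>t u)}"
    show ?thesis
    proof (rule infinite_level_set)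
      show "uncountable ?V" by (rule uncountable_of_positive_measure[OF U(2,3) B6])
      show "?V \<subseteq> {0..1}" using U(1) by blast
      fix u assume "u \<in> ?V"
      then have uU: "u \<in> U" and u: "u \<in> {0..1}" and inj: "inj_on (\<lambda>\<theta>. LINT x|Pt \<theta> u. \<phi> x) (\<Theta>t u)"
        using U(1) by blast+
      \<comment> \<open>Different window laws at \<open>\<theta>\<close> and
        \<open>\<theta>0\<close> therefore force different reduced parameters \<open>g u\<close>,
        and on these the mean features are injective for almost every u.\<close>
      have PtP: "Pt (g u \<theta>) u = P \<theta> u" if "\<theta> \<in> \<Theta>" for \<theta>
      proof -
        have "g u \<theta> \<in> \<Theta>t u" using that by (simp add: B3_image)
        then show ?thesis unfolding P Pt
          using that u
          by (intro noise.window_law_eq measurable_fix_parameter[OF B3_measurable] Glim_meas B3_eq) auto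
      qed
      have "g u \<theta> \<noteq> g u \<theta>0" using U(4)[OF uU] PtP[OF \<theta>(1)] PtP[OF \<theta>0] by metis
      then have "(LINT x|Pt (g u \<theta>) u. \<phi> x) \<noteq> (LINT x|Pt (g u \<theta>0) u. \<phi> x)"
        using inj \<theta>(1) \<theta>0 by (auto simp: B3_image dest: inj_onD)
      then have "(LINT x|P \<theta> u. \<phi> x) \<noteq> (LINT x|P \<theta>0 u. \<phi> x)" using PtP \<theta>(1) \<theta>0 by simp
      then obtain c where "(LINT x|P \<theta> u. \<phi> x) $ c \<noteq> (LINT x|P \<theta>0 u. \<phi> x) $ c" by (auto simp: vec_eq_iff)
      then have "rw.\<Phi>lim c u \<theta> \<noteq> rw.\<Phi>lim c u \<theta>0"
        unfolding P \<phi> rw.\<Phi>lim_def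
        by (simp add: noise.integral_window_law_rff[OF m] Glim_meas[OF u \<theta>(1)] Glim_meas[OF u \<theta>0])
      then show "\<exists>c. rw.\<Phi>lim c u \<theta>0 - rw.\<Phi>lim c u \<theta> \<noteq> 0" by (intro exI[of _ c]) simp
    qed
  qed
  have Q_eq: "Q_RW m s \<phi> (w n) (\<tau> n) (L n) n (\<lambda>t. Xobs n t x) (\<lambda>r t. Xsim n r t \<theta> x) = rw.Q n \<theta> x"
    if n: "m < n" and \<theta>: "\<theta> \<in> \<Theta>" and x: "x \<in> space M" for n \<theta> x
    unfolding Q_RW_eq_sum_rw_crit rw.Q_def
  proof (intro sum.cong refl rw_crit_cong)
    have n1: "1 \<le> n" using n by simp
    show "1 \<le> \<tau> n" using seq_pos[OF n1] by simp
    fix c t assume t: "t \<in> {int m + 1..int n}"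
    \<comment> \<open>Every row of a window ending after m has its time in 1, ..., n, where the
      observed and simulated series are given by the maps.\<close>
    have rows: "t - int m + int (to_nat_on UNIV (a::'m)) \<in> {1..int n}" for a
      using t to_nat_on_le[OF m, of a] by auto
    have obs: "\<phi> (window m (\<lambda>t. Xobs n t x) t) $ c = rw.Fobs c n 0 \<theta>0 t (past (epsc 0) t x)"
    proof -
      have "window m (\<lambda>t. Xobs n t x) t = (window m (\<lambda>j. G n 0 (real_of_int j / real n) (past (epsc 0) j x) \<theta>0) t :: real^'d^'m)"
        unfolding window_def by (intro arg_cong[where f=vec_lambda] ext B1_obs[OF n1 rows x])
      then show ?thesis
        using window_feature[OF m, of "\<Omega> c z" "\<alpha> c z" "\<lambda>j y. G n 0 (real_of_int j / real n) y \<theta>0" t "epsc 0" x]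
        by (simp add: \<phi> rff_def rw.Fobs_def rw.rtime_def)
    qed
    have sim: "\<phi> (window m (\<lambda>t. Xsim n r t \<theta> x) t) $ c = rw.Fobs c n r \<theta> t (past (epsc r) t x)" if "r \<in> {1..s}" for r
    proof -
      have "window m (\<lambda>t. Xsim n r t \<theta> x) t = (window m (\<lambda>j. G n r (real_of_int j / real n) (past (epsc r) j x) \<theta>) t :: real^'d^'m)"
        unfolding window_def by (intro arg_cong[where f=vec_lambda] ext B1_sim[OF n1 that rows \<theta> x])
      then show ?thesis
        using window_feature[OF m, of "\<Omega> c z" "\<alpha> c z" "\<lambda>j y. G n r (real_of_int j / real n) y \<theta>" t "epsc r" x]
        by (simp add: \<phi> rff_def rw.Fobs_def rw.rtime_def)
    qed
    show "\<phi> (window m (\<lambda>t. Xobs n t x) t) $ c - 1 / real s * (\<Sum>r=1..s. \<phi> (window m (\<lambda>t. Xsim n r t \<theta> x) t) $ c) = rw.Y c n \<theta> t x"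
      unfolding rw.Y_def obs by (intro arg_cong2[where f="(-)"] arg_cong2[where f="(*)"] refl sum.cong sim)
  qed
  from estimator obtain R where est: "\<And>n. m < n \<Longrightarrow> \<theta>hat n \<in> measurable M (restrict_space borel \<Theta>)"
    and R: "\<And>n. R n \<in> borel_measurable M" "tendsto_in_prob M R 0"
    and min: "\<And>n. m < n \<Longrightarrow> AE x in M.
       \<bar>Q_RW m s \<phi> (w n) (\<tau> n) (L n) n (\<lambda>t. Xobs n t x) (\<lambda>r t. Xsim n r t (\<theta>hat n x) x)\<bar> \<le>
       (INF \<theta>\<in>\<Theta>. \<bar>Q_RW m s \<phi> (w n) (\<tau> n) (L n) n (\<lambda>t. Xobs n t x) (\<lambda>r t. Xsim n r t \<theta> x)\<bar>) + R n x"
    unfolding approx_minimizer_def by blast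
  show ?thesis
  proof (rule rw.consistency[OF pos est R])
    fix n assume n: "m < n"
    show "AE x in M. \<bar>rw.Q n (\<theta>hat n x) x\<bar> \<le> (INF \<theta>\<in>\<Theta>. \<bar>rw.Q n \<theta> x\<bar>) + R n x"
      using min[OF n] AE_space
    proof eventually_elim
      case (elim x)
      have "\<theta>hat n x \<in> \<Theta>" using measurable_space[OF est[OF n] elim(2)] by (simp add: space_restrict_space)
      then show ?case using elim by (simp add: Q_eq[OF n _ elim(2)] cong: INF_cong)
    qed
  qed
qed

end
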